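(* For any radial $f(\boldsymbol x)=\sum_{n\ge0}\alpha(n)\Psi_n(\boldsymbol x)\in L^2(\mathbb{R}^2,\mathrm{d}\boldsymbol x)$ we have $$\|e^{it\Delta}f(\boldsymbol x)\|^4_{L^4(\mathbb{R}^3,\mathrm{d}\boldsymbol x\,\mathrm{d}t)}=\frac1{16}\langle\varphi,\mathcal{Q}\varphi\rangle_{\mathcal{G}}\qquad\text{and}\qquad\big(2^{-1/2}\|f\|_{L^2(\mathbb{R}^2,\mathrm{d}\boldsymbol x)}\big)^4=\frac1{16}\|\varphi\|_{\mathcal{G}}^2,$$ where $\varphi(a,b)=\alpha(a)\alpha(b)$ for all integers $a,b\ge0$. For every integer $S\ge0$ the matrix $$\mathcal{Q}_S=[Q(a,S-a,c,S-c)]_{a,c=0,\dots,S}$$ is a positive semi-definite doubly stochastic matrix with strictly positive entries. Consequently $\|\mathcal{Q}\|_{\mathcal{G}\to\mathcal{G}}=1$. Furthermore, a function $\varphi\in\mathcal{G}$ satisfies $\langle\varphi,\mathcal{Q}\varphi\rangle_{\mathcal{G}}=\|\varphi\|_{\mathcal{G}}^2$ if and only if $\varphi(a,b)=\varphi(c,d)$ whenever $a+b=c+d$.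
   Context: $e^{it\Delta}f(\boldsymbol x)$ is the solution of $\partial_t u=i\Delta u$ on $\mathbb{R}^2\times\mathbb{R}$ with $u(\boldsymbol x,0)=f(\boldsymbol x)$. $L_n=L_n^{(0)}$ are the (standard) Laguerre polynomials: orthonormal polynomials for $e^{-x}\mathrm{d}x$ on $(0,\infty)$, with $L_n(0)=1$. $\Psi_n(\boldsymbol x)=L_n(2\pi\|\boldsymbol x\|^2)e^{-\pi\|\boldsymbol x\|^2}$, $\boldsymbol x\in\mathbb{R}^2$; these form an orthogonal basis of the space of radial functions in $L^2(\mathbb{R}^2,\mathrm{d}\boldsymbol x)$. $\mathbb{Z}_+=\{0,1,2,\dots\}$. $\mathcal{G}=\ell^2(\mathbb{Z}_+^2)$ is the Hilbert space of complex sequences $\{\varphi(a,b)\}_{(a,b)\in\mathbb{Z}_+^2}$ with $\|\varphi\|_{\mathcal{G}}^2=\sum_{a,b\ge0}|\varphi(a,b)|^2<\infty$ and inner product $\langle\varphi,\psi\rangle_{\mathcal{G}}=\sum_{a,b\ge0}\varphi(a,b)\overline{\psi(a,b)}$. For nonnegative integers, $$Q(a,b,c,d)=\int_0^\infty L_a(x/2)L_b(x/2)L_c(x/2)L_d(x/2)e^{-x}\,\mathrm{d}x,$$ and the operator $\mathcal{Q}$ on $\mathcal{G}$ is $$\mathcal{Q}\varphi(a,b)=\sum_{c,d\ge0,\ c+d=a+b}\varphi(c,d)\,Q(a,b,c,d).$$ The matrix $\mathcal{Q}_S$ represents the restriction of $\mathcal{Q}$ to the invariant subspace of sequences with $\varphi(a,b)=0$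 unless $a+b=S$. Doubly stochastic means that entries are nonnegative and every row and column sums to $1$. *)

theory Defs
  imports "HOL-Analysis.Analysis" "HOL-Computational_Algebra.Polynomial"
begin

text \<open>Elements of \<open>L\<^sup>p\<close> are handled through Borel measurable representatives.\<close>

definition Lp :: "nat \<Rightarrow> ('a::euclidean_space \<Rightarrow> complex) set" where
  "Lp p = {f. f \<in> borel_measurable lborel \<and> integrable lborel (\<lambda>x. norm (f x) ^ p)}"

definition Lp_norm :: "nat \<Rightarrow> ('a::euclidean_space \<Rightarrow> complex) \<Rightarrow> real" where
  "Lp_norm p f = root p (LINT x|lborel. norm (f x) ^ p)"

definition radial :: "('a::euclidean_space \<Rightarrow> complex) \<Rightarrow> bool" where
  "radial f \<longleftrightarrow> (\<exists>g. AE x in lborel. f x = g (norm x))"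

definition partial_deriv :: "2 \<Rightarrow> (real^2 \<Rightarrow> complex) \<Rightarrow> real^2 \<Rightarrow> complex" where
  "partial_deriv i \<phi> x = frechet_derivative \<phi> (at x) (axis i 1)"

definition laplacian :: "(real^2 \<Rightarrow> complex) \<Rightarrow> real^2 \<Rightarrow> complex" where
  "laplacian \<phi> x = (\<Sum>i\<in>UNIV. partial_deriv i (partial_deriv i \<phi>) x)"

definition test_function :: "(real^2 \<Rightarrow> complex) \<Rightarrow> bool" where
  "test_function \<phi> \<longleftrightarrow>
     (\<forall>x. \<phi> differentiable (at x)) \<and>
     (\<forall>i x. partial_deriv i \<phi> differentiable (at x)) \<and>
     (\<forall>i j. continuous_on UNIV (partial_deriv j (partial_deriv i \<phi>))) \<and>
     compact (closure {x. \<phi> x \<noteq> 0})"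

text \<open>
  For \<open>L\<^sup>2\<close> data, \<open>\<partial>\<^sub>t u = i \<Delta> u\<close>, \<open>u(\<cdot>, 0) = f\<close> is understood in the standard weak sense:
  \<open>t \<mapsto> u(\<cdot>, t)\<close> is a continuous curve in \<open>L\<^sup>2\<close> that satisfies the equation when paired with
  every compactly supported \<open>C\<^sup>2\<close> function of \<open>x\<close>.  (By density, testing with smooth compactly
  supported functions only gives the same solutions.)  In this class the solution is unique
  up to null sets in \<open>x\<close> for each \<open>t\<close>; it is \<open>e\<^bsup>it\<Delta>\<^esup>f\<close>.  Joint measurability is required so
  that space-time norms make sense.
\<close>

definition schrodinger_solution :: "(real^2 \<Rightarrow> complex) \<Rightarrow> ((real^2) \<times> real \<Rightarrow> complex) \<Rightarrow> bool" where
  "schrodinger_solution f u \<longleftrightarrow>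
     u \<in> borel_measurable lborel \<and>
     (\<forall>t. (\<lambda>x. u (x, t)) \<in> Lp 2) \<and>
     (\<forall>t. ((\<lambda>s. Lp_norm 2 (\<lambda>x. u (x, s) - u (x, t))) \<longlongrightarrow> 0) (at t)) \<and>
     (AE x in lborel. u (x, 0) = f x) \<and>
     (\<forall>\<phi> t. test_function \<phi> \<longrightarrow>
        ((\<lambda>s. LINT x|lborel. u (x, s) * \<phi> x) has_vector_derivative
           \<i> * (LINT x|lborel. u (x, t) * laplacian \<phi> x)) (at t))"

definition laguerre_system :: "(nat \<Rightarrow> real poly) \<Rightarrow> bool" where
  "laguerre_system P \<longleftrightarrow>
     (\<forall>n. degree (P n) = n \<and> poly (P n) 0 = 1) \<and>
     (\<forall>m n. (LINT x:{0<..}|lborel. poly (P m) x * poly (P n) x * exp (- x)) =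
              (if m = n then 1 else 0))"

text \<open>These conditions determine the polynomials uniquely; existence is classical.\<close>

definition laguerre :: "nat \<Rightarrow> real poly" where
  "laguerre = (THE P. laguerre_system P)"

definition Psi :: "nat \<Rightarrow> real^2 \<Rightarrow> complex" where
  "Psi n x = complex_of_real (poly (laguerre n) (2 * pi * (norm x)\<^sup>2) * exp (- pi * (norm x)\<^sup>2))"

definition G :: "(nat \<times> nat \<Rightarrow> complex) set" where
  "G = {\<phi>. (\<lambda>p. (norm (\<phi> p))\<^sup>2) summable_on UNIV}"

definition G_inner :: "(nat \<times> nat \<Rightarrow> complex) \<Rightarrow> (nat \<times> nat \<Rightarrow> complex) \<Rightarrow> complex" where
  "G_inner \<phi> \<psi> = (\<Sum>\<^sub>\<infinity>p. \<phi> p * cnj (\<psi> p))"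

definition G_norm :: "(nat \<times> nat \<Rightarrow> complex) \<Rightarrow> real" where
  "G_norm \<phi> = sqrt (\<Sum>\<^sub>\<infinity>p. (norm (\<phi> p))\<^sup>2)"

text \<open>Extended-valued, so that an unbounded operator has norm \<open>\<infinity>\<close>; only meaningful for \<open>T\<close>
  mapping \<open>G\<close> into \<open>G\<close>.\<close>

definition G_opnorm :: "((nat \<times> nat \<Rightarrow> complex) \<Rightarrow> (nat \<times> nat \<Rightarrow> complex)) \<Rightarrow> ennreal" where
  "G_opnorm T = (SUP \<phi>\<in>{\<phi>\<in>G. G_norm \<phi> \<le> 1}. ennreal (G_norm (T \<phi>)))"

definition Q :: "nat \<Rightarrow> nat \<Rightarrow> nat \<Rightarrow> nat \<Rightarrow> real" where
  "Q a b c d = (LINT x:{0<..}|lborel.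
     poly (laguerre a) (x/2) * poly (laguerre b) (x/2) *
     poly (laguerre c) (x/2) * poly (laguerre d) (x/2) * exp (- x))"

definition Q_op :: "(nat \<times> nat \<Rightarrow> complex) \<Rightarrow> nat \<times> nat \<Rightarrow> complex" where
  "Q_op \<phi> = (\<lambda>(a, b). \<Sum>(c, d)\<in>{(c, d). c + d = a + b}. \<phi> (c, d) * complex_of_real (Q a b c d))"

text \<open>An \<open>n \<times> n\<close> matrix is a function of two indices, of which only the values at indices
  below \<open>n\<close> matter; \<open>Q_mat S\<close> has size \<open>S + 1\<close>.\<close>

definition Q_mat :: "nat \<Rightarrow> nat \<Rightarrow> nat \<Rightarrow> real" where
  "Q_mat S a c = Q a (S - a) c (S - c)"

definition positive_semidefinite :: "nat \<Rightarrow> (nat \<Rightarrow> nat \<Rightarrow> real) \<Rightarrow> bool" where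
  "positive_semidefinite n M \<longleftrightarrow>
     (\<forall>i<n. \<forall>j<n. M i j = M j i) \<and>
     (\<forall>v :: nat \<Rightarrow> real. 0 \<le> (\<Sum>i<n. \<Sum>j<n. v i * M i j * v j))"

definition doubly_stochastic :: "nat \<Rightarrow> (nat \<Rightarrow> nat \<Rightarrow> real) \<Rightarrow> bool" where
  "doubly_stochastic n M \<longleftrightarrow>
     (\<forall>i<n. \<forall>j<n. 0 \<le> M i j) \<and>
     (\<forall>i<n. (\<Sum>j<n. M i j) = 1) \<and>
     (\<forall>j<n. (\<Sum>i<n. M i j) = 1)"

end

theory Submission
  imports Defs "HOL-Probability.Distributions" "HOL-Probability.Sinc_Integral"
begin

text \<open>
  The evolution of a Laguerre mode is explicit. With \<open>\<zeta> = 1 + 4 \<pi> i t\<close>, the function \<open>Psi n\<close> evolves into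
  \<open>(cnj \<zeta> / \<zeta>) ^ n / \<zeta>\<close> times the same Laguerre polynomial in the rescaled variable \<open>|x|\<^sup>2 / |\<zeta>|\<^sup>2\<close> times the
  Gaussian \<open>exp (- \<pi> |x|\<^sup>2 / \<zeta>)\<close>. So the modulus only rescales in space, and mode \<open>n\<close> carries the \<open>n\<close>-th
  power of a common unimodular phase. If four modes \<open>a, b\<close> and, conjugated, \<open>c, d\<close> are multiplied, the integral over
  space gives a multiple of \<open>Q a b c d\<close>. What remains is an integral over time of the phase to the power
  \<open>a + b - c - d\<close>. The phase runs once around the unit circle, hence the integral vanishes unless
  \<open>a + b = c + d\<close> (\<open>psi4_integral\<close>). Summing over the modes gives the quadratic form of the operator for
  finite sums, and absolute convergence of the quadruple sum gives it in general.

  The matrices \<open>Q_mat S\<close> are understood through one fact (\<open>Lag_product_linearization\<close>): the product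
  \<open>L\<^sub>a(x/2) L\<^sub>b(x/2)\<close> is a convex combination of \<open>L\<^sub>0(x), \<dots>, L\<^sub>S(x)\<close>, where \<open>S = a + b\<close>. Its coefficients are squares
  of Krawtchouk polynomials up to positive factors, hence nonnegative. They sum to one over the basis (evaluate at
  \<open>x = 0\<close>) and also over \<open>a + b = S\<close> (the Krawtchouk matrix is an involution up to scaling). By orthonormality of the
  Laguerre polynomials \<open>Q_mat S = W W\<^sup>T\<close> with a doubly stochastic matrix \<open>W\<close> whose first column is positive. So
  \<open>Q_mat S\<close> is positive semidefinite and doubly stochastic with positive entries. For such a matrix
  \<open>\<parallel>v\<parallel>\<^sup>2 - \<langle>v, Q_mat S v\<rangle>\<close> is half the sum of \<open>Q_mat S a c |v a - v c|\<^sup>2\<close> (\<open>block_defect\<close>). It is nonnegative and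
  vanishes only for constant \<open>v\<close>, which yields the operator norm and the case of equality.

  The identity is claimed for every weak solution, so existence and uniqueness are part of the proof. Existence: the
  evolved series converges in the mean uniformly in time, and a subsequence that does not depend on time converges
  almost everywhere at each time (\<open>wave_limit_exists\<close>, \<open>wave_limit_solution\<close>). Uniqueness: let \<open>w\<close> be the
  difference of two solutions. The heat kernel at complex time \<open>z\<close> satisfies \<open>\<partial>\<^sub>z = \<Delta>\<close>, so the pairing of
  \<open>w(t)\<close> with the heat kernel at the complex time \<open>z0 + i (T - t)\<close> is constant in \<open>t\<close>, hence zero
  (\<open>gaussian_pairing_eq_0\<close>). At \<open>t = T\<close> this says that \<open>w(T)\<close> is orthogonal to all Gaussians, and these determine it
  (\<open>AE_eq_0_of_gaussians\<close>).
\<close>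

section \<open>Laguerre polynomials and their orthogonality\<close>

text \<open>
  The closed form of the Laguerre polynomials; \<open>laguerre_eq\<close> identifies it with the family that is
  characterized by \<open>laguerre_system\<close>.
\<close>

definition Lag :: "nat \<Rightarrow> real poly" where
  "Lag n = (\<Sum>k\<le>n. monom (real (n choose k) * (-1) ^ k / fact k) k)"

lemma coeff_Lag: "coeff (Lag n) k = real (n choose k) * (-1) ^ k / fact k"
  by (auto simp: Lag_def coeff_sum binomial_eq_0)

lemma poly_Lag: "poly (Lag n) x = (\<Sum>k\<le>n. real (n choose k) * (-x) ^ k / fact k)"
  unfolding Lag_def poly_sum poly_monom
  by (intro sum.cong refl) (metis (no_types, lifting) minus_mult_minus mult_minus1 power_mult_distrib mult.assoc mult.commute times_divide_eq_right)

lemma poly_Lag_0 [simp]: "poly (Lag n) 0 = 1"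
  by (simp add: poly_0_coeff_0 coeff_Lag)

lemma degree_Lag [simp]: "degree (Lag n) = n"
proof (rule antisym)
  show "degree (Lag n) \<le> n"
    by (rule degree_le) (simp add: coeff_Lag binomial_eq_0)
  show "n \<le> degree (Lag n)"
    by (rule le_degree) (simp add: coeff_Lag)
qed

text \<open>
  Integration against \<open>exp (- x)\<close> and the umbral map below are both of this shape: a linear
  functional on polynomials given by its values \<open>m k\<close> on the monomials. The bound \<open>degree p\<close> of
  the sum may be replaced by any larger one, which is what makes linearity easy.
\<close>

definition moment :: "(nat \<Rightarrow> real) \<Rightarrow> real poly \<Rightarrow> real" where
  "moment m p = (\<Sum>k\<le>degree p. coeff p k * m k)"

lemma moment_bound: "degree p \<le> N \<Longrightarrow> moment m p = (\<Sum>k\<le>N. coeff p k * m k)"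
  unfolding moment_def by (rule sum.mono_neutral_left) (auto simp: coeff_eq_0)

lemma moment_add: "moment m (p + q) = moment m p + moment m q"
proof -
  let ?N = "max (degree p) (degree q)"
  have "degree (p + q) \<le> ?N" by (rule degree_add_le_max)
  then show ?thesis
    using moment_bound[of p ?N m] moment_bound[of q ?N m] moment_bound[of "p + q" ?N m]
    by (simp add: sum.distrib distrib_right)
qed

lemma moment_smult: "moment m (smult c p) = c * moment m p"
  using moment_bound[of "smult c p" "degree p" m]
  by (simp add: moment_def degree_smult_le sum_distrib_left mult.assoc)

lemma moment_sum: "moment m (\<Sum>i\<in>I. f i) = (\<Sum>i\<in>I. moment m (f i))"
  by (induction I rule: infinite_finite_induct) (auto simp: moment_add moment_def[of m 0])

lemma moment_monom: "moment m (monom c k) = c * m k"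
proof -
  have "moment m (monom c k) = (\<Sum>i\<le>k. coeff (monom c k) i * m i)"
    by (rule moment_bound) (rule degree_monom_le)
  also have "\<dots> = (\<Sum>i\<le>k. if k = i then c * m k else 0)"
    by (intro sum.cong) auto
  finally show ?thesis by simp
qed

lemma has_bochner_integral_exp_monomial:
  "has_bochner_integral lborel (\<lambda>x::real. indicator {0<..} x * (x ^ k * exp (- x))) (fact k)"
proof (rule has_bochner_integral_nn_integral)
  have "AE x in lborel. x \<noteq> (0::real)"
    by (rule AE_lborel_singleton)
  then have "(\<integral>\<^sup>+x. ennreal (indicator {0<..} x * (x ^ k * exp (- x))) \<partial>lborel)
      = (\<integral>\<^sup>+x. ennreal (x ^ k * exp (- x)) * indicator {0..} x \<partial>lborel)"
    by (intro nn_integral_cong_AE) (auto elim!: eventually_mono simp: indicator_def)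
  then show "(\<integral>\<^sup>+x. ennreal (indicator {0<..} x * (x ^ k * exp (- x))) \<partial>lborel) = ennreal (fact k)"
    by (simp add: nn_intergal_power_times_exp_Ici)
qed (auto simp: indicator_def)

lemma has_bochner_integral_exp_poly:
  "has_bochner_integral lborel (\<lambda>x::real. indicator {0<..} x * (poly p x * exp (- x)))
     (\<Sum>k\<le>degree p. coeff p k * fact k)"
proof -
  have "has_bochner_integral lborel
      (\<lambda>x::real. \<Sum>k\<le>degree p. coeff p k * (indicator {0<..} x * (x ^ k * exp (- x))))
      (\<Sum>k\<le>degree p. coeff p k * fact k)"
    by (intro has_bochner_integral_sum has_bochner_integral_mult_right has_bochner_integral_exp_monomial)
  moreover have "(\<lambda>x::real. \<Sum>k\<le>degree p. coeff p k * (indicator {0<..} x * (x ^ k * exp (- x))))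
      = (\<lambda>x. indicator {0<..} x * (poly p x * exp (- x)))"
    by (auto simp: poly_altdef sum_distrib_left sum_distrib_right mult_ac)
  ultimately show ?thesis by simp
qed

definition expint :: "real poly \<Rightarrow> real" where
  "expint p = (LINT x:{0<..}|lborel. poly p x * exp (- x))"

lemma expint_eq_moment: "expint p = moment fact p"
  using has_bochner_integral_exp_poly[of p]
  by (simp add: expint_def moment_def set_lebesgue_integral_def has_bochner_integral_iff)

lemma expint_smult: "expint (smult c p) = c * expint p"
  and expint_sum: "expint (\<Sum>i\<in>I. f i) = (\<Sum>i\<in>I. expint (f i))"
  and expint_monom: "expint (monom c k) = c * fact k"
  by (simp_all only: expint_eq_moment moment_smult moment_sum moment_monom)

lemma alternating_pascal:
  fixes f :: "nat \<Rightarrow> real"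
  shows "(\<Sum>k\<le>Suc n. (-1) ^ k * real (Suc n choose k) * f k)
       = (\<Sum>k\<le>n. (-1) ^ k * real (n choose k) * (f k - f (Suc k)))"
proof -
  have e1: "(\<Sum>k\<le>Suc n. (-1) ^ k * real (Suc n choose k) * f k)
      = f 0 - (\<Sum>k\<le>n. (-1) ^ k * real (n choose Suc k) * f (Suc k))
            - (\<Sum>k\<le>n. (-1) ^ k * real (n choose k) * f (Suc k))"
    by (subst sum.atMost_Suc_shift) (simp add: sum.distrib sum_negf sum_subtractf algebra_simps)
  have e2: "f 0 - (\<Sum>k\<le>n. (-1) ^ k * real (n choose Suc k) * f (Suc k))
      = (\<Sum>k\<le>Suc n. (-1) ^ k * real (n choose k) * f k)"
    by (subst sum.atMost_Suc_shift) (simp add: sum_negf)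
  have e3: "(\<Sum>k\<le>Suc n. (-1) ^ k * real (n choose k) * f k)
      = (\<Sum>k\<le>n. (-1) ^ k * real (n choose k) * f k)" by simp
  show ?thesis
    unfolding right_diff_distrib sum_subtractf e1 e2 e3 ..
qed

text \<open>
  An \<open>n\<close>-th finite difference of \<open>x \<mapsto> (x choose l)\<close>: each difference lowers \<open>l\<close> by one, so
  that nothing is left once \<open>n\<close> exceeds \<open>l\<close>. This is the source of orthogonality.
\<close>

lemma alternating_binomial_sum:
  "(\<Sum>k\<le>n. (-1) ^ k * real (n choose k) * real ((m + k) choose l))
     = (if n \<le> l then (-1) ^ n * real (m choose (l - n)) else 0)"
proof (induction n arbitrary: m)
  case (Suc n)
  have "(\<Sum>k\<le>Suc n. (-1) ^ k * real (Suc n choose k) * real ((m + k) choose l))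
      = (\<Sum>k\<le>n. (-1) ^ k * real (n choose k) * real ((m + k) choose l))
      - (\<Sum>k\<le>n. (-1) ^ k * real (n choose k) * real ((Suc m + k) choose l))"
    by (subst alternating_pascal) (simp add: algebra_simps sum_subtractf)
  also have "\<dots> = (if Suc n \<le> l then (-1) ^ Suc n * real (m choose (l - Suc n)) else 0)"
  proof (cases "l - n")
    case 0
    then show ?thesis unfolding Suc.IH by auto
  next
    case (Suc r)
    then have "l - Suc n = r" "Suc n \<le> l" "n \<le> l" by auto
    then show ?thesis unfolding Suc.IH Suc by (simp add: algebra_simps)
  qed
  finally show ?case .
qed simp

lemma expint_Lag_monom:
  "expint (Lag n * monom (1 / fact j) j) = (if n \<le> j then (-1) ^ n * real (j choose n) else 0)"
proof -
  have "expint (Lag n * monom (1 / fact j) j)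
      = (\<Sum>k\<le>n. (-1) ^ k * real (n choose k) * real ((j + k) choose j))"
    unfolding Lag_def sum_distrib_right expint_sum mult_monom expint_monom
    by (intro sum.cong refl) (simp add: binomial_fact mult_ac add.commute)
  also have "\<dots> = (if n \<le> j then (-1) ^ n * real (j choose n) else 0)"
    unfolding alternating_binomial_sum by (auto simp: binomial_symmetric[symmetric])
  finally show ?thesis .
qed

text \<open>
  For \<open>m \<le> n\<close> expand the polynomial of lower degree in monomials: \<open>Lag n\<close> annihilates all
  \<open>x ^ j\<close> with \<open>j < n\<close>.
\<close>

lemma expint_Lag_Lag: "expint (Lag m * Lag n) = (if m = n then 1 else 0)"
proof -
  have *: "expint (Lag n * Lag m) = (if m = n then 1 else 0)" if "m \<le> n" for m n
  proof -
    have "Lag m = (\<Sum>j\<le>m. smult (real (m choose j) * (-1) ^ j) (monom (1 / fact j) j))"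
      by (simp add: Lag_def smult_monom)
    then have "expint (Lag n * Lag m)
        = (\<Sum>j\<le>m. real (m choose j) * (-1) ^ j * expint (Lag n * monom (1 / fact j) j))"
      by (simp only: sum_distrib_left expint_sum mult_smult_right expint_smult)
    also have "\<dots> = (\<Sum>j\<le>m. if j = n then 1 else 0)"
      using that unfolding expint_Lag_monom
      by (intro sum.cong refl) (auto simp: power_add[symmetric] mult_2[symmetric])
    also have "\<dots> = (if m = n then 1 else 0)" using that by auto
    finally show ?thesis .
  qed
  show ?thesis
    using *[of m n] *[of n m] by (cases "m \<le> n") (auto simp: mult.commute)
qed

lemma laguerre_system_Lag: "laguerre_system Lag"
  unfolding laguerre_system_def
  using expint_Lag_Lag unfolding expint_def by simp

lemma poly_Lag_expansion:
  assumes "degree p \<le> n"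
  shows "\<exists>c. p = (\<Sum>k\<le>n. smult (c k) (Lag k))"
  using assms
proof (induction n arbitrary: p)
  case 0
  then obtain a where "p = [:a:]" by (metis degree_eq_zeroE le_zero_eq)
  moreover have "Lag 0 = [:1:]" by (simp add: Lag_def monom_0)
  ultimately show ?case by (intro exI[of _ "\<lambda>_. a"]) simp
next
  case (Suc n)
  define a where "a = coeff p (Suc n) / coeff (Lag (Suc n)) (Suc n)"
  define q where "q = p - smult a (Lag (Suc n))"
  have nz: "coeff (Lag (Suc n)) (Suc n) \<noteq> 0" by (simp add: coeff_Lag)
  have "degree q \<le> n"
  proof (rule degree_le, intro allI impI)
    fix i assume "n < i"
    show "coeff q i = 0"
    proof (cases "i = Suc n")
      case True then show ?thesis using nz by (simp add: q_def a_def)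
    next
      case False
      then have "i > Suc n" using \<open>n < i\<close> by simp
      then show ?thesis using Suc.prems by (simp add: q_def coeff_eq_0)
    qed
  qed
  then obtain c where c: "q = (\<Sum>k\<le>n. smult (c k) (Lag k))" using Suc.IH by blast
  have "p = q + smult a (Lag (Suc n))" by (simp add: q_def)
  also have "\<dots> = (\<Sum>k\<le>Suc n. smult ((c(Suc n := a)) k) (Lag k))"
    unfolding c by simp
  finally show ?case by blast
qed

text \<open>
  In the expansion of \<open>P n\<close> in the basis \<open>Lag 0, \<dots>, Lag n\<close> the coefficients below \<open>n\<close> are inner
  products with \<open>P j\<close>, \<open>j < n\<close>, by induction; the value at \<open>0\<close> normalizes the last one.
\<close>

lemma laguerre_system_unique:
  assumes "laguerre_system P"
  shows "P = Lag"
proof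
  fix n
  show "P n = Lag n"
  proof (induction n rule: less_induct)
    case (less n)
    have P: "degree (P n) = n" "poly (P n) 0 = 1"
      and orth: "\<And>m. expint (P m * P n) = (if m = n then 1 else 0)"
      using assms unfolding laguerre_system_def expint_def by auto
    obtain c where c: "P n = (\<Sum>k\<le>n. smult (c k) (Lag k))"
      using poly_Lag_expansion[of "P n" n] P by auto
    have "c j = 0" if "j < n" for j
    proof -
      have "c j = (\<Sum>k\<le>n. c k * expint (Lag j * Lag k))"
        using that by (simp add: expint_Lag_Lag if_distrib[of "\<lambda>x. c _ * x"] cong: if_cong)
      also have "\<dots> = expint (Lag j * P n)"
        unfolding c sum_distrib_left by (simp add: expint_sum expint_smult)
      also have "\<dots> = 0" using orth[of j] less that by simp
      finally show ?thesis .
    qed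
    then have "P n = (\<Sum>k\<le>n. if k = n then smult (c n) (Lag n) else 0)"
      unfolding c by (intro sum.cong) auto
    then have "P n = smult (c n) (Lag n)" by simp
    moreover from this P(2) have "c n = 1" by simp
    ultimately show ?case by simp
  qed
qed

lemma laguerre_eq: "laguerre = Lag"
  unfolding laguerre_def
  by (rule the_equality) (use laguerre_system_Lag laguerre_system_unique in auto)


section \<open>Linearization of products by Krawtchouk polynomials\<close>

lemma sum_rotate:
  "(\<Sum>m\<in>A. \<Sum>n\<in>B. \<Sum>j\<in>C. f m n j) = (\<Sum>j\<in>C. \<Sum>m\<in>A. \<Sum>n\<in>B. f m n j)"
proof -
  have "(\<Sum>m\<in>A. \<Sum>n\<in>B. \<Sum>j\<in>C. f m n j) = (\<Sum>m\<in>A. \<Sum>j\<in>C. \<Sum>n\<in>B. f m n j)"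
    by (intro sum.cong refl sum.swap)
  also have "\<dots> = (\<Sum>j\<in>C. \<Sum>m\<in>A. \<Sum>n\<in>B. f m n j)"
    by (rule sum.swap)
  finally show ?thesis .
qed

text \<open>
  The coefficient of \<open>z ^ b\<close> in \<open>krawtchouk S k\<close> is the binary Krawtchouk polynomial of degree \<open>b\<close>
  at the point \<open>k\<close>.
\<close>

definition krawtchouk :: "nat \<Rightarrow> nat \<Rightarrow> real poly" where
  "krawtchouk S k = [:1, -1:] ^ k * [:1, 1:] ^ (S - k)"

text \<open>
  Multiplication by a linear factor commutes with homogenization, so a product of linear factors
  can be homogenized factor by factor.
\<close>

lemma homogenize_linear_factor:
  fixes p :: "real poly"
  assumes "degree p \<le> n"
  shows "(\<Sum>k\<le>Suc n. coeff ([:c, d:] * p) k * v ^ k * u ^ (Suc n - k))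
       = (c * u + d * v) * (\<Sum>k\<le>n. coeff p k * v ^ k * u ^ (n - k))"
proof -
  have "(\<Sum>k\<le>Suc n. coeff ([:c, d:] * p) k * v ^ k * u ^ (Suc n - k))
      = (\<Sum>k\<le>Suc n. c * (coeff p k * v ^ k * u ^ (Suc n - k)))
      + (\<Sum>k\<le>Suc n. coeff (pCons 0 (smult d p)) k * v ^ k * u ^ (Suc n - k))"
    by (simp add: sum.distrib[symmetric] algebra_simps del: sum.atMost_Suc)
  also have "(\<Sum>k\<le>Suc n. c * (coeff p k * v ^ k * u ^ (Suc n - k)))
      = (\<Sum>k\<le>n. c * (coeff p k * v ^ k * u ^ (Suc n - k)))"
    using assms by (simp add: coeff_eq_0)
  also have "\<dots> = c * u * (\<Sum>k\<le>n. coeff p k * v ^ k * u ^ (n - k))"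
    unfolding sum_distrib_left by (intro sum.cong refl) (simp add: Suc_diff_le)
  also have "(\<Sum>k\<le>Suc n. coeff (pCons 0 (smult d p)) k * v ^ k * u ^ (Suc n - k))
      = d * v * (\<Sum>k\<le>n. coeff p k * v ^ k * u ^ (n - k))"
    unfolding sum_distrib_left by (subst sum.atMost_Suc_shift) (simp add: mult_ac)
  finally show ?thesis by (simp add: algebra_simps)
qed

lemma degree_krawtchouk_le: "degree ([:1, -1:] ^ b * [:1, 1:] ^ a :: real poly) \<le> a + b"
  by (rule order_trans[OF degree_mult_le]) (simp add: degree_linear_power)

lemma homogenize_krawtchouk:
  "(\<Sum>k\<le>a + b. coeff ([:1, -1:] ^ b * [:1, 1:] ^ a) k * v ^ k * u ^ (a + b - k))
     = (u - v) ^ b * (u + v :: real) ^ a"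
proof (induction b)
  case 0
  show ?case
  proof (induction a)
    case (Suc a)
    have "degree ([:1, 1:] ^ a :: real poly) \<le> a" by (simp add: degree_linear_power)
    from homogenize_linear_factor[OF this, of 1 1 v u] Suc show ?case by simp
  qed simp
next
  case (Suc b)
  have "(\<Sum>k\<le>a + Suc b. coeff ([:1, -1:] ^ Suc b * [:1, 1:] ^ a) k * v ^ k * u ^ (a + Suc b - k))
      = (1 * u + (-1) * v) * (\<Sum>k\<le>a + b. coeff ([:1, -1:] ^ b * [:1, 1:] ^ a) k * v ^ k * u ^ (a + b - k))"
    using homogenize_linear_factor[OF degree_krawtchouk_le[of b a], of 1 "-1" v u]
    by (simp only: power_Suc mult.assoc add_Suc_right)
  then show ?case unfolding Suc by (simp add: mult.assoc)
qed

lemma krawtchouk_sum: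
  assumes "k \<le> S"
  shows "(\<Sum>b\<le>S. coeff (krawtchouk S k) b * v ^ b * u ^ (S - b)) = (u - v) ^ k * (u + v :: real) ^ (S - k)"
  using homogenize_krawtchouk[where a = "S - k" and b = k and v = v and u = u] assms unfolding krawtchouk_def by simp

text \<open>
  Both sides are coefficients of \<open>(1 + z + w - w * z) ^ S\<close>, which is symmetric in \<open>z\<close> and \<open>w\<close>.
\<close>

lemma krawtchouk_symmetry:
  assumes "k \<le> S" "b \<le> S"
  shows "real (S choose k) * coeff (krawtchouk S k) b = real (S choose b) * coeff (krawtchouk S b) k"
proof -
  have "(\<Sum>k\<le>S. (real (S choose k) * coeff (krawtchouk S k) b) * w ^ k)
      = (\<Sum>k\<le>S. (real (S choose b) * coeff (krawtchouk S b) k) * w ^ k)" for w :: real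
  proof -
    have "coeff (([:w, -w:] + [:1, 1:]) ^ S) b = coeff ([:1 + w, 1 - w:] ^ S) b"
      by (simp add: add.commute)
    also have "\<dots> = real (S choose b) * ((1 - w) ^ b * (1 + w) ^ (S - b))"
      using assms by (subst coeff_linear_poly_power) auto
    also have "\<dots> = real (S choose b) * (\<Sum>k\<le>S. coeff (krawtchouk S b) k * w ^ k)"
      using krawtchouk_sum[OF assms(2), of w 1] by simp
    also have "\<dots> = (\<Sum>k\<le>S. (real (S choose b) * coeff (krawtchouk S b) k) * w ^ k)"
      by (simp add: sum_distrib_left mult.assoc)
    finally have *: "coeff (([:w, -w:] + [:1, 1:]) ^ S) b = \<dots>" .
    have w: "[:w, -w:] = smult w [:1, -1:]" by simp
    have "coeff (([:w, -w:] + [:1, 1:]) ^ S) b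
        = (\<Sum>k\<le>S. coeff (of_nat (S choose k) * [:w, -w:] ^ k * [:1, 1:] ^ (S - k)) b)"
      by (simp only: binomial_ring coeff_sum)
    also have "\<dots> = (\<Sum>k\<le>S. (real (S choose k) * coeff (krawtchouk S k) b) * w ^ k)"
      unfolding w smult_power of_nat_poly krawtchouk_def
      by (intro sum.cong refl) (simp add: mult_ac)
    finally show ?thesis using * by simp
  qed
  then show ?thesis
    using polyfun_eq_coeffs[of "\<lambda>k. real (S choose k) * coeff (krawtchouk S k) b" S
        "\<lambda>k. real (S choose b) * coeff (krawtchouk S b) k"] assms by auto
qed

text \<open>
  These are the coefficients of \<open>L\<^sub>a(x/2) L\<^sub>b(x/2)\<close> in the Laguerre basis. In the picture of two
  harmonic oscillators they are the squared entries of the orthogonal matrix that rotates the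
  oscillators by \<open>45\<close> degrees, which is why they form a doubly stochastic matrix.
\<close>

definition lin_coeff :: "nat \<Rightarrow> nat \<Rightarrow> nat \<Rightarrow> real" where
  "lin_coeff a b k = coeff (krawtchouk (a + b) b) k * coeff (krawtchouk (a + b) k) b / 2 ^ (a + b)"

text \<open>
  By \<open>krawtchouk_symmetry\<close> the two factors of \<open>lin_coeff a b k\<close> are positive multiples of each
  other, so their product is a square up to a positive factor.
\<close>

lemma lin_coeff_nonneg:
  assumes "k \<le> a + b"
  shows "0 \<le> lin_coeff a b k"
proof -
  let ?S = "a + b"
  have pos: "0 < real (?S choose k)" using assms by simp
  then have "coeff (krawtchouk ?S k) b = real (?S choose b) / real (?S choose k) * coeff (krawtchouk ?S b) k"
    using krawtchouk_symmetry[of k ?S b] assms by (simp add: field_simps)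
  then have "lin_coeff a b k = real (?S choose b) / real (?S choose k) * (coeff (krawtchouk ?S b) k)\<^sup>2 / 2 ^ ?S"
    by (simp add: lin_coeff_def power2_eq_square)
  then show ?thesis using pos by simp
qed

lemma lin_coeff_0_pos: "0 < lin_coeff a b 0"
proof -
  have "coeff (krawtchouk (a + b) b) 0 = 1"
    by (simp add: krawtchouk_def coeff_mult_0 coeff_0_power)
  moreover have "coeff (krawtchouk (a + b) 0) b = real ((a + b) choose b)"
    by (simp add: krawtchouk_def coeff_linear_poly_power)
  ultimately show ?thesis by (simp add: lin_coeff_def)
qed

text \<open>
  The Krawtchouk matrix is an involution up to the factor \<open>2 ^ S\<close>: substituting \<open>1 - z\<close> and
  \<open>1 + z\<close> for the two variables twice gives \<open>2 z\<close> and \<open>2\<close>.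
\<close>

lemma lin_coeff_column_sum:
  assumes "k \<le> S"
  shows "(\<Sum>b\<le>S. lin_coeff (S - b) b k) = 1"
proof -
  have "(\<Sum>b\<le>S. smult (coeff (krawtchouk S k) b) (krawtchouk S b)) = monom (2 ^ S) k"
  proof (subst poly_eq_poly_eq_iff[symmetric], rule ext)
    fix z :: real
    have "poly (\<Sum>b\<le>S. smult (coeff (krawtchouk S k) b) (krawtchouk S b)) z
        = (\<Sum>b\<le>S. coeff (krawtchouk S k) b * (1 - z) ^ b * (1 + z) ^ (S - b))"
      by (simp add: poly_sum krawtchouk_def mult.assoc)
    also have "\<dots> = (2 * z) ^ k * 2 ^ (S - k)"
      using krawtchouk_sum[OF assms, of "1 - z" "1 + z"] by simp
    also have "\<dots> = poly (monom (2 ^ S) k) z"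
      using assms by (simp add: poly_monom power_mult_distrib power_add[symmetric] mult_ac)
    finally show "poly (\<Sum>b\<le>S. smult (coeff (krawtchouk S k) b) (krawtchouk S b)) z = poly (monom (2 ^ S) k) z" .
  qed
  then have "coeff (\<Sum>b\<le>S. smult (coeff (krawtchouk S k) b) (krawtchouk S b)) k = 2 ^ S" by simp
  then have "(\<Sum>b\<le>S. coeff (krawtchouk S k) b * coeff (krawtchouk S b) k) = 2 ^ S"
    by (simp add: coeff_sum)
  moreover have "(\<Sum>b\<le>S. lin_coeff (S - b) b k) = (\<Sum>b\<le>S. coeff (krawtchouk S k) b * coeff (krawtchouk S b) k) / 2 ^ S"
    unfolding sum_divide_distrib by (intro sum.cong) (auto simp: lin_coeff_def)
  ultimately show ?thesis by simp
qed

text \<open>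
  Both sides are the coefficient of \<open>y ^ b\<close> in \<open>(\<beta> + \<alpha> y) ^ b (\<alpha> + \<beta> y) ^ a\<close>. The binomial theorem
  gives the right-hand side. In the variables \<open>1 + y\<close> and \<open>1 - y\<close>, which diagonalize the
  substitution with eigenvalues \<open>1\<close> and \<open>r\<close>, the same product is a sum of powers of \<open>r\<close>.
\<close>

lemma lin_coeff_generating:
  fixes r :: real
  defines "\<alpha> \<equiv> (1 + r) / 2" and "\<beta> \<equiv> (1 - r) / 2"
  shows "(\<Sum>k\<le>a + b. lin_coeff a b k * r ^ k)
       = (\<Sum>j\<le>b. real (a choose j) * real (b choose j) * \<alpha> ^ (a - j) * \<alpha> ^ (b - j) * \<beta> ^ (2 * j))"
proof -
  let ?S = "a + b"
  have "[:\<beta>, \<alpha>:] ^ b * [:\<alpha>, \<beta>:] ^ a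
      = (\<Sum>k\<le>?S. smult (coeff (krawtchouk ?S b) k * r ^ k / 2 ^ ?S) (krawtchouk ?S k))"
  proof (subst poly_eq_poly_eq_iff[symmetric], rule ext)
    fix y :: real
    have ab: "poly [:\<beta>, \<alpha>:] y = ((1 + y) - r * (1 - y)) / 2"
         "poly [:\<alpha>, \<beta>:] y = ((1 + y) + r * (1 - y)) / 2"
      by (simp_all add: \<alpha>_def \<beta>_def field_simps)
    have "poly ([:\<beta>, \<alpha>:] ^ b * [:\<alpha>, \<beta>:] ^ a) y
        = ((1 + y) - r * (1 - y)) ^ b * ((1 + y) + r * (1 - y)) ^ a / 2 ^ ?S"
      unfolding poly_mult poly_power ab by (simp add: power_divide power_add)
    also have "\<dots> = (\<Sum>k\<le>?S. coeff (krawtchouk ?S b) k * (r * (1 - y)) ^ k * (1 + y) ^ (?S - k)) / 2 ^ ?S"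
      using krawtchouk_sum[of b ?S "r * (1 - y)" "1 + y"] by simp
    also have "\<dots> = poly (\<Sum>k\<le>?S. smult (coeff (krawtchouk ?S b) k * r ^ k / 2 ^ ?S) (krawtchouk ?S k)) y"
      by (simp add: poly_sum krawtchouk_def sum_divide_distrib power_mult_distrib mult_ac)
    finally show "poly ([:\<beta>, \<alpha>:] ^ b * [:\<alpha>, \<beta>:] ^ a) y
        = poly (\<Sum>k\<le>?S. smult (coeff (krawtchouk ?S b) k * r ^ k / 2 ^ ?S) (krawtchouk ?S k)) y" .
  qed
  then have "coeff ([:\<beta>, \<alpha>:] ^ b * [:\<alpha>, \<beta>:] ^ a) b = (\<Sum>k\<le>?S. lin_coeff a b k * r ^ k)"
    by (simp add: coeff_sum lin_coeff_def mult_ac)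
  moreover have "coeff ([:\<beta>, \<alpha>:] ^ b * [:\<alpha>, \<beta>:] ^ a) b
      = (\<Sum>j\<le>b. coeff ([:\<beta>, \<alpha>:] ^ b) (b - j) * coeff ([:\<alpha>, \<beta>:] ^ a) j)"
    unfolding coeff_mult by (rule sum.reindex_bij_witness[of _ "\<lambda>j. b - j" "\<lambda>j. b - j"]) auto
  moreover have "coeff ([:\<beta>, \<alpha>:] ^ b) (b - j) * coeff ([:\<alpha>, \<beta>:] ^ a) j
      = real (a choose j) * real (b choose j) * \<alpha> ^ (a - j) * \<alpha> ^ (b - j) * \<beta> ^ (2 * j)" if "j \<le> b" for j
  proof (cases "j \<le> a")
    case True
    then show ?thesis using that
      by (simp add: coeff_linear_poly_power binomial_symmetric[symmetric] mult_2 power_add)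
  next
    case False
    have "degree ([:\<alpha>, \<beta>:] ^ a) \<le> a"
      by (rule order_trans[OF degree_power_le]) simp
    with False have "coeff ([:\<alpha>, \<beta>:] ^ a) j = 0" by (intro coeff_eq_0) simp
    with False show ?thesis by (simp add: binomial_eq_0)
  qed
  ultimately show ?thesis by simp
qed

lemma binomial_convolution:
  fixes w :: real
  shows "(\<Sum>m\<le>a. real (a choose m) * real (m choose j) * w ^ m)
       = real (a choose j) * w ^ j * (1 + w) ^ (a - j)"
proof (cases "j \<le> a")
  case True
  have "(\<Sum>m\<le>a. real (a choose m) * real (m choose j) * w ^ m)
      = (\<Sum>m=j..a. real (a choose m) * real (m choose j) * w ^ m)"
    by (rule sum.mono_neutral_right) (auto simp: binomial_eq_0)
  also have "\<dots> = (\<Sum>m=j..a. real (a choose j) * w ^ j * (real ((a - j) choose (m - j)) * w ^ (m - j)))"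
  proof (rule sum.cong[OF refl])
    fix m assume m: "m \<in> {j..a}"
    then have "real (a choose m) * real (m choose j) = real (a choose j) * real ((a - j) choose (m - j))"
      using choose_mult[of j m a] by (metis atLeastAtMost_iff of_nat_mult)
    moreover have "w ^ m = w ^ j * w ^ (m - j)" using m by (simp add: power_add[symmetric])
    ultimately show "real (a choose m) * real (m choose j) * w ^ m
        = real (a choose j) * w ^ j * (real ((a - j) choose (m - j)) * w ^ (m - j))" by simp
  qed
  also have "\<dots> = (\<Sum>i\<le>a - j. real (a choose j) * w ^ j * (real ((a - j) choose i) * w ^ i))"
    by (rule sum.reindex_bij_witness[of _ "\<lambda>i. i + j" "\<lambda>m. m - j"]) (use True in auto)
  also have "\<dots> = real (a choose j) * w ^ j * (1 + w) ^ (a - j)"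
    by (subst add.commute, subst binomial_ring) (simp add: sum_distrib_left)
  finally show ?thesis .
next
  case False
  then show ?thesis by (auto simp: binomial_eq_0 intro!: sum.neutral)
qed

text \<open>
  By Vandermonde, \<open>(m + n choose n)\<close> is a sum over \<open>j\<close> of \<open>(m choose j) (n choose j)\<close>, and then the
  double sum splits into a product for each \<open>j\<close>.
\<close>

lemma double_binomial_sum:
  fixes w :: real
  shows "(\<Sum>m\<le>a. \<Sum>n\<le>b. real (a choose m) * real (b choose n) * real ((m + n) choose n) * w ^ (m + n))
     = (\<Sum>j\<le>b. real (a choose j) * real (b choose j) * (1 + w) ^ (a - j) * (1 + w) ^ (b - j) * w ^ (2 * j))"
proof -
  have vdm: "real ((m + n) choose n) = (\<Sum>j\<le>b. real (m choose j) * real (n choose j))" if "n \<le> b" for m n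
  proof -
    have "((m + n) choose n) = (\<Sum>k\<le>n. (m choose k) * (n choose (n - k)))"
      by (rule vandermonde[symmetric])
    also have "\<dots> = (\<Sum>k\<le>n. (m choose k) * (n choose k))"
      by (intro sum.cong refl) (simp add: binomial_symmetric[symmetric])
    also have "\<dots> = (\<Sum>k\<le>b. (m choose k) * (n choose k))"
      using that by (intro sum.mono_neutral_left) (auto simp: binomial_eq_0)
    finally show ?thesis by simp
  qed
  have "(\<Sum>m\<le>a. \<Sum>n\<le>b. real (a choose m) * real (b choose n) * real ((m + n) choose n) * w ^ (m + n))
     = (\<Sum>m\<le>a. \<Sum>n\<le>b. \<Sum>j\<le>b. (real (a choose m) * real (m choose j) * w ^ m) * (real (b choose n) * real (n choose j) * w ^ n))"
    by (intro sum.cong refl) (simp add: vdm sum_distrib_left sum_distrib_right power_add mult_ac)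
  also have "\<dots> = (\<Sum>j\<le>b. \<Sum>m\<le>a. \<Sum>n\<le>b. (real (a choose m) * real (m choose j) * w ^ m) * (real (b choose n) * real (n choose j) * w ^ n))"
    by (rule sum_rotate)
  also have "\<dots> = (\<Sum>j\<le>b. (\<Sum>m\<le>a. real (a choose m) * real (m choose j) * w ^ m) * (\<Sum>n\<le>b. real (b choose n) * real (n choose j) * w ^ n))"
    by (simp add: sum_product)
  also have "\<dots> = (\<Sum>j\<le>b. real (a choose j) * real (b choose j) * (1 + w) ^ (a - j) * (1 + w) ^ (b - j) * w ^ (2 * j))"
    by (intro sum.cong refl) (simp add: binomial_convolution mult_2 power_add)
  finally show ?thesis .
qed

text \<open>
  The umbral map \<open>y ^ k \<mapsto> (- x) ^ k / k!\<close> sends \<open>(1 + y) ^ n\<close> to \<open>L\<^sub>n(x)\<close>, so identities between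
  Laguerre polynomials that are linear in them become identities between powers of \<open>1 + y\<close>.
\<close>

definition umbral :: "real \<Rightarrow> real poly \<Rightarrow> real" where
  "umbral x = moment (\<lambda>k. (- x) ^ k / fact k)"

lemma umbral_linear_power: "umbral x ([:1, 1:] ^ n) = poly (Lag n) x"
proof -
  have "degree ([:1, 1:] ^ n :: real poly) \<le> n" by (simp add: degree_linear_power)
  from moment_bound[OF this] show ?thesis
    by (simp add: umbral_def poly_Lag coeff_linear_poly_power)
qed

text \<open>
  The product is the umbral image of the double sum of \<open>double_binomial_sum\<close> with \<open>w = y / 2\<close>, and
  the right-hand side is the umbral image of \<open>lin_coeff_generating\<close> with \<open>r = 1 + y\<close>.
\<close>

lemma Lag_product_linearization:
  "poly (Lag a) (x / 2) * poly (Lag b) (x / 2) = (\<Sum>k\<le>a + b. lin_coeff a b k * poly (Lag k) x)"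
proof -
  have *: "(\<Sum>m\<le>a. \<Sum>n\<le>b. monom (real (a choose m) * real (b choose n) * real ((m + n) choose n) / 2 ^ (m + n)) (m + n))
      = (\<Sum>k\<le>a + b. smult (lin_coeff a b k) ([:1, 1:] ^ k))"
  proof (subst poly_eq_poly_eq_iff[symmetric], rule ext)
    fix y :: real
    have "poly (\<Sum>m\<le>a. \<Sum>n\<le>b. monom (real (a choose m) * real (b choose n) * real ((m + n) choose n) / 2 ^ (m + n)) (m + n)) y
        = (\<Sum>m\<le>a. \<Sum>n\<le>b. real (a choose m) * real (b choose n) * real ((m + n) choose n) * (y / 2) ^ (m + n))"
      by (simp add: poly_sum poly_monom power_divide)
    also have "\<dots> = (\<Sum>k\<le>a + b. lin_coeff a b k * (1 + y) ^ k)"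
    proof -
      have e: "(1 + (1 + y)) / 2 = 1 + y / 2" "(1 - (1 + y)) / 2 = - (y / 2)" by (simp_all add: field_simps)
      show ?thesis
        unfolding double_binomial_sum using lin_coeff_generating[of a b "1 + y"] unfolding e
        by (simp add: power_mult)
    qed
    also have "\<dots> = poly (\<Sum>k\<le>a + b. smult (lin_coeff a b k) ([:1, 1:] ^ k)) y"
      by (simp add: poly_sum)
    finally show "poly (\<Sum>m\<le>a. \<Sum>n\<le>b. monom (real (a choose m) * real (b choose n) * real ((m + n) choose n) / 2 ^ (m + n)) (m + n)) y
        = poly (\<Sum>k\<le>a + b. smult (lin_coeff a b k) ([:1, 1:] ^ k)) y" .
  qed
  have half: "(- (x / 2)) ^ m = (- x) ^ m / 2 ^ m" for m
    by (metis minus_divide_left power_divide)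
  have "(\<Sum>k\<le>a + b. lin_coeff a b k * poly (Lag k) x)
      = (\<Sum>m\<le>a. \<Sum>n\<le>b. real (a choose m) * real (b choose n) * real ((m + n) choose n) / 2 ^ (m + n) * ((- x) ^ (m + n) / fact (m + n)))"
    using arg_cong[OF *, of "umbral x"] umbral_linear_power[of x]
    by (simp add: umbral_def moment_smult moment_sum moment_monom)
  also have "\<dots> = poly (Lag a) (x / 2) * poly (Lag b) (x / 2)"
    unfolding poly_Lag sum_product half
    by (intro sum.cong refl)
       (simp add: binomial_fact[of _ "_ + _"] power_add power_divide field_simps)
  finally show ?thesis by simp
qed

lemma lin_coeff_row_sum: "(\<Sum>k\<le>a + b. lin_coeff a b k) = 1"
  using Lag_product_linearization[of a 0 b] by simp

section \<open>The matrix on a diagonal\<close>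

lemma Q_eq_lin_coeff:
  assumes "a + b = S" "c + d = S"
  shows "Q a b c d = (\<Sum>k\<le>S. lin_coeff a b k * lin_coeff c d k)"
proof -
  define p where "p a b = (\<Sum>k\<le>a + b. smult (lin_coeff a b k) (Lag k))" for a b
  have p: "poly (p a b) x = poly (Lag a) (x / 2) * poly (Lag b) (x / 2)" for a b x
    by (simp add: p_def Lag_product_linearization poly_sum)
  have "Q a b c d = expint (p a b * p c d)"
    unfolding Q_def expint_def laguerre_eq by (simp add: p mult.assoc)
  also have "\<dots> = (\<Sum>k\<le>S. \<Sum>l\<le>S. lin_coeff a b k * lin_coeff c d l * expint (Lag k * Lag l))"
    unfolding p_def assms sum_product by (simp add: expint_sum expint_smult mult_ac)
  also have "\<dots> = (\<Sum>k\<le>S. lin_coeff a b k * lin_coeff c d k)"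
    by (simp add: expint_Lag_Lag if_distrib[of "\<lambda>x. _ * x"] cong: if_cong)
  finally show ?thesis .
qed

text \<open>
  By orthonormality the matrix is \<open>W W\<^sup>T\<close>, where \<open>W\<close> has the entries \<open>lin_coeff a (S - a) k\<close>. All
  properties of \<open>Q_mat S\<close> below are read off from this factorization.
\<close>

lemma Q_mat_eq_lin_coeff:
  assumes "a \<le> S" "c \<le> S"
  shows "Q_mat S a c = (\<Sum>k\<le>S. lin_coeff a (S - a) k * lin_coeff c (S - c) k)"
  unfolding Q_mat_def using assms by (intro Q_eq_lin_coeff) auto

lemma Q_mat_pos:
  assumes "a \<le> S" "c \<le> S"
  shows "0 < Q_mat S a c"
proof -
  have "lin_coeff a (S - a) 0 * lin_coeff c (S - c) 0 \<le> (\<Sum>k\<le>S. lin_coeff a (S - a) k * lin_coeff c (S - c) k)"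
    using assms by (intro member_le_sum) (auto intro!: mult_nonneg_nonneg lin_coeff_nonneg)
  then show ?thesis
    using assms lin_coeff_0_pos[of a "S - a"] lin_coeff_0_pos[of c "S - c"] unfolding Q_mat_eq_lin_coeff[OF assms]
    by (meson less_le_trans mult_pos_pos)
qed

lemma Q_mat_sym: "Q_mat S a c = Q_mat S c a"
  unfolding Q_mat_def Q_def by (simp add: mult_ac)

lemma Q_mat_row_sum:
  assumes "a \<le> S"
  shows "(\<Sum>c\<le>S. Q_mat S a c) = 1"
proof -
  have "(\<Sum>c\<le>S. Q_mat S a c) = (\<Sum>c\<le>S. \<Sum>k\<le>S. lin_coeff a (S - a) k * lin_coeff c (S - c) k)"
    using assms by (intro sum.cong) (auto simp: Q_mat_eq_lin_coeff)
  also have "\<dots> = (\<Sum>k\<le>S. lin_coeff a (S - a) k * (\<Sum>c\<le>S. lin_coeff c (S - c) k))"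
    unfolding sum_distrib_left by (rule sum.swap)
  also have "\<dots> = (\<Sum>k\<le>S. lin_coeff a (S - a) k)"
  proof (intro sum.cong refl)
    fix k assume k: "k \<in> {..S}"
    have "(\<Sum>c\<le>S. lin_coeff c (S - c) k) = (\<Sum>b\<le>S. lin_coeff (S - b) b k)"
      by (rule sum.reindex_bij_witness[of _ "\<lambda>b. S - b" "\<lambda>b. S - b"]) auto
    then show "lin_coeff a (S - a) k * (\<Sum>c\<le>S. lin_coeff c (S - c) k) = lin_coeff a (S - a) k"
      using lin_coeff_column_sum[of k S] k by simp
  qed
  also have "\<dots> = 1" using lin_coeff_row_sum[of a "S - a"] assms by simp
  finally show ?thesis .
qed

lemma Q_mat_positive_semidefinite: "positive_semidefinite (S + 1) (Q_mat S)"
proof -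
  have lt: "{..<S + 1} = {..S}" by auto
  have "0 \<le> (\<Sum>i\<le>S. \<Sum>j\<le>S. v i * Q_mat S i j * v j)" for v :: "nat \<Rightarrow> real"
  proof -
    have "(\<Sum>i\<le>S. \<Sum>j\<le>S. v i * Q_mat S i j * v j)
        = (\<Sum>i\<le>S. \<Sum>j\<le>S. \<Sum>k\<le>S. (v i * lin_coeff i (S - i) k) * (v j * lin_coeff j (S - j) k))"
      by (intro sum.cong refl) (simp add: Q_mat_eq_lin_coeff sum_distrib_left sum_distrib_right mult_ac)
    also have "\<dots> = (\<Sum>k\<le>S. \<Sum>i\<le>S. \<Sum>j\<le>S. (v i * lin_coeff i (S - i) k) * (v j * lin_coeff j (S - j) k))"
      by (rule sum_rotate)
    also have "\<dots> = (\<Sum>k\<le>S. (\<Sum>i\<le>S. v i * lin_coeff i (S - i) k)\<^sup>2)"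
      by (simp add: power2_eq_square sum_product)
    finally show ?thesis by (simp add: sum_nonneg)
  qed
  then show ?thesis unfolding positive_semidefinite_def lt using Q_mat_sym by auto
qed

lemma Q_mat_doubly_stochastic: "doubly_stochastic (S + 1) (Q_mat S)"
proof -
  have lt: "{..<S + 1} = {..S}" by auto
  show ?thesis
    unfolding doubly_stochastic_def lt
    using Q_mat_row_sum Q_mat_pos
    by (auto simp: less_Suc_eq_le less_imp_le) (subst Q_mat_sym, auto)
qed

section \<open>The operator on square-summable sequences\<close>

text \<open>
  The operator acts separately on each set \<open>a + b = n\<close>. Finite unions of these sets exhaust all pairs
  and are invariant, so sums over them are sums of finite-dimensional expressions.
\<close>

definition diagonal :: "nat \<Rightarrow> (nat \<times> nat) set" where
  "diagonal n = {q. fst q + snd q = n}"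

definition lower_triangle :: "nat \<Rightarrow> (nat \<times> nat) set" where
  "lower_triangle n = {q. fst q + snd q \<le> n}"

lemma diagonal_eq: "diagonal n = (\<lambda>c. (c, n - c)) ` {..n}"
  by (auto simp: diagonal_def image_iff)

lemma finite_diagonal [simp]: "finite (diagonal n)"
  by (simp add: diagonal_eq)

lemma sum_diagonal: "(\<Sum>q\<in>diagonal n. f q) = (\<Sum>c\<le>n. f (c, n - c))"
  unfolding diagonal_eq by (subst sum.reindex) (auto simp: inj_on_def)

lemma triangle_eq: "lower_triangle n = (\<Union>k\<le>n. diagonal k)"
  by (auto simp: diagonal_def lower_triangle_def)

lemma finite_triangle [simp]: "finite (lower_triangle n)"
  unfolding triangle_eq by (intro finite_UN_I finite_atMost finite_diagonal)

lemma sum_triangle: "(\<Sum>q\<in>lower_triangle n. f q) = (\<Sum>k\<le>n. \<Sum>c\<le>k. f (c, k - c))"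
proof -
  have "(\<Sum>q\<in>lower_triangle n. f q) = (\<Sum>k\<le>n. \<Sum>q\<in>diagonal k. f q)"
    unfolding triangle_eq
    by (rule sum.UNION_disjoint) (simp, simp, auto simp: diagonal_def)
  then show ?thesis by (simp add: sum_diagonal)
qed

lemma finite_subset_triangle:
  assumes "finite F"
  shows "\<exists>n. F \<subseteq> lower_triangle n"
  using assms
proof (induction F)
  case (insert q F)
  then obtain n where "F \<subseteq> lower_triangle n" by blast
  then have "insert q F \<subseteq> lower_triangle (max n (fst q + snd q))"
    by (auto simp: lower_triangle_def)
  then show ?case by blast
qed auto

lemma filterlim_triangle: "filterlim lower_triangle (finite_subsets_at_top UNIV) sequentially"
  unfolding filterlim_finite_subsets_at_top
proof (intro allI impI)
  fix F :: "(nat \<times> nat) set" assume "finite F \<and> F \<subseteq> UNIV"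
  then obtain n where "F \<subseteq> lower_triangle n" using finite_subset_triangle by blast
  moreover have "lower_triangle n \<subseteq> lower_triangle m" if "n \<le> m" for m
    using that by (auto simp: lower_triangle_def)
  ultimately show "\<forall>\<^sub>F m in sequentially. finite (lower_triangle m) \<and> F \<subseteq> lower_triangle m \<and> lower_triangle m \<subseteq> UNIV"
    by (intro eventually_sequentiallyI[of n]) auto
qed

lemma has_sum_triangle:
  assumes "(f has_sum s) UNIV"
  shows "(\<lambda>n. \<Sum>k\<le>n. \<Sum>c\<le>k. f (c, k - c)) \<longlonglongrightarrow> s"
  using filterlim_compose[OF assms[unfolded has_sum_def] filterlim_triangle]
  by (simp add: sum_triangle)

text \<open>
  Summability and bounds can be checked on the invariant triangles only, because every finite set
  of pairs lies in one of them.
\<close>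

lemma summable_triangle:
  fixes f :: "nat \<times> nat \<Rightarrow> real"
  assumes nonneg: "\<And>p. 0 \<le> f p" and le: "\<And>n. (\<Sum>k\<le>n. \<Sum>c\<le>k. f (c, k - c)) \<le> C"
  shows "f summable_on UNIV" "infsum f UNIV \<le> C"
proof -
  have F: "sum f F \<le> C" if "finite F" for F
  proof -
    obtain n where "F \<subseteq> lower_triangle n" using finite_subset_triangle[OF \<open>finite F\<close>] by blast
    then have "sum f F \<le> sum f (lower_triangle n)" by (intro sum_mono2) (auto simp: nonneg)
    also have "\<dots> \<le> C" unfolding sum_triangle by (rule le)
    finally show ?thesis .
  qed
  show s: "f summable_on UNIV"
    by (rule nonneg_bdd_above_summable_on) (auto simp: nonneg F intro!: bdd_aboveI[of _ C])
  show "infsum f UNIV \<le> C"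
    by (rule infsum_le_finite_sums[OF s]) (auto simp: F)
qed

lemma G_norm_sq: "(G_norm \<phi>)\<^sup>2 = (\<Sum>\<^sub>\<infinity>p. (norm (\<phi> p))\<^sup>2)"
  unfolding G_norm_def by (intro real_sqrt_pow2 infsum_nonneg) auto

lemma G_norm_nonneg: "0 \<le> G_norm \<phi>"
  unfolding G_norm_def by (intro real_sqrt_ge_zero infsum_nonneg) auto

lemma G_triangle_le:
  assumes "\<phi> \<in> G"
  shows "(\<Sum>k\<le>n. \<Sum>c\<le>k. (norm (\<phi> (c, k - c)))\<^sup>2) \<le> (G_norm \<phi>)\<^sup>2"
  unfolding G_norm_sq sum_triangle[of "\<lambda>p. (norm (\<phi> p))\<^sup>2", symmetric]
  using assms by (intro finite_sum_le_infsum) (auto simp: G_def)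

lemma Q_op_diagonal:
  assumes "a \<le> S"
  shows "Q_op \<phi> (a, S - a) = (\<Sum>c\<le>S. \<phi> (c, S - c) * complex_of_real (Q_mat S a c))"
proof -
  have "{(c, d). c + d = a + (S - a)} = diagonal S"
    using assms by (auto simp: diagonal_def)
  then show ?thesis
    unfolding Q_op_def Q_mat_def by (simp add: sum_diagonal)
qed

lemma Q_mat_nonneg: "a \<le> S \<Longrightarrow> c \<le> S \<Longrightarrow> 0 \<le> Q_mat S a c"
  using Q_mat_pos less_imp_le by blast

text \<open>
  Jensen's inequality for the probability weights \<open>Q_mat S a c\<close>.
\<close>

lemma block_row_le:
  fixes v :: "nat \<Rightarrow> complex"
  assumes "a \<le> S"
  shows "(norm (\<Sum>c\<le>S. v c * complex_of_real (Q_mat S a c)))\<^sup>2 \<le> (\<Sum>c\<le>S. Q_mat S a c * (norm (v c))\<^sup>2)"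
proof -
  have "norm (\<Sum>c\<le>S. v c * complex_of_real (Q_mat S a c)) \<le> (\<Sum>c\<le>S. norm (v c * complex_of_real (Q_mat S a c)))"
    by (rule norm_sum)
  also have "\<dots> = (\<Sum>c\<le>S. sqrt (Q_mat S a c) * (sqrt (Q_mat S a c) * norm (v c)))"
    using assms Q_mat_nonneg[of a S] by (intro sum.cong refl) (simp add: norm_mult mult.assoc[symmetric])
  finally have "(norm (\<Sum>c\<le>S. v c * complex_of_real (Q_mat S a c)))\<^sup>2
      \<le> (\<Sum>c\<le>S. sqrt (Q_mat S a c) * (sqrt (Q_mat S a c) * norm (v c)))\<^sup>2"
    by (rule power_mono) simp
  also have "\<dots> \<le> (\<Sum>c\<le>S. (sqrt (Q_mat S a c))\<^sup>2) * (\<Sum>c\<le>S. (sqrt (Q_mat S a c) * norm (v c))\<^sup>2)"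
    by (rule Cauchy_Schwarz_ineq_sum)
  also have "\<dots> = (\<Sum>c\<le>S. Q_mat S a c) * (\<Sum>c\<le>S. Q_mat S a c * (norm (v c))\<^sup>2)"
    using assms Q_mat_nonneg[of a S]
    by (intro arg_cong2[where f = "(*)"] sum.cong refl) (auto simp: power_mult_distrib)
  finally show ?thesis using Q_mat_row_sum[OF assms] by simp
qed

lemma Q_mat_weighted_sum:
  "(\<Sum>a\<le>S. \<Sum>c\<le>S. Q_mat S a c * f c) = (\<Sum>c\<le>S. f c)"
  "(\<Sum>a\<le>S. \<Sum>c\<le>S. Q_mat S a c * f a) = (\<Sum>a\<le>S. f a)"
proof -
  show 2: "(\<Sum>a\<le>S. \<Sum>c\<le>S. Q_mat S a c * f a) = (\<Sum>a\<le>S. f a)" for f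
    by (simp add: sum_distrib_right[symmetric] Q_mat_row_sum)
  have "(\<Sum>a\<le>S. \<Sum>c\<le>S. Q_mat S a c * f c) = (\<Sum>c\<le>S. \<Sum>a\<le>S. Q_mat S c a * f c)"
    by (subst sum.swap) (subst Q_mat_sym, simp)
  then show "(\<Sum>a\<le>S. \<Sum>c\<le>S. Q_mat S a c * f c) = (\<Sum>c\<le>S. f c)" using 2[of f] by simp
qed

lemma block_contraction:
  fixes v :: "nat \<Rightarrow> complex"
  shows "(\<Sum>a\<le>S. (norm (\<Sum>c\<le>S. v c * complex_of_real (Q_mat S a c)))\<^sup>2) \<le> (\<Sum>c\<le>S. (norm (v c))\<^sup>2)"
proof -
  have "(\<Sum>a\<le>S. (norm (\<Sum>c\<le>S. v c * complex_of_real (Q_mat S a c)))\<^sup>2)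
      \<le> (\<Sum>a\<le>S. \<Sum>c\<le>S. Q_mat S a c * (norm (v c))\<^sup>2)"
    by (intro sum_mono block_row_le) auto
  also have "\<dots> = (\<Sum>c\<le>S. (norm (v c))\<^sup>2)" by (rule Q_mat_weighted_sum)
  finally show ?thesis .
qed

text \<open>
  On each diagonal the matrix is symmetric and doubly stochastic, hence a contraction.
\<close>

lemma Q_op_contraction:
  assumes "\<phi> \<in> G"
  shows "Q_op \<phi> \<in> G" "G_norm (Q_op \<phi>) \<le> G_norm \<phi>"
proof -
  have "(\<Sum>k\<le>n. \<Sum>c\<le>k. (norm (Q_op \<phi> (c, k - c)))\<^sup>2) \<le> (G_norm \<phi>)\<^sup>2" for n
  proof -
    have "(\<Sum>k\<le>n. \<Sum>c\<le>k. (norm (Q_op \<phi> (c, k - c)))\<^sup>2) \<le> (\<Sum>k\<le>n. \<Sum>c\<le>k. (norm (\<phi> (c, k - c)))\<^sup>2)"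
    proof (rule sum_mono)
      fix k
      show "(\<Sum>c\<le>k. (norm (Q_op \<phi> (c, k - c)))\<^sup>2) \<le> (\<Sum>c\<le>k. (norm (\<phi> (c, k - c)))\<^sup>2)"
        using block_contraction[where S = k and v = "\<lambda>c. \<phi> (c, k - c)"] by (simp add: Q_op_diagonal)
    qed
    also have "\<dots> \<le> (G_norm \<phi>)\<^sup>2" by (rule G_triangle_le[OF assms])
    finally show ?thesis .
  qed
  from summable_triangle[of "\<lambda>p. (norm (Q_op \<phi> p))\<^sup>2", OF _ this]
  have s: "(\<lambda>p. (norm (Q_op \<phi> p))\<^sup>2) summable_on UNIV"
    and le: "(\<Sum>\<^sub>\<infinity>p. (norm (Q_op \<phi> p))\<^sup>2) \<le> (G_norm \<phi>)\<^sup>2" by auto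
  show "Q_op \<phi> \<in> G" using s by (simp add: G_def)
  show "G_norm (Q_op \<phi>) \<le> G_norm \<phi>"
    using le unfolding G_norm_sq[symmetric] by (rule power2_le_imp_le) (rule G_norm_nonneg)
qed

lemma Q_op_constant:
  assumes "\<And>a b c d. a + b = c + d \<Longrightarrow> \<phi> (a, b) = \<phi> (c, d)"
  shows "Q_op \<phi> = \<phi>"
proof
  fix p :: "nat \<times> nat"
  obtain a b where p: "p = (a, b)" by fastforce
  have "Q_op \<phi> (a, a + b - a) = (\<Sum>c\<le>a + b. \<phi> (c, a + b - c) * complex_of_real (Q_mat (a + b) a c))"
    by (rule Q_op_diagonal) simp
  also have "\<dots> = (\<Sum>c\<le>a + b. \<phi> (a, b) * complex_of_real (Q_mat (a + b) a c))"
    by (intro sum.cong refl) (auto intro!: assms arg_cong2[where f = "(*)"])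
  also have "\<dots> = \<phi> (a, b)"
    by (simp add: sum_distrib_left[symmetric] of_real_sum[symmetric] Q_mat_row_sum del: of_real_sum)
  finally show "Q_op \<phi> p = \<phi> p" by (simp add: p)
qed

text \<open>
  The bound \<open>1\<close> is attained at the unit sequence at \<open>(0, 0)\<close>, on which the operator is the
  identity.
\<close>

lemma G_opnorm_Q_op: "G_opnorm Q_op = 1"
proof -
  \<comment> \<open>the sequence supported at the origin\<close>
  define e where "e p = (if p = (0, 0) then 1 else 0 :: complex)" for p :: "nat \<times> nat"
  have inf: "((\<lambda>p. (norm (e p))\<^sup>2) has_sum (\<Sum>p\<in>{(0,0)}. (norm (e p))\<^sup>2)) UNIV"
    by (rule has_sum_finite_neutralI[of "{(0, 0)}"]) (auto simp: e_def)
  have eG: "e \<in> G" using inf by (auto simp: G_def summable_on_def)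
  have "(\<Sum>p\<in>{(0,0)}. (norm (e p))\<^sup>2) = 1" by (simp add: e_def)
  with infsumI[OF inf] have e1: "G_norm e = 1" by (simp add: G_norm_def)
  have "Q_op e (0, 0) = 1"
  proof -
    have "Q_op e (0, 0 - 0) = (\<Sum>c\<le>0. e (c, 0 - c) * complex_of_real (Q_mat 0 0 c))"
      by (rule Q_op_diagonal) simp
    then show ?thesis using Q_mat_row_sum[of 0 0] by (simp add: e_def)
  qed
  then have "1 = (\<Sum>p\<in>{(0,0)}. (norm (Q_op e p))\<^sup>2)" by simp
  also have "\<dots> \<le> (G_norm (Q_op e))\<^sup>2"
    unfolding G_norm_sq using Q_op_contraction(1)[OF eG]
    by (intro finite_sum_le_infsum) (auto simp: G_def)
  finally have "1 \<le> G_norm (Q_op e)" using G_norm_nonneg[of "Q_op e"]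
    by (metis one_power2 power2_le_imp_le)
  then have "1 \<le> ennreal (G_norm (Q_op e))" by (simp add: ennreal_ge_1)
  also have "\<dots> \<le> G_opnorm Q_op"
    unfolding G_opnorm_def using eG e1 by (intro SUP_upper) auto
  finally have "1 \<le> G_opnorm Q_op" .
  moreover have "G_opnorm Q_op \<le> 1"
    unfolding G_opnorm_def
  proof (rule SUP_least)
    fix \<phi> assume "\<phi> \<in> {\<phi> \<in> G. G_norm \<phi> \<le> 1}"
    then have "G_norm (Q_op \<phi>) \<le> 1" using Q_op_contraction(2)[of \<phi>] by auto
    then show "ennreal (G_norm (Q_op \<phi>)) \<le> 1" by (simp add: ennreal_le_1)
  qed
  ultimately show ?thesis by (rule antisym[rotated])
qed

text \<open>
  The pairs of pairs with equal sums: the only ones that survive integration in time. The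
  quadratic form of the operator is the sum of \<open>resonant_term\<close> over this set.
\<close>

definition resonant :: "((nat \<times> nat) \<times> (nat \<times> nat)) set" where
  "resonant = Sigma UNIV (\<lambda>p. diagonal (fst p + snd p))"

definition resonant_term :: "(nat \<times> nat \<Rightarrow> complex) \<Rightarrow> (nat \<times> nat) \<times> (nat \<times> nat) \<Rightarrow> complex" where
  "resonant_term \<phi> = (\<lambda>(p, q). \<phi> p * cnj (\<phi> q) * complex_of_real (Q (fst p) (snd p) (fst q) (snd q)))"

lemma block_form_le:
  fixes x :: "nat \<Rightarrow> real"
  shows "(\<Sum>a\<le>S. \<Sum>c\<le>S. x a * x c * Q_mat S a c) \<le> (\<Sum>a\<le>S. (x a)\<^sup>2)"
proof -
  have "(\<Sum>a\<le>S. \<Sum>c\<le>S. x a * x c * Q_mat S a c)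
      \<le> (\<Sum>a\<le>S. \<Sum>c\<le>S. Q_mat S a c * ((x a)\<^sup>2 / 2) + Q_mat S a c * ((x c)\<^sup>2 / 2))"
  proof (intro sum_mono)
    fix a c assume "a \<in> {..S}" "c \<in> {..S}"
    then have "Q_mat S a c * (x a * x c) \<le> Q_mat S a c * ((x a)\<^sup>2 / 2 + (x c)\<^sup>2 / 2)"
      using sum_squares_bound[of "x a" "x c"] by (intro mult_left_mono Q_mat_nonneg) auto
    then show "x a * x c * Q_mat S a c \<le> Q_mat S a c * ((x a)\<^sup>2 / 2) + Q_mat S a c * ((x c)\<^sup>2 / 2)"
      by (simp add: algebra_simps)
  qed
  also have "\<dots> = (\<Sum>a\<le>S. (x a)\<^sup>2)"
    unfolding sum.distrib Q_mat_weighted_sum by (simp add: sum.distrib[symmetric])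
  finally show ?thesis .
qed

text \<open>
  Uniform bounds for finite partial sums give absolute convergence of the quadruple sum, so that it
  may be summed in any order.
\<close>

lemma resonant_term_finite_sum_le:
  assumes "\<phi> \<in> G" "finite F" "F \<subseteq> resonant"
  shows "(\<Sum>x\<in>F. norm (resonant_term \<phi> x)) \<le> (G_norm \<phi>)\<^sup>2"
proof -
  obtain n where n: "fst ` F \<subseteq> lower_triangle n"
    using finite_subset_triangle[of "fst ` F"] assms by blast
  have "(\<Sum>x\<in>F. norm (resonant_term \<phi> x)) \<le> (\<Sum>x\<in>Sigma (lower_triangle n) (\<lambda>p. diagonal (fst p + snd p)). norm (resonant_term \<phi> x))"
    using assms n unfolding resonant_def by (intro sum_mono2 finite_SigmaI) fastforce+
  also have "\<dots> = (\<Sum>p\<in>lower_triangle n. \<Sum>q\<in>diagonal (fst p + snd p). norm (resonant_term \<phi> (p, q)))"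
    by (subst sum.Sigma) auto
  also have "\<dots> = (\<Sum>k\<le>n. \<Sum>a\<le>k. \<Sum>c\<le>k. norm (resonant_term \<phi> ((a, k - a), (c, k - c))))"
    by (simp add: sum_triangle sum_diagonal)
  also have "\<dots> = (\<Sum>k\<le>n. \<Sum>a\<le>k. \<Sum>c\<le>k. norm (\<phi> (a, k - a)) * norm (\<phi> (c, k - c)) * Q_mat k a c)"
  proof (intro sum.cong refl)
    fix k a c :: nat assume "a \<in> {..k}" "c \<in> {..k}"
    then have "0 \<le> Q a (k - a) c (k - c)" using Q_mat_nonneg[of a k c] by (simp add: Q_mat_def)
    then show "norm (resonant_term \<phi> ((a, k - a), (c, k - c))) = norm (\<phi> (a, k - a)) * norm (\<phi> (c, k - c)) * Q_mat k a c"
      by (simp add: resonant_term_def norm_mult Q_mat_def)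
  qed
  also have "\<dots> \<le> (\<Sum>k\<le>n. \<Sum>a\<le>k. (norm (\<phi> (a, k - a)))\<^sup>2)"
    by (intro sum_mono block_form_le)
  also have "\<dots> \<le> (G_norm \<phi>)\<^sup>2" by (rule G_triangle_le[OF assms(1)])
  finally show ?thesis .
qed

lemma resonant_term_summable:
  assumes "\<phi> \<in> G"
  shows "(\<lambda>x. norm (resonant_term \<phi> x)) summable_on resonant" "resonant_term \<phi> summable_on resonant"
proof -
  show "(\<lambda>x. norm (resonant_term \<phi> x)) summable_on resonant"
    by (rule nonneg_bdd_above_summable_on)
       (auto intro!: bdd_aboveI[of _ "(G_norm \<phi>)\<^sup>2"] resonant_term_finite_sum_le[OF assms])
  then show "resonant_term \<phi> summable_on resonant" by (rule abs_summable_summable)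
qed

lemma resonant_term_inner:
  assumes "\<phi> \<in> G"
  shows "((\<lambda>p. \<phi> p * cnj (Q_op \<phi> p)) has_sum (\<Sum>\<^sub>\<infinity>x\<in>resonant. resonant_term \<phi> x)) UNIV"
proof -
  have s: "resonant_term \<phi> summable_on Sigma UNIV (\<lambda>p. diagonal (fst p + snd p))"
    using resonant_term_summable(2)[OF assms] unfolding resonant_def .
  have inner: "(\<Sum>\<^sub>\<infinity>q\<in>diagonal (fst p + snd p). resonant_term \<phi> (p, q)) = \<phi> p * cnj (Q_op \<phi> p)" for p
  proof -
    obtain a b where p: "p = (a, b)" by fastforce
    have "Q_op \<phi> (a, a + b - a) = (\<Sum>c\<le>a + b. \<phi> (c, a + b - c) * complex_of_real (Q_mat (a + b) a c))"
      by (rule Q_op_diagonal) simp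
    then show ?thesis
      by (simp add: p sum_diagonal resonant_term_def Q_mat_def sum_distrib_left mult.assoc)
  qed
  have "(\<lambda>p. \<Sum>\<^sub>\<infinity>q\<in>diagonal (fst p + snd p). resonant_term \<phi> (p, q)) summable_on UNIV"
    using s by (intro summable_on_Sigma_banach) (simp add: case_prod_eta)
  then have "(\<lambda>p. \<phi> p * cnj (Q_op \<phi> p)) summable_on UNIV" by (simp add: inner)
  moreover have "(\<Sum>\<^sub>\<infinity>p. \<phi> p * cnj (Q_op \<phi> p)) = (\<Sum>\<^sub>\<infinity>x\<in>resonant. resonant_term \<phi> x)"
    using infsum_Sigma_banach[OF s] unfolding inner resonant_def .
  ultimately show ?thesis using has_sum_infsum by metis
qed

lemma G_inner_Q_op:
  assumes "\<phi> \<in> G"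
  shows "G_inner \<phi> (Q_op \<phi>) = (\<Sum>\<^sub>\<infinity>x\<in>resonant. resonant_term \<phi> x)"
  unfolding G_inner_def by (rule infsumI[OF resonant_term_inner[OF assms]])

text \<open>
  The space-time norm of a partial sum of the series of \<open>f\<close> yields the quadruple sum over a cube;
  the cubes exhaust the resonant set.
\<close>

lemma resonant_term_square_limit:
  assumes "\<phi> \<in> G"
  shows "(\<lambda>n. \<Sum>x\<in>resonant \<inter> (({..<n} \<times> {..<n}) \<times> ({..<n} \<times> {..<n})). resonant_term \<phi> x)
     \<longlonglongrightarrow> G_inner \<phi> (Q_op \<phi>)"
proof -
  let ?K = "\<lambda>n. resonant \<inter> (({..<n} \<times> {..<n}) \<times> ({..<n} \<times> {..<n}))"
  have "filterlim ?K (finite_subsets_at_top resonant) sequentially"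
    unfolding filterlim_finite_subsets_at_top
  proof (intro allI impI)
    fix F assume F: "finite F \<and> F \<subseteq> resonant"
    define m where "m x = Suc (Max {fst (fst x), snd (fst x), fst (snd x), snd (snd x)})"
      for x :: "(nat \<times> nat) \<times> (nat \<times> nat)"
    obtain N where N: "\<And>x. x \<in> F \<Longrightarrow> m x \<le> N"
      using F by (metis finite_nat_set_iff_bounded_le finite_imageI imageI)
    have "F \<subseteq> ?K n" if "N \<le> n" for n
    proof
      fix x assume "x \<in> F"
      then have "m x \<le> n" using N that le_trans by blast
      then show "x \<in> ?K n" using F \<open>x \<in> F\<close> by (cases x) (auto simp: m_def)
    qed
    then show "\<forall>\<^sub>F n in sequentially. finite (?K n) \<and> F \<subseteq> ?K n \<and> ?K n \<subseteq> resonant"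
      by (intro eventually_sequentiallyI[of N]) auto
  qed
  from filterlim_compose[OF _ this] has_sum_infsum[OF resonant_term_summable(2)[OF assms]]
  show ?thesis unfolding has_sum_def G_inner_Q_op[OF assms] by blast
qed

text \<open>
  The deficit in the contraction estimate is a Dirichlet form, by the row and column sums.
\<close>

lemma block_defect:
  fixes v :: "nat \<Rightarrow> complex"
  shows "(\<Sum>a\<le>S. v a * cnj (v a) - v a * cnj (\<Sum>c\<le>S. v c * complex_of_real (Q_mat S a c)))
    = complex_of_real (1 / 2 * (\<Sum>a\<le>S. \<Sum>c\<le>S. Q_mat S a c * (norm (v a - v c))\<^sup>2))"
proof -
  define R where "R = (\<Sum>a\<le>S. \<Sum>c\<le>S. complex_of_real (Q_mat S a c) * (v a * cnj (v c)))"
  define N where "N = (\<Sum>a\<le>S. v a * cnj (v a))"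
  have R': "(\<Sum>a\<le>S. \<Sum>c\<le>S. complex_of_real (Q_mat S a c) * (v c * cnj (v a))) = R"
    unfolding R_def by (subst sum.swap) (subst Q_mat_sym, simp)
  have w1: "(\<Sum>a\<le>S. \<Sum>c\<le>S. complex_of_real (Q_mat S a c) * (v a * cnj (v a))) = N"
    unfolding N_def sum_distrib_right[symmetric] of_real_sum[symmetric] by (simp add: Q_mat_row_sum)
  have w2: "(\<Sum>a\<le>S. \<Sum>c\<le>S. complex_of_real (Q_mat S a c) * (v c * cnj (v c))) = N"
    by (subst w1[symmetric]) (subst sum.swap, subst Q_mat_sym, simp)
  have sq: "complex_of_real (Q_mat S a c * (norm (v a - v c))\<^sup>2)
     = complex_of_real (Q_mat S a c) * (v a * cnj (v a)) + complex_of_real (Q_mat S a c) * (v c * cnj (v c))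
     - complex_of_real (Q_mat S a c) * (v a * cnj (v c)) - complex_of_real (Q_mat S a c) * (v c * cnj (v a))" for a c
    unfolding of_real_mult complex_norm_square by (simp add: algebra_simps)
  have "complex_of_real (1 / 2 * (\<Sum>a\<le>S. \<Sum>c\<le>S. Q_mat S a c * (norm (v a - v c))\<^sup>2))
      = 1 / 2 * (\<Sum>a\<le>S. \<Sum>c\<le>S. complex_of_real (Q_mat S a c * (norm (v a - v c))\<^sup>2))"
    by simp
  also have "\<dots> = 1 / 2 * (N + N - R - R)"
    unfolding sq sum.distrib sum_subtractf w1 w2 R' R_def[symmetric] ..
  also have "\<dots> = N - R" by simp
  also have "\<dots> = (\<Sum>a\<le>S. v a * cnj (v a) - v a * cnj (\<Sum>c\<le>S. v c * complex_of_real (Q_mat S a c)))"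
    unfolding N_def R_def sum_subtractf by (simp add: sum_distrib_left mult_ac)
  finally show ?thesis by simp
qed

text \<open>
  The deficit is a series of nonnegative Dirichlet forms, one for each diagonal. If it vanishes, each
  of them vanishes, and since all weights are positive the sequence is constant on each diagonal.
\<close>

lemma Q_op_equality_iff:
  assumes "\<phi> \<in> G"
  shows "G_inner \<phi> (Q_op \<phi>) = complex_of_real ((G_norm \<phi>)\<^sup>2)
     \<longleftrightarrow> (\<forall>a b c d. a + b = c + d \<longrightarrow> \<phi> (a, b) = \<phi> (c, d))"
proof
  assume const: "\<forall>a b c d. a + b = c + d \<longrightarrow> \<phi> (a, b) = \<phi> (c, d)"
  have "Q_op \<phi> = \<phi>" by (rule Q_op_constant) (use const in blast)
  then have "G_inner \<phi> (Q_op \<phi>) = (\<Sum>\<^sub>\<infinity>p. complex_of_real ((norm (\<phi> p))\<^sup>2))"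
    unfolding G_inner_def by (simp only: complex_norm_square)
  also have "\<dots> = complex_of_real (\<Sum>\<^sub>\<infinity>p. (norm (\<phi> p))\<^sup>2)"
    using assms by (intro infsumI has_sum_of_real has_sum_infsum) (simp add: G_def)
  finally show "G_inner \<phi> (Q_op \<phi>) = complex_of_real ((G_norm \<phi>)\<^sup>2)" by (simp only: G_norm_sq)
next
  assume eq: "G_inner \<phi> (Q_op \<phi>) = complex_of_real ((G_norm \<phi>)\<^sup>2)"
  define f where "f p = \<phi> p * cnj (\<phi> p) - \<phi> p * cnj (Q_op \<phi> p)" for p
  define g where "g k = 1 / 2 * (\<Sum>a\<le>k. \<Sum>c\<le>k. Q_mat k a c * (norm (\<phi> (a, k - a) - \<phi> (c, k - c)))\<^sup>2)" for k
  have "((\<lambda>p. (norm (\<phi> p))\<^sup>2) has_sum (G_norm \<phi>)\<^sup>2) UNIV"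
    unfolding G_norm_sq using assms by (intro has_sum_infsum) (simp add: G_def)
  from has_sum_of_real[OF this, where 'a = complex]
  have "((\<lambda>p. \<phi> p * cnj (\<phi> p)) has_sum complex_of_real ((G_norm \<phi>)\<^sup>2)) UNIV"
    by (simp only: complex_norm_square)
  from has_sum_add[OF this has_sum_uminusI[OF resonant_term_inner[OF assms]]]
  have "(f has_sum 0) UNIV"
    using eq unfolding G_inner_Q_op[OF assms] f_def by simp
  from has_sum_triangle[OF this]
  have lim: "(\<lambda>n. \<Sum>k\<le>n. \<Sum>c\<le>k. f (c, k - c)) \<longlonglongrightarrow> 0" .
  have "(\<Sum>c\<le>k. f (c, k - c)) = complex_of_real (g k)" for k
    using block_defect[where S = k and v = "\<lambda>c. \<phi> (c, k - c)"] unfolding f_def g_def by (simp add: Q_op_diagonal)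
  with lim have "(\<lambda>n. complex_of_real (\<Sum>k\<le>n. g k)) \<longlonglongrightarrow> complex_of_real 0" by simp
  then have glim: "(\<lambda>n. \<Sum>k\<le>n. g k) \<longlonglongrightarrow> 0" by (simp only: tendsto_of_real_iff)
  have gnn: "0 \<le> g k" for k
    unfolding g_def by (intro mult_nonneg_nonneg sum_nonneg Q_mat_nonneg) auto
  have g0: "g k = 0" for k
  proof -
    have "(\<Sum>k\<le>n. g k) \<le> 0" for n
      by (rule incseq_le[OF _ glim]) (auto simp: incseq_def gnn intro!: sum_mono2)
    moreover have "g k \<le> (\<Sum>j\<le>k. g j)" by (rule member_le_sum) (auto simp: gnn)
    ultimately show ?thesis using gnn[of k] by (meson order_trans order_antisym)
  qed
  show "\<forall>a b c d. a + b = c + d \<longrightarrow> \<phi> (a, b) = \<phi> (c, d)"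
  proof (intro allI impI)
    fix a b c d :: nat assume s: "a + b = c + d"
    let ?k = "a + b"
    let ?t = "\<lambda>a c. Q_mat ?k a c * (norm (\<phi> (a, ?k - a) - \<phi> (c, ?k - c)))\<^sup>2"
    have tnn: "0 \<le> ?t a c" if "a \<le> ?k" "c \<le> ?k" for a c
      using that by (intro mult_nonneg_nonneg Q_mat_nonneg) auto
    have ac: "a \<le> ?k" "c \<le> ?k" using s by auto
    have "?t a c \<le> (\<Sum>c\<le>?k. ?t a c)"
      using ac by (intro member_le_sum tnn) auto
    also have "\<dots> \<le> (\<Sum>a\<le>?k. \<Sum>c\<le>?k. ?t a c)"
      using ac by (intro member_le_sum[of a "{..?k}" "\<lambda>a. \<Sum>c\<le>?k. ?t a c"] sum_nonneg tnn) auto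
    also have "\<dots> = 0" using g0[of ?k] unfolding g_def by simp
    finally have "?t a c = 0" using tnn[of a c] s by auto
    moreover have "Q_mat ?k a c \<noteq> 0" using Q_mat_pos[of a ?k c] s by auto
    moreover have "?k - a = b" "?k - c = d" using s by auto
    ultimately show "\<phi> (a, b) = \<phi> (c, d)" by simp
  qed
qed

section \<open>Inequalities in Lebesgue spaces\<close>

text \<open>
  Convexity of the \<open>p\<close>-th power. With the weight \<open>l\<close> chosen according to the norms it gives
  Minkowski's inequality after integration.
\<close>

lemma power_add_le_convex:
  fixes x y l :: real
  assumes "0 \<le> x" "0 \<le> y" "0 < l" "l < 1"
  shows "(x + y) ^ p \<le> (1 - l) * (x / (1 - l)) ^ p + l * (y / l) ^ p"
proof -
  have "convex_on {0..} (\<lambda>x::real. x ^ p)"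
    using convex_power_odd[of p] convex_on_subset[OF convex_power_even[of p] subset_UNIV]
    by (cases "even p") auto
  from convex_onD[OF this, of l "x / (1 - l)" "y / l"] assms
  show ?thesis by simp
qed

lemma LpD:
  assumes "f \<in> Lp p"
  shows "f \<in> borel_measurable lborel" "integrable lborel (\<lambda>x. norm (f x) ^ p)"
  using assms by (auto simp: Lp_def)

lemma Lp_norm_nonneg [simp]: "0 < p \<Longrightarrow> 0 \<le> Lp_norm p f"
  unfolding Lp_norm_def by (intro real_root_ge_zero integral_nonneg_AE) auto

lemma Lp_norm_power: "0 < p \<Longrightarrow> Lp_norm p f ^ p = (LINT x|lborel. norm (f x) ^ p)"
  unfolding Lp_norm_def by (intro real_root_pow_pos2 integral_nonneg_AE) auto

lemma Lp_norm_leI: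
  assumes "0 < p" "(LINT x|lborel. norm (f x) ^ p) \<le> c ^ p" "0 \<le> c"
  shows "Lp_norm p f \<le> c"
  using assms by (metis Lp_norm_power Lp_norm_nonneg power_mono_iff)

lemma le_of_le_approx_add:
  fixes A B X :: real
  assumes "\<And>a b. A < a \<Longrightarrow> B < b \<Longrightarrow> X \<le> a + b"
  shows "X \<le> A + B"
proof (rule field_le_epsilon)
  fix e :: real assume "0 < e"
  then show "X \<le> A + B + e" using assms[of "A + e / 2" "B + e / 2"] by simp
qed

lemma le_of_le_approx_mult:
  fixes A B X :: real
  assumes "\<And>a b. A < a \<Longrightarrow> B < b \<Longrightarrow> X \<le> a * b"
  shows "X \<le> A * B"
proof (rule LIMSEQ_le_const)
  have 0: "(\<lambda>n. inverse (real (Suc n))) \<longlonglongrightarrow> 0" by (rule LIMSEQ_inverse_real_of_nat)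
  have "(\<lambda>n. (A + inverse (real (Suc n))) * (B + inverse (real (Suc n)))) \<longlonglongrightarrow> (A + 0) * (B + 0)"
    by (intro tendsto_intros 0)
  then show "(\<lambda>n. (A + inverse (real (Suc n))) * (B + inverse (real (Suc n)))) \<longlonglongrightarrow> A * B" by simp
  show "\<exists>N. \<forall>n\<ge>N. X \<le> (A + inverse (real (Suc n))) * (B + inverse (real (Suc n)))"
    by (intro exI[of _ 0] allI impI assms) auto
qed

text \<open>
  For bounds \<open>a\<close>, \<open>b\<close> above the two norms use the weight \<open>l = b / (a + b)\<close>. Working with strict upper
  bounds avoids the case of vanishing norms.
\<close>

lemma Lp_add:
  assumes f: "f \<in> Lp p" and g: "g \<in> Lp p" and p: "0 < p"
  shows "(\<lambda>x. f x + g x) \<in> Lp p" "Lp_norm p (\<lambda>x. f x + g x) \<le> Lp_norm p f + Lp_norm p g"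
proof -
  note [measurable] = LpD(1)[OF f] LpD(1)[OF g]
  have pt: "norm (f x + g x) ^ p \<le> (1 - l) * (norm (f x) / (1 - l)) ^ p + l * (norm (g x) / l) ^ p"
    if "0 < l" "l < 1" for l x
  proof -
    have "norm (f x + g x) ^ p \<le> (norm (f x) + norm (g x)) ^ p"
      by (intro power_mono norm_triangle_ineq) auto
    also have "\<dots> \<le> (1 - l) * (norm (f x) / (1 - l)) ^ p + l * (norm (g x) / l) ^ p"
      using that by (intro power_add_le_convex) auto
    finally show ?thesis .
  qed
  have int: "integrable lborel (\<lambda>x. (1 - l) * (norm (f x) / (1 - l)) ^ p + l * (norm (g x) / l) ^ p)" for l
    unfolding power_divide
    by (intro Bochner_Integration.integrable_add integrable_mult_right integrable_divide LpD(2) f g)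
  have int_sum: "integrable lborel (\<lambda>x. norm (f x + g x) ^ p)"
    by (rule Bochner_Integration.integrable_bound[OF int[of "1/2"]])
       (use pt[of "1/2"] in \<open>auto intro!: AE_I2 order_trans[OF _ abs_ge_self]\<close>)
  then show "(\<lambda>x. f x + g x) \<in> Lp p" by (simp add: Lp_def)
  show "Lp_norm p (\<lambda>x. f x + g x) \<le> Lp_norm p f + Lp_norm p g"
  proof (rule le_of_le_approx_add)
    fix a b assume ab: "Lp_norm p f < a" "Lp_norm p g < b"
    have a: "0 < a" and b: "0 < b"
      using ab Lp_norm_nonneg[OF p, of f] Lp_norm_nonneg[OF p, of g] by linarith+
    \<comment> \<open>makes both fractions in \<open>power_add_le_convex\<close> equal to \<open>a + b\<close>\<close>
    define l where "l = b / (a + b)"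
    have l: "0 < l" "l < 1" "1 - l = a / (a + b)" using a b by (auto simp: l_def field_simps)
    have "(LINT x|lborel. norm (f x + g x) ^ p)
        \<le> (LINT x|lborel. (1 - l) * (norm (f x) / (1 - l)) ^ p + l * (norm (g x) / l) ^ p)"
      using pt[OF l(1,2)] by (intro integral_mono int_sum int)
    also have "\<dots> = (1 - l) * (Lp_norm p f / (1 - l)) ^ p + l * (Lp_norm p g / l) ^ p"
      unfolding power_divide Lp_norm_power[OF p]
      by (subst Bochner_Integration.integral_add)
         (auto intro!: integrable_mult_right integrable_divide LpD(2) f g)
    also have "\<dots> \<le> (1 - l) * (a / (1 - l)) ^ p + l * (b / l) ^ p"
      using ab l(1,2) Lp_norm_nonneg[OF p, of f] Lp_norm_nonneg[OF p, of g]
      by (intro add_mono mult_left_mono power_mono divide_right_mono divide_nonneg_nonneg) auto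
    also have "\<dots> = (a + b) ^ p"
    proof -
      have "a / (1 - l) = a + b" using a b unfolding l(3) by simp
      moreover have "b / l = a + b" using a b unfolding l_def by simp
      ultimately show ?thesis by (simp add: algebra_simps)
    qed
    finally show "Lp_norm p (\<lambda>x. f x + g x) \<le> a + b"
      using a b p by (intro Lp_norm_leI) auto
  qed
qed

lemma Lp_norm_cmult: "Lp_norm p (\<lambda>x. c * f x) = norm c * Lp_norm p f" if "0 < p"
  using that by (simp add: Lp_norm_def norm_mult power_mult_distrib real_root_mult real_root_power_cancel)

lemma Lp_cmult:
  assumes "f \<in> Lp p"
  shows "(\<lambda>x. c * f x) \<in> Lp p"
  using assms by (auto simp: Lp_def norm_mult power_mult_distrib)

lemma Lp_diff:
  assumes f: "f \<in> Lp p" and g: "g \<in> Lp p" and p: "0 < p"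
  shows "(\<lambda>x. f x - g x) \<in> Lp p" "Lp_norm p (\<lambda>x. f x - g x) \<le> Lp_norm p f + Lp_norm p g"
  using Lp_add[OF f Lp_cmult[OF g, of "-1"] p] Lp_norm_cmult[OF p, of "-1" g] by simp_all

lemma Lp_zero: "0 < p \<Longrightarrow> (\<lambda>x. 0) \<in> Lp p"
  by (simp add: Lp_def power_0_left)

lemma Lp_sum:
  assumes "\<And>i. i \<in> I \<Longrightarrow> f i \<in> Lp p" "0 < p"
  shows "(\<lambda>x. \<Sum>i\<in>I. f i x) \<in> Lp p"
  using assms(1)
  by (induction I rule: infinite_finite_induct) (auto simp: Lp_zero Lp_add assms(2))

lemma Lp_norm_minus_commute: "Lp_norm p (\<lambda>x. f x - g x) = Lp_norm p (\<lambda>x. g x - f x)"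
  by (simp add: Lp_norm_def norm_minus_commute)

lemma Lp_norm_diff_le:
  assumes f: "f \<in> Lp p" and g: "g \<in> Lp p" and p: "0 < p"
  shows "\<bar>Lp_norm p f - Lp_norm p g\<bar> \<le> Lp_norm p (\<lambda>x. f x - g x)"
  using Lp_add(2)[OF Lp_diff(1)[OF f g p] g p] Lp_add(2)[OF Lp_diff(1)[OF g f p] f p]
  by (simp add: Lp_norm_minus_commute[of p f g])

lemma Lp_cong_AE:
  assumes "AE x in lborel. f x = g x" "f \<in> borel_measurable lborel" "g \<in> borel_measurable lborel"
  shows "f \<in> Lp p \<longleftrightarrow> g \<in> Lp p" "Lp_norm p f = Lp_norm p g"
proof -
  note [measurable] = assms(2,3)
  have ae: "AE x in lborel. norm (f x) ^ p = norm (g x) ^ p" using assms(1) by eventually_elim simp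
  have "integrable lborel (\<lambda>x. norm (f x) ^ p) \<longleftrightarrow> integrable lborel (\<lambda>x. norm (g x) ^ p)"
    by (rule integrable_cong_AE[OF _ _ ae]) measurable
  then show "f \<in> Lp p \<longleftrightarrow> g \<in> Lp p" using assms by (simp add: Lp_def)
  have "(LINT x|lborel. norm (f x) ^ p) = (LINT x|lborel. norm (g x) ^ p)"
    by (rule integral_cong_AE[OF _ _ ae]) measurable
  then show "Lp_norm p f = Lp_norm p g" by (simp add: Lp_norm_def)
qed

lemma Lp_norm_eq_0_AE:
  assumes "f \<in> Lp p" "Lp_norm p f = 0" "0 < p"
  shows "AE x in lborel. f x = 0"
proof -
  have "(LINT x|lborel. norm (f x) ^ p) = 0"
    using Lp_norm_power[OF assms(3), of f] assms by (simp add: power_0_left)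
  then have "AE x in lborel. norm (f x) ^ p = 0"
    using integral_nonneg_eq_0_iff_AE[OF LpD(2)[OF assms(1)]] by simp
  then show ?thesis by eventually_elim simp
qed

text \<open>
  The Cauchy-Schwarz inequality, from \<open>2 s t \<le> s\<^sup>2 + t\<^sup>2\<close> after scaling by upper bounds of the norms.
\<close>

lemma L2_mult:
  assumes f: "f \<in> Lp 2" and g: "g \<in> Lp 2"
  shows "integrable lborel (\<lambda>x. f x * g x)"
    "norm (LINT x|lborel. f x * g x) \<le> Lp_norm 2 f * Lp_norm 2 g"
proof -
  note [measurable] = LpD(1)[OF f] LpD(1)[OF g]
  have pt: "norm (f x * g x) \<le> a * b * (((norm (f x))\<^sup>2 / a\<^sup>2 + (norm (g x))\<^sup>2 / b\<^sup>2) / 2)"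
    if "0 < a" "0 < b" for a b x
  proof -
    have "norm (f x) / a * (norm (g x) / b) \<le> ((norm (f x) / a)\<^sup>2 + (norm (g x) / b)\<^sup>2) / 2"
      using sum_squares_bound[of "norm (f x) / a" "norm (g x) / b"] by (simp add: mult_ac)
    then have "a * b * (norm (f x) / a * (norm (g x) / b)) \<le> a * b * (((norm (f x) / a)\<^sup>2 + (norm (g x) / b)\<^sup>2) / 2)"
      using that by (intro mult_left_mono) auto
    then show ?thesis using that by (simp add: norm_mult power_divide)
  qed
  have int: "integrable lborel (\<lambda>x. a * b * (((norm (f x))\<^sup>2 / a\<^sup>2 + (norm (g x))\<^sup>2 / b\<^sup>2) / 2))" for a b
    by (intro Bochner_Integration.integrable_add integrable_mult_right integrable_divide LpD(2) f g)
  show fg: "integrable lborel (\<lambda>x. f x * g x)"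
    by (rule Bochner_Integration.integrable_bound[OF int[of 1 1]])
       (use pt[of 1 1] in \<open>auto intro!: AE_I2 order_trans[OF _ abs_ge_self]\<close>)
  show "norm (LINT x|lborel. f x * g x) \<le> Lp_norm 2 f * Lp_norm 2 g"
  proof (rule le_of_le_approx_mult)
    fix a b assume ab: "Lp_norm 2 f < a" "Lp_norm 2 g < b"
    have a: "0 < a" and b: "0 < b"
      using ab Lp_norm_nonneg[of 2 f] Lp_norm_nonneg[of 2 g] by linarith+
    have "norm (LINT x|lborel. f x * g x) \<le> (LINT x|lborel. norm (f x * g x))" by simp
    also have "\<dots> \<le> (LINT x|lborel. a * b * (((norm (f x))\<^sup>2 / a\<^sup>2 + (norm (g x))\<^sup>2 / b\<^sup>2) / 2))"
      using pt[OF a b] by (intro integral_mono integrable_norm fg int)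
    also have "\<dots> = a * b * (((Lp_norm 2 f)\<^sup>2 / a\<^sup>2 + (Lp_norm 2 g)\<^sup>2 / b\<^sup>2) / 2)"
      using LpD(2)[OF f] LpD(2)[OF g] by (simp add: Lp_norm_power)
    also have "\<dots> \<le> a * b * ((1 + 1) / 2)"
      using ab a b by (intro mult_left_mono divide_right_mono add_mono) (auto simp: power_mono)
    finally show "norm (LINT x|lborel. f x * g x) \<le> a * b" by simp
  qed
qed

lemma Lp_Fatou:
  fixes f :: "'a::euclidean_space \<Rightarrow> complex"
  assumes fk: "\<And>k. fk k \<in> Lp p" and f[measurable]: "f \<in> borel_measurable lborel"
    and lim: "AE x in lborel. (\<lambda>k. fk k x) \<longlonglongrightarrow> f x"
    and le: "\<And>k. Lp_norm p (fk k) \<le> c" and p: "0 < p"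
  shows "f \<in> Lp p" "Lp_norm p f \<le> c"
proof -
  note [measurable] = LpD(1)[OF fk]
  have c: "0 \<le> c" using le[of 0] Lp_norm_nonneg[OF p, of "fk 0"] by linarith
  have "(\<integral>\<^sup>+x. ennreal (norm (f x) ^ p) \<partial>lborel) = (\<integral>\<^sup>+x. liminf (\<lambda>k. ennreal (norm (fk k x) ^ p)) \<partial>lborel)"
  proof (rule nn_integral_cong_AE)
    show "AE x in lborel. ennreal (norm (f x) ^ p) = liminf (\<lambda>k. ennreal (norm (fk k x) ^ p))"
      using lim
    proof eventually_elim
      case (elim x)
      then have "(\<lambda>k. ennreal (norm (fk k x) ^ p)) \<longlonglongrightarrow> ennreal (norm (f x) ^ p)"
        by (intro tendsto_intros)
      from lim_imp_Liminf[OF trivial_limit_sequentially this] show ?case by simp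
    qed
  qed
  also have "\<dots> \<le> liminf (\<lambda>k. \<integral>\<^sup>+x. ennreal (norm (fk k x) ^ p) \<partial>lborel)"
    by (rule nn_integral_liminf) measurable
  also have "\<dots> \<le> liminf (\<lambda>k. ennreal (c ^ p))"
  proof (intro Liminf_mono always_eventually allI)
    fix k
    have "(\<integral>\<^sup>+x. ennreal (norm (fk k x) ^ p) \<partial>lborel) = ennreal (Lp_norm p (fk k) ^ p)"
      unfolding Lp_norm_power[OF p] by (rule nn_integral_eq_integral[OF LpD(2)[OF fk]]) simp
    also have "\<dots> \<le> ennreal (c ^ p)" using le p by (intro ennreal_leI power_mono) auto
    finally show "(\<integral>\<^sup>+x. ennreal (norm (fk k x) ^ p) \<partial>lborel) \<le> ennreal (c ^ p)" .
  qed
  also have "\<dots> = ennreal (c ^ p)" by (simp add: Liminf_const)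
  finally have le: "(\<integral>\<^sup>+x. ennreal (norm (f x) ^ p) \<partial>lborel) \<le> ennreal (c ^ p)" .
  then have int: "integrable lborel (\<lambda>x. norm (f x) ^ p)"
    by (intro integrableI_bounded) (auto simp: norm_power intro: le_less_trans)
  then show "f \<in> Lp p" by (simp add: Lp_def)
  have "ennreal (LINT x|lborel. norm (f x) ^ p) \<le> ennreal (c ^ p)"
    using le nn_integral_eq_integral[OF int] by simp
  then have "(LINT x|lborel. norm (f x) ^ p) \<le> c ^ p" using c by simp
  then show "Lp_norm p f \<le> c" by (rule Lp_norm_leI[OF p _ c])
qed

section \<open>Radial integrals in the plane\<close>

text \<open>
  The area of a disc of radius \<open>sqrt a\<close> is \<open>pi * a\<close>, so in the variable \<open>s = |x|\<^sup>2\<close> the Lebesgue measure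
  of the plane is a multiple of the Lebesgue measure on the half-line.
\<close>

lemma distr_norm_squared:
  "distr lborel borel (\<lambda>x::real^2. (norm x)\<^sup>2) = density lborel (\<lambda>s. ennreal (pi * indicator {0..} s))"
proof (rule measure_eqI_generator_eq[where \<Omega> = UNIV and E = "range (\<lambda>a::real. {..a})" and A = "\<lambda>i. {..real i}"])
  show "Int_stable (range (\<lambda>a::real. {..a}))"
    by (auto simp: Int_stable_def)
  have sig: "sets borel = sigma_sets UNIV (range (\<lambda>a::real. {..a}))"
    by (subst borel_eq_atMost) (auto simp: sets_measure_of)
  show "sets (distr lborel borel (\<lambda>x::real^2. (norm x)\<^sup>2)) = sigma_sets UNIV (range (\<lambda>a::real. {..a}))"
    using sig by simp
  show "sets (density lborel (\<lambda>s. ennreal (pi * indicator {0..} s))) = sigma_sets UNIV (range (\<lambda>a::real. {..a}))"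
    using sig by simp
  have M: "emeasure (distr lborel borel (\<lambda>x::real^2. (norm x)\<^sup>2)) {..a} = ennreal (pi * max 0 a)" for a :: real
  proof (cases "0 \<le> a")
    case True
    have "(norm x)\<^sup>2 \<le> a \<longleftrightarrow> norm x \<le> sqrt a" for x :: "real^2"
      using True real_le_rsqrt[of "norm x" a] power_mono[of "norm x" "sqrt a" 2] by auto
    then have "(\<lambda>x::real^2. (norm x)\<^sup>2) -` {..a} = cball 0 (sqrt a)"
      by (auto simp: cball_def)
    then show ?thesis using True
      by (subst emeasure_distr) (auto simp: emeasure_cball unit_ball_vol_2)
  next
    case False
    have "\<not> (norm x)\<^sup>2 \<le> a" for x :: "real^2"
      using False zero_le_power2[of "norm x"] by linarith
    then have "(\<lambda>x::real^2. (norm x)\<^sup>2) -` {..a} = {}" by auto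
    then show ?thesis using False by (subst emeasure_distr) auto
  qed
  have N: "emeasure (density lborel (\<lambda>s. ennreal (pi * indicator {0..} s))) {..a} = ennreal (pi * max 0 a)" for a :: real
  proof -
    have "emeasure (density lborel (\<lambda>s. ennreal (pi * indicator {0..} s))) {..a}
        = (\<integral>\<^sup>+s. ennreal pi * indicator {0..a} s \<partial>lborel)"
      by (subst emeasure_density) (auto intro!: nn_integral_cong simp: indicator_def)
    also have "\<dots> = ennreal pi * emeasure lborel {0..a}" by (subst nn_integral_cmult_indicator) auto
    also have "\<dots> = ennreal (pi * max 0 a)"
      by (cases "0 \<le> a") (auto simp: ennreal_mult)
    finally show ?thesis .
  qed
  show "emeasure (distr lborel borel (\<lambda>x::real^2. (norm x)\<^sup>2)) X
      = emeasure (density lborel (\<lambda>s. ennreal (pi * indicator {0..} s))) X" if "X \<in> range (\<lambda>a::real. {..a})" for X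
    using that M N by auto
  show "emeasure (distr lborel borel (\<lambda>x::real^2. (norm x)\<^sup>2)) {..real i} \<noteq> \<infinity>" for i
    unfolding M by simp
  show "(\<Union>i. {..real i}) = UNIV" by (auto intro: real_arch_simple)
qed auto

lemma radial_integral:
  fixes F :: "real \<Rightarrow> 'b::{banach, second_countable_topology}"
  assumes [measurable]: "F \<in> borel_measurable borel"
  shows "integrable lborel (\<lambda>x::real^2. F ((norm x)\<^sup>2)) \<longleftrightarrow> set_integrable lborel {0<..} F"
    "(LINT x|lborel. F ((norm (x::real^2))\<^sup>2)) = pi *\<^sub>R (LINT s:{0<..}|lborel. F s)"
proof -
  have "AE s in lborel. s \<noteq> (0::real)" by (rule AE_lborel_singleton)
  then have ae: "AE s in lborel. (pi * indicator {0..} s) *\<^sub>R F s = pi *\<^sub>R (indicat_real {0<..} s *\<^sub>R F s)"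
    by eventually_elim (auto simp: indicator_def)
  have scale: "integrable lborel (\<lambda>s. pi *\<^sub>R (indicat_real {0<..} s *\<^sub>R F s))
      \<longleftrightarrow> integrable lborel (\<lambda>s. indicat_real {0<..} s *\<^sub>R F s)"
    using integrable_scaleR_right[of "1 / pi" lborel "\<lambda>s. pi *\<^sub>R (indicat_real {0<..} s *\<^sub>R F s)"]
      integrable_scaleR_right[of pi lborel "\<lambda>s. indicat_real {0<..} s *\<^sub>R F s"] by auto
  have "integrable lborel (\<lambda>x::real^2. F ((norm x)\<^sup>2)) \<longleftrightarrow> integrable (distr lborel borel (\<lambda>x::real^2. (norm x)\<^sup>2)) F"
    by (subst integrable_distr_eq) auto
  also have "\<dots> \<longleftrightarrow> integrable lborel (\<lambda>s. (pi * indicator {0..} s) *\<^sub>R F s)"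
    unfolding distr_norm_squared by (subst integrable_density) auto
  also have "\<dots> \<longleftrightarrow> integrable lborel (\<lambda>s. pi *\<^sub>R (indicat_real {0<..} s *\<^sub>R F s))"
    by (rule integrable_cong_AE[OF _ _ ae]) measurable
  also have "\<dots> \<longleftrightarrow> set_integrable lborel {0<..} F"
    unfolding set_integrable_def by (rule scale)
  finally show "integrable lborel (\<lambda>x::real^2. F ((norm x)\<^sup>2)) \<longleftrightarrow> set_integrable lborel {0<..} F" .
  have "(LINT x|lborel. F ((norm (x::real^2))\<^sup>2)) = integral\<^sup>L (distr lborel borel (\<lambda>x::real^2. (norm x)\<^sup>2)) F"
    by (subst integral_distr) auto
  also have "\<dots> = (LINT s|lborel. (pi * indicator {0..} s) *\<^sub>R F s)"
    unfolding distr_norm_squared by (subst integral_density) auto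
  also have "\<dots> = (LINT s|lborel. pi *\<^sub>R (indicat_real {0<..} s *\<^sub>R F s))"
    by (rule integral_cong_AE[OF _ _ ae]) measurable
  also have "\<dots> = pi *\<^sub>R (LINT s:{0<..}|lborel. F s)"
  proof (cases "integrable lborel (\<lambda>s. indicat_real {0<..} s *\<^sub>R F s)")
    case True
    then show ?thesis unfolding set_lebesgue_integral_def by (intro integral_scaleR_right)
  next
    case False
    then have "\<not> integrable lborel (\<lambda>s. pi *\<^sub>R (indicat_real {0<..} s *\<^sub>R F s))" using scale by blast
    from not_integrable_integral_eq[OF this] not_integrable_integral_eq[OF False] show ?thesis
      unfolding set_lebesgue_integral_def by (simp only: scaleR_zero_right)
  qed
  finally show "(LINT x|lborel. F ((norm (x::real^2))\<^sup>2)) = pi *\<^sub>R (LINT s:{0<..}|lborel. F s)" .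
qed

section \<open>Explicit evolution of Laguerre modes\<close>

text \<open>
  The polynomial \<open>Lag n\<close> with complex coefficients. The evolved modes are then holomorphic in the
  time-like variable \<open>\<zeta>\<close> and in the square of the radius, and can be differentiated as such.
\<close>

definition LagC :: "nat \<Rightarrow> complex poly" where
  "LagC n = (\<Sum>k\<le>n. monom (of_nat (n choose k) * (-1) ^ k / fact k) k)"

lemma coeff_LagC: "coeff (LagC n) k = of_nat (n choose k) * (-1) ^ k / fact k"
  by (auto simp: LagC_def coeff_sum binomial_eq_0)

lemma poly_LagC_of_real: "poly (LagC n) (of_real x) = of_real (poly (Lag n) x)"
  unfolding LagC_def Lag_def poly_sum of_real_sum poly_monom
  by (intro sum.cong refl) simp

lemma Laguerre_ODE:
  "z * poly (pderiv (pderiv (LagC n))) z = (z - 1) * poly (pderiv (LagC n)) z - of_nat n * poly (LagC n) z"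
proof -
  let ?L = "LagC n"
  have "pCons 0 (pderiv (pderiv ?L)) + pderiv ?L - pCons 0 (pderiv ?L) + smult (of_nat n) ?L = 0"
  proof (rule poly_eqI)
    fix k
    have rec: "of_nat (Suc k) * of_nat (Suc k) * coeff ?L (Suc k) + (of_nat n - of_nat k) * coeff ?L k = 0"
    proof (cases "k \<le> n")
      case True
      have "of_nat (Suc k * (n choose Suc k)) = (of_nat ((n - k) * (n choose k)) :: complex)"
        using binomial_absorption[of k n] binomial_absorb_comp[of n k] by (metis mult.commute)
      from this[unfolded of_nat_mult of_nat_diff[OF True]]
      have b: "of_nat (Suc k) * of_nat (n choose Suc k) = (of_nat n - of_nat k) * (of_nat (n choose k) :: complex)"
        .
      have "of_nat (Suc k) * of_nat (Suc k) * coeff ?L (Suc k)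
          = of_nat (Suc k) * of_nat (n choose Suc k) * ((-1) ^ Suc k / fact k)"
        unfolding coeff_LagC fact_Suc by (simp del: of_nat_Suc)
      also have "\<dots> = - ((of_nat n - of_nat k) * coeff ?L k)"
        unfolding b by (simp add: coeff_LagC)
      finally show ?thesis by simp
    qed (simp add: coeff_LagC binomial_eq_0)
    show "coeff (pCons 0 (pderiv (pderiv ?L)) + pderiv ?L - pCons 0 (pderiv ?L) + smult (of_nat n) ?L) k = coeff 0 k"
      using rec by (cases k) (simp_all add: coeff_pderiv algebra_simps)
  qed
  then have "poly (pCons 0 (pderiv (pderiv ?L)) + pderiv ?L - pCons 0 (pderiv ?L) + smult (of_nat n) ?L) z = 0"
    by simp
  then show ?thesis by (simp add: algebra_simps)
qed

abbreviation cpi :: complex where "cpi \<equiv> complex_of_real pi"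

text \<open>
  The evolution of \<open>Psi n\<close> at time \<open>t\<close>, as a function of \<open>\<zeta> = 1 + 4 \<pi> i t\<close> and \<open>z = |x|\<^sup>2\<close>. For real \<open>t\<close>
  the number \<open>2 - \<zeta>\<close> is the conjugate of \<open>\<zeta>\<close>; writing it this way keeps the formula holomorphic.
  The functions \<open>mode_z\<close> and \<open>mode_zz\<close> are the first two derivatives in \<open>z\<close>.
\<close>

definition mode :: "nat \<Rightarrow> complex \<Rightarrow> complex \<Rightarrow> complex" where
  "mode n \<zeta> z = (2 - \<zeta>) ^ n / \<zeta> ^ Suc n * poly (LagC n) (2 * cpi * z / (\<zeta> * (2 - \<zeta>))) * exp (- cpi * z / \<zeta>)"

definition mode_z :: "nat \<Rightarrow> complex \<Rightarrow> complex \<Rightarrow> complex" where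
  "mode_z n \<zeta> z = (2 - \<zeta>) ^ n / \<zeta> ^ Suc n *
     (2 * cpi / (\<zeta> * (2 - \<zeta>)) * poly (pderiv (LagC n)) (2 * cpi * z / (\<zeta> * (2 - \<zeta>)))
      - cpi / \<zeta> * poly (LagC n) (2 * cpi * z / (\<zeta> * (2 - \<zeta>)))) * exp (- cpi * z / \<zeta>)"

definition mode_zz :: "nat \<Rightarrow> complex \<Rightarrow> complex \<Rightarrow> complex" where
  "mode_zz n \<zeta> z = (2 - \<zeta>) ^ n / \<zeta> ^ Suc n *
     ((2 * cpi / (\<zeta> * (2 - \<zeta>)))\<^sup>2 * poly (pderiv (pderiv (LagC n))) (2 * cpi * z / (\<zeta> * (2 - \<zeta>)))
      - 2 * (2 * cpi / (\<zeta> * (2 - \<zeta>))) * (cpi / \<zeta>) * poly (pderiv (LagC n)) (2 * cpi * z / (\<zeta> * (2 - \<zeta>)))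
      + (cpi / \<zeta>)\<^sup>2 * poly (LagC n) (2 * cpi * z / (\<zeta> * (2 - \<zeta>)))) * exp (- cpi * z / \<zeta>)"

lemma mode_z_derivative:
  "(mode n \<zeta> has_field_derivative mode_z n \<zeta> z) (at z)"
proof -
  define b where "b = 2 * cpi / (\<zeta> * (2 - \<zeta>))"
  define g where "g = cpi / \<zeta>"
  define A where "A = (2 - \<zeta>) ^ n / \<zeta> ^ Suc n"
  have 1: "mode n \<zeta> = (\<lambda>z. A * poly (LagC n) (b * z) * exp (- g * z))"
    by (rule ext) (simp add: mode_def A_def b_def g_def)
  have 2: "mode_z n \<zeta> z = A * (b * poly (pderiv (LagC n)) (b * z) - g * poly (LagC n) (b * z)) * exp (- g * z)"
    by (simp add: mode_z_def A_def b_def g_def)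
  have p: "((\<lambda>z. poly p (b * z)) has_field_derivative (b * poly (pderiv p) (b * z))) (at z)" for p
    by (rule DERIV_chain2[OF poly_DERIV, THEN DERIV_cong]) (auto intro!: derivative_eq_intros)
  show ?thesis
    unfolding 1 2 by (auto intro!: derivative_eq_intros p simp: algebra_simps)
qed

lemma mode_zz_derivative:
  "(mode_z n \<zeta> has_field_derivative mode_zz n \<zeta> z) (at z)"
proof -
  define b where "b = 2 * cpi / (\<zeta> * (2 - \<zeta>))"
  define g where "g = cpi / \<zeta>"
  define A where "A = (2 - \<zeta>) ^ n / \<zeta> ^ Suc n"
  have 1: "mode_z n \<zeta> = (\<lambda>z. A * (b * poly (pderiv (LagC n)) (b * z) - g * poly (LagC n) (b * z)) * exp (- g * z))"
    by (rule ext) (simp add: mode_z_def A_def b_def g_def)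
  have 2: "mode_zz n \<zeta> z = A * (b\<^sup>2 * poly (pderiv (pderiv (LagC n))) (b * z)
      - 2 * b * g * poly (pderiv (LagC n)) (b * z) + g\<^sup>2 * poly (LagC n) (b * z)) * exp (- g * z)"
    by (simp add: mode_zz_def A_def b_def g_def)
  have p: "((\<lambda>z. poly p (b * z)) has_field_derivative (b * poly (pderiv p) (b * z))) (at z)" for p
    by (rule DERIV_chain2[OF poly_DERIV, THEN DERIV_cong]) (auto intro!: derivative_eq_intros)
  show ?thesis
    unfolding 1 2 by (auto intro!: derivative_eq_intros p simp: algebra_simps power2_eq_square)
qed

text \<open>
  The Schroedinger equation in radial form: \<open>z \<partial>\<^sub>z\<^sup>2 + \<partial>\<^sub>z\<close> is a quarter of the Laplacian in the variable
  \<open>z = |x|\<^sup>2\<close>. After differentiation everything reduces to the Laguerre equation at the point \<open>y\<close>.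
\<close>

lemma mode_zeta_derivative:
  assumes nz: "\<zeta> \<noteq> 0" "\<zeta> \<noteq> 2"
  shows "((\<lambda>\<zeta>. mode n \<zeta> z) has_field_derivative (z * mode_zz n \<zeta> z + mode_z n \<zeta> z) / cpi) (at \<zeta>)"
proof -
  let ?L = "LagC n"
  define y where "y = 2 * cpi * z / (\<zeta> * (2 - \<zeta>))"
  define A where "A = (2 - \<zeta>) ^ n / \<zeta> ^ Suc n"
  define E where "E = exp (- cpi * z / \<zeta>)"
  have nz': "2 - \<zeta> \<noteq> 0" using nz by simp
  have pow: "of_nat n * (2 - \<zeta>) ^ (n - Suc 0) = of_nat n * (2 - \<zeta>) ^ n / (2 - \<zeta>)"
    using nz' by (cases n) auto
  have pw: "of_nat n * \<zeta> ^ (n - Suc 0) * \<zeta> = of_nat n * \<zeta> ^ n" by (cases n) auto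
  have dA: "((\<lambda>\<zeta>. (2 - \<zeta>) ^ n / \<zeta> ^ Suc n) has_field_derivative
      A * (- of_nat n / (2 - \<zeta>) - (of_nat n + 1) / \<zeta>)) (at \<zeta>)"
  proof -
    have "((\<lambda>\<zeta>. (2 - \<zeta>) ^ n / \<zeta> ^ Suc n) has_field_derivative
      ((- (of_nat n * (2 - \<zeta>) ^ (n - Suc 0))) * \<zeta> ^ Suc n - (2 - \<zeta>) ^ n * (of_nat (Suc n) * \<zeta> ^ n)) / (\<zeta> ^ Suc n * \<zeta> ^ Suc n)) (at \<zeta>)"
      using nz by (auto intro!: derivative_eq_intros) (simp only: pw, simp add: distrib_right)
    moreover have "((- (of_nat n * (2 - \<zeta>) ^ (n - Suc 0))) * \<zeta> ^ Suc n - (2 - \<zeta>) ^ n * (of_nat (Suc n) * \<zeta> ^ n)) / (\<zeta> ^ Suc n * \<zeta> ^ Suc n)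
      = A * (- of_nat n / (2 - \<zeta>) - (of_nat n + 1) / \<zeta>)"
      unfolding pow A_def using nz nz' by (simp add: divide_simps) (simp add: algebra_simps)
    ultimately show ?thesis by simp
  qed
  have dy: "((\<lambda>\<zeta>. 2 * cpi * z / (\<zeta> * (2 - \<zeta>))) has_field_derivative y * (2 * (\<zeta> - 1) / (\<zeta> * (2 - \<zeta>)))) (at \<zeta>)"
  proof -
    have dq: "((\<lambda>\<zeta>. \<zeta> * (2 - \<zeta>)) has_field_derivative (2 - 2 * \<zeta>)) (at \<zeta>)"
      by (auto intro!: derivative_eq_intros)
    have q: "\<zeta> * (2 - \<zeta>) \<noteq> 0" using nz nz' by simp
    show ?thesis
      unfolding y_def
      by (rule DERIV_cong[OF DERIV_divide[OF DERIV_const dq q]])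
         (simp only: times_divide_times_eq, simp add: right_diff_distrib)
  qed
  have dL: "((\<lambda>\<zeta>. poly ?L (2 * cpi * z / (\<zeta> * (2 - \<zeta>)))) has_field_derivative
      poly (pderiv ?L) y * (y * (2 * (\<zeta> - 1) / (\<zeta> * (2 - \<zeta>))))) (at \<zeta>)"
    by (rule DERIV_chain2[OF poly_DERIV dy, folded y_def])
  have dE: "((\<lambda>\<zeta>. exp (- cpi * z / \<zeta>)) has_field_derivative E * (cpi * z / \<zeta>\<^sup>2)) (at \<zeta>)"
    unfolding E_def using nz
    by (auto intro!: derivative_eq_intros simp: power2_eq_square)
  have "((\<lambda>\<zeta>. mode n \<zeta> z) has_field_derivative
      A * E * (poly (pderiv ?L) y * (y * (2 * (\<zeta> - 1) / (\<zeta> * (2 - \<zeta>))))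
        + poly ?L y * (cpi * z / \<zeta>\<^sup>2 - of_nat n / (2 - \<zeta>) - (of_nat n + 1) / \<zeta>))) (at \<zeta>)"
  proof -
    define d1 d2 d3 where "d1 = - of_nat n / (2 - \<zeta>) - (of_nat n + 1) / \<zeta>"
      and "d2 = y * (2 * (\<zeta> - 1) / (\<zeta> * (2 - \<zeta>)))" and "d3 = cpi * z / \<zeta>\<^sup>2"
    have d31: "cpi * z / \<zeta>\<^sup>2 - of_nat n / (2 - \<zeta>) - (of_nat n + 1) / \<zeta> = d3 + d1"
      by (simp add: d1_def d3_def)
    show ?thesis
      unfolding mode_def d31 d2_def[symmetric]
      by (rule DERIV_cong[OF DERIV_mult'[OF DERIV_mult'[OF dA dL] dE]])
         (simp only: A_def[symmetric] y_def[symmetric] E_def[symmetric] d1_def[symmetric] d2_def[symmetric] d3_def[symmetric],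
          simp only: distrib_left distrib_right mult_ac add_ac)
  qed
  moreover have "(z * mode_zz n \<zeta> z + mode_z n \<zeta> z)
      = cpi * (A * E * (poly (pderiv ?L) y * (y * (2 * (\<zeta> - 1) / (\<zeta> * (2 - \<zeta>))))
        + poly ?L y * (cpi * z / \<zeta>\<^sup>2 - of_nat n / (2 - \<zeta>) - (of_nat n + 1) / \<zeta>)))"
  proof -
    define b where "b = 2 * cpi / (\<zeta> * (2 - \<zeta>))"
    define g where "g = cpi / \<zeta>"
    have yb: "y = b * z" by (simp add: y_def b_def)
    define P0 P1 P2 where "P0 = poly ?L y" and "P1 = poly (pderiv ?L) y" and "P2 = poly (pderiv (pderiv ?L)) y"
    have ode: "y * P2 = (y - 1) * P1 - of_nat n * P0"
      unfolding P0_def P1_def P2_def by (rule Laguerre_ODE)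
    have "z * mode_zz n \<zeta> z + mode_z n \<zeta> z
        = A * E * (z * (b\<^sup>2 * P2 - 2 * b * g * P1 + g\<^sup>2 * P0) + b * P1 - g * P0)"
      unfolding mode_zz_def mode_z_def A_def[symmetric] y_def[symmetric] E_def[symmetric] b_def[symmetric]
        g_def[symmetric] P0_def[symmetric] P1_def[symmetric] P2_def[symmetric]
      by (simp add: algebra_simps)
    also have "z * (b\<^sup>2 * P2 - 2 * b * g * P1 + g\<^sup>2 * P0) + b * P1 - g * P0
        = b * (y * P2) - 2 * g * y * P1 + z * g\<^sup>2 * P0 + b * P1 - g * P0"
      unfolding yb by (simp add: algebra_simps power2_eq_square)
    also have "\<dots> = (b - 2 * g) * y * P1 + (z * g\<^sup>2 - g - of_nat n * b) * P0"
      unfolding ode by (simp add: algebra_simps)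
    also have "b - 2 * g = cpi * (2 * (\<zeta> - 1) / (\<zeta> * (2 - \<zeta>)))"
      unfolding b_def g_def using nz nz' by (simp add: field_simps)
    also have "z * g\<^sup>2 - g - of_nat n * b = cpi * (cpi * z / \<zeta>\<^sup>2 - of_nat n / (2 - \<zeta>) - (of_nat n + 1) / \<zeta>)"
    proof -
      have "of_nat n / (2 - \<zeta>) + of_nat n / \<zeta> = of_nat n * (2 / (\<zeta> * (2 - \<zeta>)))"
        using nz nz' by (simp add: field_simps)
      then have "cpi * (cpi * z / \<zeta>\<^sup>2 - of_nat n / (2 - \<zeta>) - (of_nat n + 1) / \<zeta>)
         = cpi * (cpi * z / \<zeta>\<^sup>2 - of_nat n * (2 / (\<zeta> * (2 - \<zeta>))) - 1 / \<zeta>)"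
        by (simp add: add_divide_distrib algebra_simps)
      then show ?thesis unfolding b_def g_def by (simp add: power2_eq_square algebra_simps)
    qed
    finally show ?thesis unfolding P0_def P1_def by (simp add: algebra_simps)
  qed
  ultimately show ?thesis by simp
qed

section \<open>Second-order calculus in the plane\<close>

definition twice_differentiable :: "(real^2 \<Rightarrow> complex) \<Rightarrow> bool" where
  "twice_differentiable f \<longleftrightarrow>
     (\<forall>x. f differentiable (at x)) \<and>
     (\<forall>i x. partial_deriv i f differentiable (at x)) \<and>
     (\<forall>i j. continuous_on UNIV (partial_deriv j (partial_deriv i f)))"

lemma test_function_iff:
  "test_function \<phi> \<longleftrightarrow> twice_differentiable \<phi> \<and> compact (closure {x. \<phi> x \<noteq> 0})"
  unfolding test_function_def twice_differentiable_def by auto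

lemma partial_deriv_eq:
  "(f has_derivative D) (at x) \<Longrightarrow> partial_deriv i f x = D (axis i 1)"
  unfolding partial_deriv_def by (simp add: frechet_derivative_at[symmetric])

lemma continuous_on_differentiable:
  "(\<And>x. f differentiable (at x)) \<Longrightarrow> continuous_on UNIV f"
  by (simp add: continuous_at_imp_continuous_on differentiable_imp_continuous_within)

lemma has_derivative_norm_sq_diff:
  fixes y :: "real^2"
  shows "((\<lambda>x. (norm (x - y))\<^sup>2) has_derivative (\<lambda>h. 2 * ((x - y) \<bullet> h))) (at x)"
  unfolding power2_norm_eq_inner
  by (auto intro!: derivative_eq_intros simp: inner_commute)

lemma radial_has_derivative:
  fixes y :: "real^2" and v :: "real \<Rightarrow> complex"
  assumes "(v has_vector_derivative v') (at ((norm (x - y))\<^sup>2))"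
  shows "((\<lambda>x. v ((norm (x - y))\<^sup>2)) has_derivative (\<lambda>h. (2 * ((x - y) \<bullet> h)) *\<^sub>R v')) (at x)"
  using has_derivative_compose[OF has_derivative_norm_sq_diff assms[unfolded has_vector_derivative_def]] .

text \<open>
  In terms of \<open>s = |x - y|\<^sup>2\<close> the Laplacian in the plane is \<open>4 (s \<partial>\<^sub>s\<^sup>2 + \<partial>\<^sub>s)\<close>. This serves both the evolved
  modes and the truncated Gaussians that are used as test functions.
\<close>

lemma radial_calculus:
  fixes y :: "real^2" and v v1 v2 :: "real \<Rightarrow> complex"
  defines "f \<equiv> (\<lambda>x. v ((norm (x - y))\<^sup>2))"
  assumes d1: "\<And>s. (v has_vector_derivative v1 s) (at s)"
    and d2: "\<And>s. (v1 has_vector_derivative v2 s) (at s)"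
    and cont: "continuous_on UNIV v2"
  shows "twice_differentiable f"
    "laplacian f x = 4 * (of_real ((norm (x - y))\<^sup>2) * v2 ((norm (x - y))\<^sup>2) + v1 ((norm (x - y))\<^sup>2))"
proof -
  have D: "(f has_derivative (\<lambda>h. (2 * ((x - y) \<bullet> h)) *\<^sub>R v1 ((norm (x - y))\<^sup>2))) (at x)" for x
    unfolding f_def by (rule radial_has_derivative[OF d1])
  have p1: "partial_deriv i f = (\<lambda>x. (2 * (x - y) $ i) *\<^sub>R v1 ((norm (x - y))\<^sup>2))" for i
    by (rule ext, subst partial_deriv_eq[OF D]) (simp add: inner_axis)
  have D2: "(partial_deriv i f has_derivative
      (\<lambda>h. (2 * (x - y) $ i) *\<^sub>R ((2 * ((x - y) \<bullet> h)) *\<^sub>R v2 ((norm (x - y))\<^sup>2)) + (2 * h $ i) *\<^sub>R v1 ((norm (x - y))\<^sup>2))) (at x)" for i x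
  proof -
    have "((\<lambda>x. 2 * (x - y) $ i) has_derivative (\<lambda>h. 2 * h $ i)) (at x)"
      by (auto intro!: derivative_eq_intros bounded_linear.has_derivative[OF bounded_linear_vec_nth])
    from has_derivative_scaleR[OF this radial_has_derivative[OF d2]]
    show ?thesis unfolding p1 .
  qed
  have p2: "partial_deriv j (partial_deriv i f) = (\<lambda>x. (2 * (x - y) $ i) *\<^sub>R ((2 * (x - y) $ j) *\<^sub>R v2 ((norm (x - y))\<^sup>2))
      + (2 * axis j 1 $ i) *\<^sub>R v1 ((norm (x - y))\<^sup>2))" for i j
    by (rule ext, subst partial_deriv_eq[OF D2]) (simp add: inner_axis)
  have c1: "continuous_on UNIV v1"
    using d2 by (intro continuous_at_imp_continuous_on ballI has_vector_derivative_continuous) auto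
  have cv: "continuous_on UNIV (\<lambda>x::real^2. w ((norm (x - y))\<^sup>2))" if "continuous_on UNIV w" for w :: "real \<Rightarrow> complex"
    by (rule continuous_on_compose2[OF that]) (auto intro!: continuous_intros)
  show "twice_differentiable f"
    unfolding twice_differentiable_def
  proof (intro conjI allI)
    show "f differentiable (at x)" for x using D differentiableI by blast
    show "partial_deriv i f differentiable (at x)" for i x using D2 differentiableI by blast
    show "continuous_on UNIV (partial_deriv j (partial_deriv i f))" for i j
      unfolding p2 by (intro continuous_intros cv cont c1)
  qed
  have ns: "(norm (x - y))\<^sup>2 = ((x - y) $ 1)\<^sup>2 + ((x - y) $ 2)\<^sup>2"
    unfolding power2_norm_eq_inner inner_vec_def sum_2 by (simp add: power2_eq_square)
  have "laplacian f x = (\<Sum>i\<in>UNIV. (4 * ((x - y) $ i)\<^sup>2) *\<^sub>R v2 ((norm (x - y))\<^sup>2) + 2 *\<^sub>R v1 ((norm (x - y))\<^sup>2))"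
    unfolding laplacian_def p2 by (intro sum.cong refl) (simp add: axis_def power2_eq_square scaleR_conv_of_real algebra_simps)
  also have "\<dots> = (4 * (((x - y) $ 1)\<^sup>2 + ((x - y) $ 2)\<^sup>2)) *\<^sub>R v2 ((norm (x - y))\<^sup>2) + 4 *\<^sub>R v1 ((norm (x - y))\<^sup>2)"
    unfolding sum_2 by (simp add: scaleR_conv_of_real algebra_simps)
  also have "\<dots> = 4 * (of_real ((norm (x - y))\<^sup>2) * v2 ((norm (x - y))\<^sup>2) + v1 ((norm (x - y))\<^sup>2))"
    unfolding ns[symmetric] by (simp add: scaleR_conv_of_real algebra_simps)
  finally show "laplacian f x = 4 * (of_real ((norm (x - y))\<^sup>2) * v2 ((norm (x - y))\<^sup>2) + v1 ((norm (x - y))\<^sup>2))" .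
qed

lemma integrable_compact_support:
  fixes f :: "'a::euclidean_space \<Rightarrow> 'b::euclidean_space"
  assumes c: "continuous_on UNIV f" and K: "compact K" "\<And>x. x \<notin> K \<Longrightarrow> f x = 0"
  shows "integrable lborel f"
proof -
  have "integrable lborel (\<lambda>x. indicator K x *\<^sub>R f x)"
    by (rule borel_integrable_compact[OF K(1) continuous_on_subset[OF c subset_UNIV]])
  moreover have "(\<lambda>x. indicator K x *\<^sub>R f x) = f"
    using K(2) by (auto simp: indicator_def)
  ultimately show ?thesis by simp
qed

lemma Lp_compact_support:
  fixes f :: "'a::euclidean_space \<Rightarrow> complex"
  assumes c: "continuous_on UNIV f" and K: "compact K" "\<And>x. x \<notin> K \<Longrightarrow> f x = 0" and "0 < p"
  shows "f \<in> Lp p"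
proof -
  have "integrable lborel (\<lambda>x. norm (f x) ^ p)"
    using K assms(4) by (intro integrable_compact_support[of _ K] continuous_intros c) auto
  then show ?thesis
    using borel_measurable_continuous_onI[OF c] by (simp add: Lp_def)
qed

lemma lborel_integral_eq_cbox:
  fixes f :: "'a::euclidean_space \<Rightarrow> complex"
  assumes "integrable lborel f" "\<And>x. x \<notin> cbox a b \<Longrightarrow> f x = 0"
  shows "(LINT x|lborel. f x) = integral (cbox a b) f"
proof -
  have "f = (\<lambda>x. if x \<in> cbox a b then f x else 0)" using assms(2) by auto
  then have "integral UNIV f = integral (cbox a b) f"
    by (metis integral_restrict_UNIV)
  then show ?thesis using integral_lborel[OF assms(1)] by simp
qed

lemma lborel_translation:
  fixes f :: "'a::euclidean_space \<Rightarrow> 'b::{banach, second_countable_topology}"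
  assumes [measurable]: "f \<in> borel_measurable borel"
  shows "integrable lborel (\<lambda>x. f (x - c)) \<longleftrightarrow> integrable lborel f"
    "(LINT x|lborel. f (x - c)) = (LINT x|lborel. f x)"
proof -
  have d: "distr lborel borel (\<lambda>x. x - c) = (lborel :: 'a measure)"
  proof -
    have "(\<lambda>x::'a. x - c) = (+) (- c)" by (rule ext) simp
    then show ?thesis by (simp only: lborel_distr_plus)
  qed
  have "integrable lborel f \<longleftrightarrow> integrable (distr lborel borel (\<lambda>x. x - c)) f" by (simp only: d)
  also have "\<dots> \<longleftrightarrow> integrable lborel (\<lambda>x. f (x - c))" by (subst integrable_distr_eq) auto
  finally show "integrable lborel (\<lambda>x. f (x - c)) \<longleftrightarrow> integrable lborel f" by simp
  have "(LINT x|lborel. f x) = (LINT x|distr lborel borel (\<lambda>x. x - c). f x)" by (simp only: d)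
  also have "\<dots> = (LINT x|lborel. f (x - c))" by (subst integral_distr) auto
  finally show "(LINT x|lborel. f (x - c)) = (LINT x|lborel. f x)" by simp
qed

lemma partial_deriv_outside_support:
  assumes "closed K" "\<And>x. x \<notin> K \<Longrightarrow> f x = 0" "x \<notin> K"
  shows "partial_deriv i f x = 0"
proof -
  have "((\<lambda>_. 0) has_derivative (\<lambda>_. 0)) (at x)" by simp
  then have "(f has_derivative (\<lambda>_. 0)) (at x)"
    by (rule has_derivative_transform_within_open[where s = "- K"]) (use assms in auto)
  then show ?thesis by (simp add: partial_deriv_eq)
qed

text \<open>
  The integral of a translate of \<open>h\<close> does not depend on the translation; differentiate it under the
  integral sign.
\<close>

lemma integral_partial_deriv_eq_0:
  fixes h :: "real^2 \<Rightarrow> complex"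
  assumes diff: "\<And>x. h differentiable (at x)"
    and cont: "continuous_on UNIV (partial_deriv i h)"
    and K: "compact K" "\<And>x. x \<notin> K \<Longrightarrow> h x = 0"
  shows "(LINT x|lborel. partial_deriv i h x) = 0"
proof -
  let ?e = "axis i 1 :: real^2"
  have ch: "continuous_on UNIV h" using diff by (rule continuous_on_differentiable)
  have hm: "h \<in> borel_measurable borel" using ch by (rule borel_measurable_continuous_onI)
  obtain R where R: "\<And>x. x \<in> K \<Longrightarrow> norm x \<le> R"
    using compact_imp_bounded[OF K(1)] by (auto simp: bounded_iff)
  obtain b :: "real^2" where b: "cball 0 (R + 1) \<subseteq> cbox (- b) b"
    using bounded_subset_cbox_symmetric[of "cball 0 (R + 1)"] by auto
  have out: "h (x + \<epsilon> *\<^sub>R ?e) = 0" if "x \<notin> cbox (- b) b" "\<bar>\<epsilon>\<bar> \<le> 1" for x \<epsilon>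
  proof -
    have "R + 1 < norm x" using that b by (force simp: subset_iff)
    moreover have "norm x \<le> norm (x + \<epsilon> *\<^sub>R ?e) + \<bar>\<epsilon>\<bar>"
      using norm_triangle_ineq4[of "x + \<epsilon> *\<^sub>R ?e" "\<epsilon> *\<^sub>R ?e"] by (simp add: norm_axis_1)
    ultimately show ?thesis using that(2) R[of "x + \<epsilon> *\<^sub>R ?e"] K(2) by fastforce
  qed
  have ch': "continuous_on UNIV (\<lambda>x. h (x + \<epsilon> *\<^sub>R ?e))" for \<epsilon>
    by (rule continuous_on_compose2[OF ch]) (auto intro!: continuous_intros)
  have const: "integral (cbox (- b) b) (\<lambda>x. h (x + \<epsilon> *\<^sub>R ?e)) = (LINT x|lborel. h x)" if "\<bar>\<epsilon>\<bar> \<le> 1" for \<epsilon>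
  proof -
    have "integrable lborel (\<lambda>x. h (x + \<epsilon> *\<^sub>R ?e))"
      by (rule integrable_compact_support[OF ch' compact_cbox[of "- b" b]]) (use out that in auto)
    from lborel_integral_eq_cbox[OF this, of "- b" b] out that
    have "(LINT x|lborel. h (x + \<epsilon> *\<^sub>R ?e)) = integral (cbox (- b) b) (\<lambda>x. h (x + \<epsilon> *\<^sub>R ?e))" by auto
    then show ?thesis using lborel_translation(2)[OF hm, of "- (\<epsilon> *\<^sub>R ?e)"] by simp
  qed
  have "((\<lambda>\<epsilon>. integral (cbox (- b) b) (\<lambda>x. h (x + \<epsilon> *\<^sub>R ?e))) has_vector_derivative
      integral (cbox (- b) b) (\<lambda>x. partial_deriv i h (x + 0 *\<^sub>R ?e))) (at 0 within UNIV)"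
  proof (rule leibniz_rule_vector_derivative)
    fix \<epsilon> :: real and x :: "real^2"
    have "((\<lambda>\<epsilon>. x + \<epsilon> *\<^sub>R ?e) has_derivative (\<lambda>r. r *\<^sub>R ?e)) (at \<epsilon>)"
      by (auto intro!: derivative_eq_intros)
    moreover have Dh: "(h has_derivative frechet_derivative h (at (x + \<epsilon> *\<^sub>R ?e))) (at (x + \<epsilon> *\<^sub>R ?e))"
      using diff by (simp add: frechet_derivative_works)
    ultimately have "((\<lambda>\<epsilon>. h (x + \<epsilon> *\<^sub>R ?e)) has_derivative
        (\<lambda>r. frechet_derivative h (at (x + \<epsilon> *\<^sub>R ?e)) (r *\<^sub>R ?e))) (at \<epsilon>)"
      by (rule has_derivative_compose)
    moreover have "frechet_derivative h (at (x + \<epsilon> *\<^sub>R ?e)) (r *\<^sub>R ?e) = r *\<^sub>R partial_deriv i h (x + \<epsilon> *\<^sub>R ?e)" for r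
      unfolding partial_deriv_def
      using has_derivative_bounded_linear[OF Dh] by (simp add: linear_simps)
    ultimately show "((\<lambda>\<epsilon>. h (x + \<epsilon> *\<^sub>R ?e)) has_vector_derivative partial_deriv i h (x + \<epsilon> *\<^sub>R ?e)) (at \<epsilon> within UNIV)"
      unfolding has_vector_derivative_def by simp
  next
    show "(\<lambda>x. h (x + \<epsilon> *\<^sub>R ?e)) integrable_on cbox (- b) b" for \<epsilon>
      by (rule integrable_continuous[OF continuous_on_subset[OF ch' subset_UNIV]])
    show "continuous_on (UNIV \<times> cbox (- b) b) (\<lambda>(\<epsilon>, x). partial_deriv i h (x + \<epsilon> *\<^sub>R ?e))"
      unfolding case_prod_beta
      by (rule continuous_on_compose2[OF cont]) (auto intro!: continuous_intros)
  qed auto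
  moreover have "((\<lambda>\<epsilon>. integral (cbox (- b) b) (\<lambda>x. h (x + \<epsilon> *\<^sub>R ?e))) has_vector_derivative 0) (at 0 within UNIV)"
  proof -
    have "((\<lambda>\<epsilon>::real. (LINT x|lborel. h x)) has_vector_derivative 0) (at 0)" by simp
    then show ?thesis
      by (rule has_vector_derivative_transform_within_open[where S = "{-1<..<1}"]) (use const in auto)
  qed
  ultimately have z: "integral (cbox (- b) b) (partial_deriv i h) = 0"
    using vector_derivative_unique_at by fastforce
  have outp: "partial_deriv i h x = 0" if "x \<notin> K" for x
    using partial_deriv_outside_support[OF compact_imp_closed[OF K(1)] K(2) that] .
  have Kb: "K \<subseteq> cbox (- b) b" using b R by (force simp: subset_iff)
  have "integrable lborel (partial_deriv i h)"
    by (rule integrable_compact_support[OF cont K(1) outp])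
  from lborel_integral_eq_cbox[OF this, of "- b" b] outp Kb z show ?thesis by auto
qed

lemma has_derivative_mult_partial:
  fixes f g :: "real^2 \<Rightarrow> complex"
  assumes "f differentiable (at x)" "g differentiable (at x)"
  shows "(\<lambda>x. f x * g x) differentiable (at x)"
    "partial_deriv i (\<lambda>x. f x * g x) x = partial_deriv i f x * g x + f x * partial_deriv i g x"
proof -
  have "((\<lambda>x. f x * g x) has_derivative
     (\<lambda>h. f x * frechet_derivative g (at x) h + frechet_derivative f (at x) h * g x)) (at x)"
    using assms by (intro has_derivative_mult) (simp_all add: frechet_derivative_works)
  then show "(\<lambda>x. f x * g x) differentiable (at x)"
    "partial_deriv i (\<lambda>x. f x * g x) x = partial_deriv i f x * g x + f x * partial_deriv i g x"
    by (auto simp: partial_deriv_eq differentiableI) (simp add: partial_deriv_def add.commute)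
qed

lemma partial_deriv_diff:
  fixes f g :: "real^2 \<Rightarrow> complex"
  assumes "f differentiable (at x)" "g differentiable (at x)"
  shows "partial_deriv i (\<lambda>x. f x - g x) x = partial_deriv i f x - partial_deriv i g x"
proof -
  have "((\<lambda>x. f x - g x) has_derivative
     (\<lambda>h. frechet_derivative f (at x) h - frechet_derivative g (at x) h)) (at x)"
    using assms by (intro has_derivative_diff) (simp_all add: frechet_derivative_works)
  from partial_deriv_eq[OF this] show ?thesis by (simp add: partial_deriv_def)
qed

lemma twice_differentiable_continuous:
  assumes "twice_differentiable f"
  shows "continuous_on UNIV f" "continuous_on UNIV (partial_deriv i f)"
    "continuous_on UNIV (partial_deriv j (partial_deriv i f))" "continuous_on UNIV (laplacian f)"
proof -
  show 1: "continuous_on UNIV f" "continuous_on UNIV (partial_deriv i f)"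
    "continuous_on UNIV (partial_deriv j (partial_deriv i f))"
    using assms unfolding twice_differentiable_def by (auto intro: continuous_on_differentiable)
  show "continuous_on UNIV (laplacian f)"
    using assms unfolding laplacian_def twice_differentiable_def by (intro continuous_intros) auto
qed

lemma test_function_support:
  assumes "test_function \<phi>"
  obtains K where "compact K" "\<And>x. x \<notin> K \<Longrightarrow> \<phi> x = 0" "\<And>i x. x \<notin> K \<Longrightarrow> partial_deriv i \<phi> x = 0"
    "\<And>i j x. x \<notin> K \<Longrightarrow> partial_deriv j (partial_deriv i \<phi>) x = 0"
proof -
  define K where "K = closure {x. \<phi> x \<noteq> 0}"
  have K: "compact K" "\<And>x. x \<notin> K \<Longrightarrow> \<phi> x = 0"
    using assms unfolding test_function_def K_def by (auto intro: closure_subset[THEN subsetD])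
  note p = partial_deriv_outside_support[OF compact_imp_closed[OF K(1)]]
  show thesis by (rule that[OF K p[OF K(2)] p[OF p[OF K(2)]]])
qed

text \<open>
  The difference of the integrands is the divergence of a compactly supported field.
\<close>

lemma Green_second_identity:
  assumes f: "twice_differentiable f" and \<phi>: "test_function \<phi>"
  shows "(LINT x|lborel. laplacian f x * \<phi> x) = (LINT x|lborel. f x * laplacian \<phi> x)"
proof -
  obtain K where K: "compact K" "\<And>x. x \<notin> K \<Longrightarrow> \<phi> x = 0" and pK: "\<And>i x. x \<notin> K \<Longrightarrow> partial_deriv i \<phi> x = 0"
    and ppK: "\<And>i j x. x \<notin> K \<Longrightarrow> partial_deriv j (partial_deriv i \<phi>) x = 0"
    by (rule test_function_support[OF \<phi>]) blast
  have p: "twice_differentiable \<phi>" using \<phi> by (simp add: test_function_iff)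
  note d = f[unfolded twice_differentiable_def] p[unfolded twice_differentiable_def]
  note c = twice_differentiable_continuous[OF f] twice_differentiable_continuous[OF p]
  define h where "h i x = partial_deriv i f x * \<phi> x - f x * partial_deriv i \<phi> x" for i x
  define d2 where "d2 i x = partial_deriv i (partial_deriv i f) x * \<phi> x - f x * partial_deriv i (partial_deriv i \<phi>) x" for i x
  have hd: "h i differentiable (at x)" for i x
    unfolding h_def using d by (intro differentiable_diff has_derivative_mult_partial) auto
  have hp: "partial_deriv i (h i) = d2 i" for i
  proof
    fix x
    have "partial_deriv i (\<lambda>x. partial_deriv i f x * \<phi> x - f x * partial_deriv i \<phi> x) x = d2 i x"
      using d by (subst partial_deriv_diff) (auto simp: has_derivative_mult_partial d2_def)
    then show "partial_deriv i (h i) x = d2 i x" unfolding h_def .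
  qed
  have cd2: "continuous_on UNIV (d2 i)" for i
    unfolding d2_def by (intro continuous_intros c)
  have "(LINT x|lborel. partial_deriv i (h i) x) = 0" for i
    by (rule integral_partial_deriv_eq_0[OF hd _ K(1)]) (auto simp: hp cd2 h_def K(2) pK)
  then have z: "(LINT x|lborel. d2 i x) = 0" for i by (simp add: hp)
  have i2: "integrable lborel (d2 i)" for i
    by (rule integrable_compact_support[OF cd2 K(1)]) (simp add: d2_def K(2) ppK)
  have "(LINT x|lborel. (\<Sum>i\<in>UNIV. d2 i x)) = 0"
    by (subst Bochner_Integration.integral_sum) (auto simp: i2 z)
  moreover have "(\<Sum>i\<in>UNIV. d2 i x) = laplacian f x * \<phi> x - f x * laplacian \<phi> x" for x
    unfolding d2_def laplacian_def sum_subtractf sum_distrib_left sum_distrib_right ..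
  moreover have "integrable lborel (\<lambda>x. laplacian f x * \<phi> x)"
    by (rule integrable_compact_support[OF _ K(1)]) (auto intro!: continuous_intros c simp: K(2))
  moreover have "integrable lborel (\<lambda>x. f x * laplacian \<phi> x)"
    by (rule integrable_compact_support[OF _ K(1)]) (auto intro!: continuous_intros c simp: laplacian_def ppK)
  ultimately show ?thesis by simp
qed

lemma test_function_Lp:
  assumes "test_function \<phi>" "0 < p"
  shows "\<phi> \<in> Lp p" "laplacian \<phi> \<in> Lp p"
proof -
  obtain K where K: "compact K" "\<And>x. x \<notin> K \<Longrightarrow> \<phi> x = 0"
    and ppK: "\<And>i j x. x \<notin> K \<Longrightarrow> partial_deriv j (partial_deriv i \<phi>) x = 0"
    by (rule test_function_support[OF assms(1)]) blast
  have t: "twice_differentiable \<phi>" using assms by (simp add: test_function_iff)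
  show "\<phi> \<in> Lp p"
    by (rule Lp_compact_support[OF twice_differentiable_continuous(1)[OF t] K assms(2)])
  show "laplacian \<phi> \<in> Lp p"
    by (rule Lp_compact_support[OF twice_differentiable_continuous(4)[OF t] K(1) _ assms(2)])
       (simp add: laplacian_def ppK)
qed

section \<open>Orthogonality and weak equation of the evolved modes\<close>

text \<open>
  With \<open>c = 2 \<pi> / |\<zeta>|\<^sup>2\<close> this evaluates products of two evolved modes, with twice that value products of
  four.
\<close>

lemma radial_exp_poly:
  assumes c: "0 < c"
  shows "integrable lborel (\<lambda>x::real^2. poly p (c * (norm x)\<^sup>2) * exp (- (c * (norm x)\<^sup>2)))"
    "(LINT x|lborel. poly p (c * (norm (x::real^2))\<^sup>2) * exp (- (c * (norm x)\<^sup>2))) = pi / c * expint p"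
proof -
  define F where "F s = poly p (c * s) * exp (- (c * s))" for s :: real
  define g where "g s = indicator {0<..} s * (poly p s * exp (- s))" for s :: real
  have ind: "indicator {0<..} s *\<^sub>R F s = g (0 + c * s)" for s
    using c by (auto simp: F_def g_def indicator_def zero_less_mult_iff)
  have gi: "integrable lborel g" and gI: "(LINT s|lborel. g s) = expint p"
    using has_bochner_integral_exp_poly[of p] unfolding g_def
    by (auto simp: has_bochner_integral_iff expint_eq_moment moment_def)
  have [measurable]: "F \<in> borel_measurable borel"
    unfolding F_def by (intro borel_measurable_continuous_onI continuous_intros)
  have "set_integrable lborel {0<..} F"
    unfolding set_integrable_def ind using gi c by (intro lborel_integrable_real_affine) auto
  then show "integrable lborel (\<lambda>x::real^2. poly p (c * (norm x)\<^sup>2) * exp (- (c * (norm x)\<^sup>2)))"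
    using radial_integral(1)[of F] by (simp add: F_def)
  have "(LINT s|lborel. g s) = c * (LINT s|lborel. g (0 + c * s))"
    using c lborel_integral_real_affine[of c g 0] by simp
  then have "(LINT s:{0<..}|lborel. F s) = expint p / c"
    unfolding set_lebesgue_integral_def ind gI using c by simp
  then show "(LINT x|lborel. poly p (c * (norm (x::real^2))\<^sup>2) * exp (- (c * (norm x)\<^sup>2))) = pi / c * expint p"
    using radial_integral(2)[of F] by (simp add: F_def)
qed

definition zeta :: "real \<Rightarrow> complex" where
  "zeta t = Complex 1 (4 * pi * t)"

text \<open>
  The square of the modulus of \<open>zeta t\<close>.
\<close>

definition zeta_sq :: "real \<Rightarrow> real" where
  "zeta_sq t = 1 + (4 * pi * t)\<^sup>2"

definition phase :: "real \<Rightarrow> complex" where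
  "phase t = cnj (zeta t) / zeta t"

text \<open>
  The function \<open>e\<^bsup>it\<Delta>\<^esup> Psi n\<close>.
\<close>

definition psi :: "nat \<Rightarrow> real \<Rightarrow> real^2 \<Rightarrow> complex" where
  "psi n t x = mode n (zeta t) (of_real ((norm x)\<^sup>2))"

lemma zeta_nonzero [simp]: "zeta t \<noteq> 0" "zeta t \<noteq> 2"
  by (auto simp: zeta_def complex_eq_iff)

lemma two_minus_zeta: "2 - zeta t = cnj (zeta t)"
  by (simp add: zeta_def complex_eq_iff)

lemma zeta_mult_cnj: "zeta t * cnj (zeta t) = of_real (zeta_sq t)"
  by (simp add: zeta_def zeta_sq_def complex_eq_iff power2_eq_square)

lemma zeta_sq_ge_1: "1 \<le> zeta_sq t" and zeta_sq_pos [simp]: "0 < zeta_sq t" and zeta_sq_nonzero [simp]: "zeta_sq t \<noteq> 0"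
  and zeta_sq_nonneg [simp]: "0 \<le> zeta_sq t"
proof -
  show 1: "1 \<le> zeta_sq t" unfolding zeta_sq_def by simp
  then show "0 < zeta_sq t" "zeta_sq t \<noteq> 0" "0 \<le> zeta_sq t" by linarith+
qed

lemma norm_phase: "norm (phase t) = 1"
  by (simp add: phase_def norm_divide)

lemma phase_mult_cnj: "phase t * cnj (phase t) = 1"
  using complex_norm_square[of "phase t"] by (simp add: norm_phase)

lemma psi_eq:
  "psi n t x = phase t ^ n / zeta t * of_real (poly (Lag n) (2 * pi / zeta_sq t * (norm x)\<^sup>2))
     * exp (- (of_real (pi * (norm x)\<^sup>2) / zeta t))"
proof -
  have h1: "2 * cpi * of_real ((norm x)\<^sup>2) / (zeta t * (2 - zeta t)) = of_real (2 * pi / zeta_sq t * (norm x)\<^sup>2)"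
    unfolding two_minus_zeta zeta_mult_cnj by simp
  have h2: "(2 - zeta t) ^ n / zeta t ^ Suc n = phase t ^ n / zeta t"
    unfolding two_minus_zeta phase_def by (simp add: power_divide)
  show ?thesis
    unfolding psi_def mode_def h1 h2 poly_LagC_of_real by simp
qed

lemma psi_0: "psi n 0 x = Psi n x"
proof -
  have z: "zeta 0 = 1" "zeta_sq 0 = 1"
    by (simp_all add: zeta_def zeta_sq_def complex_eq_iff)
  then have "phase 0 = 1" by (simp add: phase_def)
  with z show ?thesis
    unfolding psi_eq Psi_def laguerre_eq by (simp add: exp_of_real[symmetric])
qed

lemma gaussian_mult_cnj:
  "exp (- (of_real (pi * s) / zeta t)) * cnj (exp (- (of_real (pi * s) / zeta t)))
     = of_real (exp (- (2 * pi / zeta_sq t * s)))"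
proof -
  have "1 / zeta t + 1 / cnj (zeta t) = of_real (2 / zeta_sq t)"
  proof -
    have "1 / zeta t + 1 / cnj (zeta t) = (zeta t + cnj (zeta t)) / (zeta t * cnj (zeta t))"
      by (simp add: add_divide_distrib add.commute)
    also have "zeta t + cnj (zeta t) = 2" by (simp add: zeta_def complex_eq_iff)
    finally show ?thesis unfolding zeta_mult_cnj by simp
  qed
  then have "of_real (pi * s) * (1 / zeta t + 1 / cnj (zeta t)) = of_real (2 * pi / zeta_sq t * s)"
    by simp
  then have "of_real (pi * s) / zeta t + of_real (pi * s) / cnj (zeta t) = of_real (2 * pi / zeta_sq t * s)"
    by (simp only: distrib_left times_divide_eq_right mult_1_right)
  then have "- (of_real (pi * s) / zeta t) + - (of_real (pi * s) / cnj (zeta t)) = of_real (- (2 * pi / zeta_sq t * s))"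
    by (simp only: minus_add_distrib[symmetric] of_real_minus)
  then show ?thesis
    by (simp add: exp_cnj exp_add[symmetric] exp_of_real[symmetric])
qed

lemma psi_mult_cnj:
  "psi m t x * cnj (psi n t x) = phase t ^ m * cnj (phase t) ^ n *
     of_real (1 / zeta_sq t * (poly (Lag m * Lag n) (2 * pi / zeta_sq t * (norm x)\<^sup>2)
        * exp (- (2 * pi / zeta_sq t * (norm x)\<^sup>2))))"
proof -
  let ?E = "exp (- (of_real (pi * (norm x)\<^sup>2) / zeta t))"
  have "psi m t x * cnj (psi n t x) = phase t ^ m * cnj (phase t) ^ n / (zeta t * cnj (zeta t))
      * (of_real (poly (Lag m) (2 * pi / zeta_sq t * (norm x)\<^sup>2)) * of_real (poly (Lag n) (2 * pi / zeta_sq t * (norm x)\<^sup>2)))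
      * (?E * cnj ?E)"
    unfolding psi_eq by (simp only: complex_cnj_mult complex_cnj_divide complex_cnj_power complex_cnj_complex_of_real
        times_divide_eq_left times_divide_eq_right times_divide_times_eq divide_divide_eq_left mult_ac)
  then show ?thesis
    unfolding zeta_mult_cnj gaussian_mult_cnj by simp
qed

lemma norm_psi_sq:
  "(norm (psi n t x))\<^sup>2 = 1 / zeta_sq t * (poly (Lag n * Lag n) (2 * pi / zeta_sq t * (norm x)\<^sup>2)
        * exp (- (2 * pi / zeta_sq t * (norm x)\<^sup>2)))"
proof -
  have "complex_of_real ((norm (psi n t x))\<^sup>2) = (phase t * cnj (phase t)) ^ n *
     of_real (1 / zeta_sq t * (poly (Lag n * Lag n) (2 * pi / zeta_sq t * (norm x)\<^sup>2)
        * exp (- (2 * pi / zeta_sq t * (norm x)\<^sup>2))))"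
    unfolding complex_norm_square psi_mult_cnj power_mult_distrib ..
  then show ?thesis unfolding phase_mult_cnj power_one mult_1_left by (simp only: of_real_eq_iff)
qed

text \<open>
  Each mode carries the phase to the power of its index, which has modulus one, and otherwise only
  the rescaling of space changes with time.
\<close>

lemma psi_orthogonal:
  "integrable lborel (\<lambda>x. psi m t x * cnj (psi n t x))"
  "(LINT x|lborel. psi m t x * cnj (psi n t x)) = (if m = n then 1 / 2 else 0)"
proof -
  let ?c = "2 * pi / zeta_sq t"
  have c: "0 < ?c" by simp
  note I = radial_exp_poly[OF c, of "Lag m * Lag n"]
  show "integrable lborel (\<lambda>x. psi m t x * cnj (psi n t x))"
    unfolding psi_mult_cnj by (intro integrable_mult_right integrable_of_real I(1))
  have "(LINT x|lborel. psi m t x * cnj (psi n t x))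
      = phase t ^ m * cnj (phase t) ^ n * of_real (1 / zeta_sq t * (pi / ?c * expint (Lag m * Lag n)))"
    unfolding psi_mult_cnj I(2)[symmetric] by (simp only: integral_mult_right_zero integral_complex_of_real)
  also have "\<dots> = (if m = n then 1 / 2 else 0)"
    unfolding expint_Lag_Lag by (auto simp: power_mult_distrib[symmetric] phase_mult_cnj)
  finally show "(LINT x|lborel. psi m t x * cnj (psi n t x)) = (if m = n then 1 / 2 else 0)" .
qed

lemma continuous_on_mode [continuous_intros]:
  fixes f g :: "'a::topological_space \<Rightarrow> complex"
  assumes "continuous_on S f" "continuous_on S g" "\<And>p. p \<in> S \<Longrightarrow> f p \<noteq> 0 \<and> f p \<noteq> 2"
  shows "continuous_on S (\<lambda>p. mode n (f p) (g p))" "continuous_on S (\<lambda>p. mode_z n (f p) (g p))"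
    "continuous_on S (\<lambda>p. mode_zz n (f p) (g p))"
  unfolding mode_def mode_z_def mode_zz_def
  using assms(3) by (auto intro!: continuous_intros assms(1,2))

lemma continuous_on_zeta [continuous_intros]:
  "continuous_on S f \<Longrightarrow> continuous_on S (\<lambda>p. zeta (f p))"
  unfolding zeta_def Complex_eq by (intro continuous_intros)

lemma continuous_on_psi:
  assumes "continuous_on S f" "continuous_on S g"
  shows "continuous_on S (\<lambda>p. psi n (f p) (g p))"
  unfolding psi_def by (intro continuous_intros assms) auto

lemma psi_measurable [measurable]: "psi n t \<in> borel_measurable borel"
  by (intro borel_measurable_continuous_onI continuous_on_psi continuous_intros)

lemma psi_Lp2: "psi n t \<in> Lp 2"
  using radial_exp_poly(1)[of "2 * pi / zeta_sq t" "Lag n * Lag n"]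
  by (simp add: Lp_def norm_psi_sq)

lemma psi_sum_norm:
  assumes "finite A"
  shows "(Lp_norm 2 (\<lambda>x. \<Sum>n\<in>A. \<alpha> n * psi n t x))\<^sup>2 = (\<Sum>n\<in>A. (norm (\<alpha> n))\<^sup>2) / 2"
proof -
  have pt: "complex_of_real ((norm (\<Sum>n\<in>A. \<alpha> n * psi n t x))\<^sup>2)
      = (\<Sum>m\<in>A. \<Sum>n\<in>A. \<alpha> m * cnj (\<alpha> n) * (psi m t x * cnj (psi n t x)))" for x
    unfolding complex_norm_square cnj_sum sum_product
    by (intro sum.cong refl) (simp add: mult_ac)
  have "complex_of_real ((Lp_norm 2 (\<lambda>x. \<Sum>n\<in>A. \<alpha> n * psi n t x))\<^sup>2)
      = (LINT x|lborel. complex_of_real ((norm (\<Sum>n\<in>A. \<alpha> n * psi n t x))\<^sup>2))"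
    by (simp only: Lp_norm_power zero_less_numeral integral_complex_of_real)
  also have "\<dots> = (\<Sum>m\<in>A. \<Sum>n\<in>A. \<alpha> m * cnj (\<alpha> n) * (if m = n then 1 / 2 else 0))"
    unfolding pt by (simp add: Bochner_Integration.integral_sum psi_orthogonal)
  also have "\<dots> = (\<Sum>m\<in>A. complex_of_real ((norm (\<alpha> m))\<^sup>2) / 2)"
    unfolding complex_norm_square using assms
    by (intro sum.cong refl) (simp add: if_distrib[of "\<lambda>x. _ * x"] cong: if_cong)
  also have "\<dots> = complex_of_real ((\<Sum>n\<in>A. (norm (\<alpha> n))\<^sup>2) / 2)"
    by (simp add: sum_divide_distrib)
  finally show ?thesis by (simp only: of_real_eq_iff)
qed

lemma psi_calculus:
  "twice_differentiable (psi n t)"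
  "((\<lambda>t. psi n t x) has_vector_derivative \<i> * laplacian (psi n t) x) (at t)"
  "continuous_on UNIV (\<lambda>(t, x). laplacian (psi n t) x)"
proof -
  have d1: "((\<lambda>s. mode n (zeta t) (of_real s)) has_vector_derivative mode_z n (zeta t) (of_real s)) (at s)" for s t
    using has_vector_derivative_real_field[OF mode_z_derivative] .
  have d2: "((\<lambda>s. mode_z n (zeta t) (of_real s)) has_vector_derivative mode_zz n (zeta t) (of_real s)) (at s)" for s t
    using has_vector_derivative_real_field[OF mode_zz_derivative] .
  have c2: "continuous_on UNIV (\<lambda>s. mode_zz n (zeta t) (of_real s))" for t
    by (intro continuous_intros) auto
  have p: "psi n t = (\<lambda>x. mode n (zeta t) (of_real ((norm (x - 0))\<^sup>2)))" for t
    by (rule ext) (simp add: psi_def)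
  note R = radial_calculus[OF d1 d2 c2, where y = 0, folded p]
  show "twice_differentiable (psi n t)" by (rule R(1))
  have lap: "laplacian (psi n t) x = 4 * (of_real ((norm x)\<^sup>2) * mode_zz n (zeta t) (of_real ((norm x)\<^sup>2))
      + mode_z n (zeta t) (of_real ((norm x)\<^sup>2)))" for t x
    unfolding R(2) by simp
  show "continuous_on UNIV (\<lambda>(t, x). laplacian (psi n t) x)"
    unfolding lap case_prod_beta by (intro continuous_intros) auto
  have dz: "((\<lambda>\<tau>. 1 + 4 * cpi * \<i> * \<tau>) has_field_derivative 4 * cpi * \<i>) (at \<tau>)" for \<tau>
    by (auto intro!: derivative_eq_intros)
  have z: "zeta t = 1 + 4 * cpi * \<i> * of_real t" for t
    by (simp add: zeta_def complex_eq_iff)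
  have "((\<lambda>t. psi n t x) has_vector_derivative
     (of_real ((norm x)\<^sup>2) * mode_zz n (zeta t) (of_real ((norm x)\<^sup>2)) + mode_z n (zeta t) (of_real ((norm x)\<^sup>2))) / cpi * (4 * cpi * \<i>)) (at t)"
    unfolding psi_def z
    by (rule has_vector_derivative_real_field[OF DERIV_chain2[OF mode_zeta_derivative dz]])
       (simp_all only: z[symmetric] zeta_nonzero not_False_eq_True)
  then show "((\<lambda>t. psi n t x) has_vector_derivative \<i> * laplacian (psi n t) x) (at t)"
    unfolding lap by (rule has_vector_derivative_eq_rhs) simp
qed

text \<open>
  Differentiate under the integral, which extends over a compact set, and shift the Laplacian to the
  test function.
\<close>

lemma psi_weak_solution:
  assumes \<phi>: "test_function \<phi>"
  shows "((\<lambda>t. LINT x|lborel. psi n t x * \<phi> x) has_vector_derivative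
     \<i> * (LINT x|lborel. psi n t x * laplacian \<phi> x)) (at t)"
proof -
  obtain K where K: "compact K" "\<And>x. x \<notin> K \<Longrightarrow> \<phi> x = 0"
    by (rule test_function_support[OF \<phi>]) blast
  obtain b :: "real^2" where b: "K \<subseteq> cbox (- b) b"
    using bounded_subset_cbox_symmetric[OF compact_imp_bounded[OF K(1)]] by auto
  have cp: "continuous_on UNIV \<phi>"
    using \<phi> twice_differentiable_continuous(1) by (simp add: test_function_iff)
  have cpsi: "continuous_on UNIV (psi n t)" for t
    by (intro continuous_on_psi continuous_intros)
  have clap: "continuous_on UNIV (laplacian (psi n t))" for t
    by (rule twice_differentiable_continuous(4)[OF psi_calculus(1)])
  have clap2: "continuous_on UNIV (\<lambda>p. laplacian (psi n (fst p)) (snd p))"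
    using psi_calculus(3)[of n] by (simp add: case_prod_beta)
  have e1: "(LINT x|lborel. psi n t x * \<phi> x) = integral (cbox (- b) b) (\<lambda>x. psi n t x * \<phi> x)" for t
    using b K by (intro lborel_integral_eq_cbox integrable_compact_support[of _ K] continuous_intros cp cpsi) auto
  have e2: "(LINT x|lborel. \<i> * laplacian (psi n t) x * \<phi> x) = integral (cbox (- b) b) (\<lambda>x. \<i> * laplacian (psi n t) x * \<phi> x)" for t
    using b K by (intro lborel_integral_eq_cbox integrable_compact_support[of _ K] continuous_intros cp clap) auto
  have "((\<lambda>t. integral (cbox (- b) b) (\<lambda>x. psi n t x * \<phi> x)) has_vector_derivative
      integral (cbox (- b) b) (\<lambda>x. \<i> * laplacian (psi n t) x * \<phi> x)) (at t within UNIV)"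
  proof (rule leibniz_rule_vector_derivative)
    show "((\<lambda>t. psi n t x * \<phi> x) has_vector_derivative \<i> * laplacian (psi n t) x * \<phi> x) (at t within UNIV)" for t x
      using has_vector_derivative_mult_left[OF psi_calculus(2)] by simp
    show "(\<lambda>x. psi n t x * \<phi> x) integrable_on cbox (- b) b" for t
      by (intro integrable_continuous continuous_intros continuous_on_subset[OF cpsi] continuous_on_subset[OF cp]) auto
    show "continuous_on (UNIV \<times> cbox (- b) b) (\<lambda>(t, x). \<i> * laplacian (psi n t) x * \<phi> x)"
      unfolding case_prod_beta
      by (intro continuous_intros continuous_on_subset[OF clap2] continuous_on_compose2[OF cp]) auto
  qed auto
  then have "((\<lambda>t. LINT x|lborel. psi n t x * \<phi> x) has_vector_derivative
      (LINT x|lborel. \<i> * laplacian (psi n t) x * \<phi> x)) (at t)"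
    unfolding e1 e2 by simp
  also have "(LINT x|lborel. \<i> * laplacian (psi n t) x * \<phi> x) = \<i> * (LINT x|lborel. laplacian (psi n t) x * \<phi> x)"
    by (simp add: mult.assoc)
  also have "(LINT x|lborel. laplacian (psi n t) x * \<phi> x) = (LINT x|lborel. psi n t x * laplacian \<phi> x)"
    by (rule Green_second_identity[OF psi_calculus(1) \<phi>])
  finally show ?thesis .
qed

text \<open>
  An integrable bound that is uniform for bounded times, for dominated convergence. The argument of
  the Laguerre polynomial and the Gaussian both depend on \<open>t\<close>, so the polynomial is estimated at the
  smallest and the Gaussian at the largest value of \<open>zeta_sq\<close>.
\<close>

lemma norm_psi_sq_le:
  assumes "\<bar>t\<bar> \<le> T"
  shows "(norm (psi n t x))\<^sup>2 \<le> poly ((\<Sum>k\<le>n. monom (real (n choose k) * zeta_sq T ^ k / fact k) k)\<^sup>2) (2 * pi / zeta_sq T * (norm x)\<^sup>2)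
     * exp (- (2 * pi / zeta_sq T * (norm x)\<^sup>2))"
proof -
  define s where "s = (norm x)\<^sup>2"
  define b where "b = 2 * pi / zeta_sq t"
  define c where "c = 2 * pi / zeta_sq T"
  have s: "0 \<le> s" by (simp add: s_def)
  have "(4 * pi * t)\<^sup>2 \<le> (4 * pi * T)\<^sup>2"
    using assms by (intro abs_le_square_iff[THEN iffD1]) (simp add: abs_mult)
  then have zz: "zeta_sq t \<le> zeta_sq T" by (simp add: zeta_sq_def)
  then have cb: "c \<le> b" unfolding b_def c_def by (intro divide_left_mono) auto
  have bT: "b \<le> zeta_sq T * c" using zeta_sq_ge_1[of t] unfolding b_def c_def
    by (simp add: field_simps)
  have b0: "0 \<le> b" by (simp add: b_def)
  have "\<bar>poly (Lag n) (b * s)\<bar> \<le> (\<Sum>k\<le>n. \<bar>real (n choose k) * (- (b * s)) ^ k / fact k\<bar>)"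
    unfolding poly_Lag by (rule sum_abs)
  also have "\<dots> = (\<Sum>k\<le>n. real (n choose k) * (b * s) ^ k / fact k)"
    using b0 s by (intro sum.cong refl) (simp add: abs_mult power_abs)
  also have "\<dots> \<le> (\<Sum>k\<le>n. real (n choose k) * (zeta_sq T * c * s) ^ k / fact k)"
    using b0 s bT by (intro sum_mono divide_right_mono mult_left_mono power_mono mult_right_mono) auto
  also have "\<dots> = poly (\<Sum>k\<le>n. monom (real (n choose k) * zeta_sq T ^ k / fact k) k) (c * s)"
    by (simp add: poly_sum poly_monom power_mult_distrib mult_ac)
  finally have P: "\<bar>poly (Lag n) (b * s)\<bar> \<le> poly (\<Sum>k\<le>n. monom (real (n choose k) * zeta_sq T ^ k / fact k) k) (c * s)" .
  have "(norm (psi n t x))\<^sup>2 = 1 / zeta_sq t * ((poly (Lag n) (b * s))\<^sup>2 * exp (- (b * s)))"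
    unfolding norm_psi_sq b_def s_def by (simp add: power2_eq_square)
  also have "\<dots> \<le> 1 * ((poly (\<Sum>k\<le>n. monom (real (n choose k) * zeta_sq T ^ k / fact k) k) (c * s))\<^sup>2 * exp (- (c * s)))"
  proof (intro mult_mono)
    show "1 / zeta_sq t \<le> 1" using zeta_sq_ge_1[of t] by (simp add: field_simps)
    show "(poly (Lag n) (b * s))\<^sup>2 \<le> (poly (\<Sum>k\<le>n. monom (real (n choose k) * zeta_sq T ^ k / fact k) k) (c * s))\<^sup>2"
      using power_mono[OF P, of 2] by simp
    show "exp (- (b * s)) \<le> exp (- (c * s))" using cb s by (simp add: mult_right_mono)
  qed auto
  finally show ?thesis unfolding c_def s_def by (simp add: poly_power)
qed

lemma psi_L2_continuous:
  "((\<lambda>s. Lp_norm 2 (\<lambda>x. psi n s x - psi n t x)) \<longlongrightarrow> 0) (at t)"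
proof -
  define T where "T = \<bar>t\<bar> + 1"
  define h where "h x = poly ((\<Sum>k\<le>n. monom (real (n choose k) * zeta_sq T ^ k / fact k) k)\<^sup>2) (2 * pi / zeta_sq T * (norm x)\<^sup>2)
     * exp (- (2 * pi / zeta_sq T * (norm x)\<^sup>2))" for x :: "real^2"
  have hi: "integrable lborel (\<lambda>x. 4 * h x)"
    unfolding h_def by (intro integrable_mult_right radial_exp_poly) simp
  have bd: "(norm (psi n s x - psi n t x))\<^sup>2 \<le> 4 * h x" if "\<bar>s\<bar> \<le> T" for s x
  proof -
    have "(norm (psi n s x - psi n t x))\<^sup>2 \<le> (norm (psi n s x) + norm (psi n t x))\<^sup>2"
      by (intro power_mono norm_triangle_ineq4) auto
    also have "\<dots> \<le> 2 * (norm (psi n s x))\<^sup>2 + 2 * (norm (psi n t x))\<^sup>2"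
      using sum_squares_bound[of "norm (psi n s x)" "norm (psi n t x)"] by (simp add: power2_sum)
    also have "\<dots> \<le> 4 * h x"
      using norm_psi_sq_le[OF that, of n x] norm_psi_sq_le[of t T n x] by (simp add: h_def T_def)
    finally show ?thesis .
  qed
  show ?thesis
    unfolding tendsto_at_iff_sequentially
  proof (intro allI impI)
    fix X assume X: "\<forall>i. X i \<in> UNIV - {t}" "X \<longlonglongrightarrow> t"
    \<comment> \<open>replaces the finitely many terms at which the uniform bound is not available\<close>
    define Y where "Y i = (if \<bar>X i\<bar> \<le> T then X i else t)" for i
    have YT: "\<bar>Y i\<bar> \<le> T" for i by (simp add: Y_def T_def)
    have "eventually (\<lambda>i. dist (X i) t < 1) sequentially" using X(2) by (simp add: tendstoD)
    then have ev: "eventually (\<lambda>i. Y i = X i) sequentially"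
      by eventually_elim (auto simp: Y_def T_def dist_real_def)
    then have Y: "Y \<longlonglongrightarrow> t"
      using X(2) by (subst tendsto_cong) auto
    have "(\<lambda>i. LINT x|lborel. (norm (psi n (Y i) x - psi n t x))\<^sup>2) \<longlonglongrightarrow> (LINT x::real^2|lborel. (0::real))"
    proof (rule integral_dominated_convergence[where w = "\<lambda>x. 4 * h x"])
      show "AE x in lborel. (\<lambda>i. (norm (psi n (Y i) x - psi n t x))\<^sup>2) \<longlonglongrightarrow> 0"
      proof (intro AE_I2)
        fix x
        have "continuous_on UNIV (\<lambda>t. psi n t x)" by (intro continuous_on_psi continuous_intros)
        then have "(\<lambda>i. psi n (Y i) x) \<longlonglongrightarrow> psi n t x"
          by (rule continuous_on_tendsto_compose[OF _ Y]) auto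
        then have "(\<lambda>i. (norm (psi n (Y i) x - psi n t x))\<^sup>2) \<longlonglongrightarrow> (norm (psi n t x - psi n t x))\<^sup>2"
          by (intro tendsto_intros)
        then show "(\<lambda>i. (norm (psi n (Y i) x - psi n t x))\<^sup>2) \<longlonglongrightarrow> 0" by simp
      qed
      show "AE x in lborel. norm ((norm (psi n (Y i) x - psi n t x))\<^sup>2) \<le> 4 * h x" for i
        using bd[OF YT] by simp
    qed (use hi in measurable)
    from tendsto_real_root[OF this, of 2]
    have "(\<lambda>i. Lp_norm 2 (\<lambda>x. psi n (Y i) x - psi n t x)) \<longlonglongrightarrow> 0"
      by (simp add: Lp_norm_def)
    moreover have "eventually (\<lambda>i. Lp_norm 2 (\<lambda>x. psi n (Y i) x - psi n t x) = ((\<lambda>s. Lp_norm 2 (\<lambda>x. psi n s x - psi n t x)) \<circ> X) i) sequentially"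
      using ev by eventually_elim simp
    ultimately show "((\<lambda>s. Lp_norm 2 (\<lambda>x. psi n s x - psi n t x)) \<circ> X) \<longlonglongrightarrow> 0"
      by (rule Lim_transform_eventually)
  qed
qed

section \<open>Existence of the solution\<close>

text \<open>
  The norms of the partial sums are known from orthogonality and converge to the norm of \<open>f\<close>.
\<close>

lemma Psi_expansion_sums:
  assumes f: "f \<in> Lp 2"
    and lim: "(\<lambda>N. Lp_norm 2 (\<lambda>x. f x - (\<Sum>n<N. \<alpha> n * Psi n x))) \<longlonglongrightarrow> 0"
  shows "(\<lambda>n. (norm (\<alpha> n))\<^sup>2) sums (2 * (Lp_norm 2 f)\<^sup>2)"
proof -
  define S where "S N = (\<lambda>x. \<Sum>n<N. \<alpha> n * Psi n x)" for N
  have S: "S N = (\<lambda>x. \<Sum>n<N. \<alpha> n * psi n 0 x)" for N by (simp add: S_def psi_0)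
  have SL: "S N \<in> Lp 2" for N unfolding S by (intro Lp_sum Lp_cmult psi_Lp2) simp
  have "(\<lambda>N. Lp_norm 2 f - Lp_norm 2 (S N)) \<longlonglongrightarrow> 0"
  proof (rule Lim_null_comparison[OF always_eventually lim], intro allI)
    show "norm (Lp_norm 2 f - Lp_norm 2 (S N)) \<le> Lp_norm 2 (\<lambda>x. f x - (\<Sum>n<N. \<alpha> n * Psi n x))" for N
      using Lp_norm_diff_le[OF f SL[of N]] by (simp add: S_def)
  qed
  from tendsto_diff[OF tendsto_const[of "Lp_norm 2 f"] this]
  have "(\<lambda>N. Lp_norm 2 (S N)) \<longlonglongrightarrow> Lp_norm 2 f" by simp
  then have "(\<lambda>N. 2 * (Lp_norm 2 (S N))\<^sup>2) \<longlonglongrightarrow> 2 * (Lp_norm 2 f)\<^sup>2" by (intro tendsto_intros)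
  moreover have "2 * (Lp_norm 2 (S N))\<^sup>2 = (\<Sum>n<N. (norm (\<alpha> n))\<^sup>2)" for N
    unfolding S by (subst psi_sum_norm) auto
  ultimately show ?thesis by (simp add: sums_def)
qed

lemma has_vector_derivative_uniform_limit:
  fixes F :: "nat \<Rightarrow> real \<Rightarrow> complex"
  assumes S: "open S" "convex S" "t \<in> S"
    and der: "\<And>n s. s \<in> S \<Longrightarrow> (F n has_vector_derivative DF n s) (at s)"
    and lim: "\<And>s. s \<in> S \<Longrightarrow> (\<lambda>n. F n s) \<longlonglongrightarrow> F' s"
    and unif: "\<And>e. 0 < e \<Longrightarrow> \<forall>\<^sub>F n in sequentially. \<forall>s\<in>S. norm (DF n s - G' s) \<le> e"
  shows "(F' has_vector_derivative G' t) (at t)"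
proof -
  have "\<exists>g. \<forall>x\<in>S. (\<lambda>n. F n x) \<longlonglongrightarrow> g x \<and> (g has_derivative (\<lambda>h. h *\<^sub>R G' x)) (at x within S)"
  proof (rule has_derivative_sequence[where f' = "\<lambda>n x h. h *\<^sub>R DF n x"])
    show "(F n has_derivative (\<lambda>h. h *\<^sub>R DF n x)) (at x within S)" if "x \<in> S" for n x
      using has_vector_derivative_at_within[OF der[OF that]] unfolding has_vector_derivative_def .
    show "\<forall>\<^sub>F n in sequentially. \<forall>x\<in>S. \<forall>h. norm (h *\<^sub>R DF n x - h *\<^sub>R G' x) \<le> e * norm h" if "0 < e" for e
      using unif[OF that]
    proof eventually_elim
      case (elim n)
      show ?case
      proof (intro ballI allI)
        fix x h assume "x \<in> S"
        with elim have "\<bar>h\<bar> * norm (DF n x - G' x) \<le> \<bar>h\<bar> * e" by (intro mult_left_mono) auto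
        then show "norm (h *\<^sub>R DF n x - h *\<^sub>R G' x) \<le> e * norm h"
          by (simp add: scaleR_diff_right[symmetric] mult.commute)
      qed
    qed
  qed (use S lim in auto)
  then obtain g where g: "\<And>x. x \<in> S \<Longrightarrow> (\<lambda>n. F n x) \<longlonglongrightarrow> g x"
    "\<And>x. x \<in> S \<Longrightarrow> (g has_derivative (\<lambda>h. h *\<^sub>R G' x)) (at x within S)" by blast
  have eq: "g x = F' x" if "x \<in> S" for x using LIMSEQ_unique[OF g(1)[OF that] lim[OF that]] .
  have "(g has_vector_derivative G' t) (at t)"
    using g(2)[OF S(3)] at_within_open[OF S(3,1)] by (simp add: has_vector_derivative_def)
  then show ?thesis
    by (rule has_vector_derivative_transform_within_open[OF _ S(1,3) eq])
qed

definition wave :: "(nat \<Rightarrow> complex) \<Rightarrow> nat set \<Rightarrow> real \<Rightarrow> real^2 \<Rightarrow> complex" where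
  "wave \<alpha> A t x = (\<Sum>n\<in>A. \<alpha> n * psi n t x)"

lemma wave_Lp2: "wave \<alpha> A t \<in> Lp 2"
  unfolding wave_def by (intro Lp_sum Lp_cmult psi_Lp2) simp

lemma wave_norm: "finite A \<Longrightarrow> (Lp_norm 2 (wave \<alpha> A t))\<^sup>2 = (\<Sum>n\<in>A. (norm (\<alpha> n))\<^sup>2) / 2"
  unfolding wave_def by (rule psi_sum_norm)

lemma wave_diff: "M \<le> N \<Longrightarrow> wave \<alpha> {..<N} t x - wave \<alpha> {..<M} t x = wave \<alpha> {M..<N} t x"
  unfolding wave_def lessThan_atLeast0 by (rule sum_diff_nat_ivl) auto

lemma wave_measurable [measurable]: "(\<lambda>p. wave \<alpha> A (snd p) (fst p)) \<in> borel_measurable borel"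
  unfolding wave_def
  by (intro borel_measurable_continuous_onI continuous_intros continuous_on_psi)

lemma wave_L2_continuous:
  "((\<lambda>s. Lp_norm 2 (\<lambda>x. wave \<alpha> A s x - wave \<alpha> A t x)) \<longlongrightarrow> 0) (at t)"
proof (induction A rule: infinite_finite_induct)
  case (insert n A)
  have L: "(\<lambda>x. \<alpha> n * (psi n s x - psi n t x)) \<in> Lp 2" "(\<lambda>x. wave \<alpha> A s x - wave \<alpha> A t x) \<in> Lp 2" for s
    by (intro Lp_cmult Lp_diff psi_Lp2 wave_Lp2; simp)+
  have eq: "wave \<alpha> (insert n A) s x - wave \<alpha> (insert n A) t x
      = \<alpha> n * (psi n s x - psi n t x) + (wave \<alpha> A s x - wave \<alpha> A t x)" for s x
    using insert by (simp add: wave_def algebra_simps)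
  have lim: "((\<lambda>s. norm (\<alpha> n) * Lp_norm 2 (\<lambda>x. psi n s x - psi n t x) + Lp_norm 2 (\<lambda>x. wave \<alpha> A s x - wave \<alpha> A t x)) \<longlongrightarrow> 0) (at t)"
    using tendsto_add[OF tendsto_mult_right_zero[OF psi_L2_continuous] insert.IH] by simp
  show ?case
  proof (rule Lim_null_comparison[OF always_eventually lim], intro allI)
    fix s
    have "Lp_norm 2 (\<lambda>x. wave \<alpha> (insert n A) s x - wave \<alpha> (insert n A) t x)
       \<le> Lp_norm 2 (\<lambda>x. \<alpha> n * (psi n s x - psi n t x)) + Lp_norm 2 (\<lambda>x. wave \<alpha> A s x - wave \<alpha> A t x)"
      unfolding eq by (rule Lp_add(2)[OF L]) simp
    then show "norm (Lp_norm 2 (\<lambda>x. wave \<alpha> (insert n A) s x - wave \<alpha> (insert n A) t x))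
       \<le> norm (\<alpha> n) * Lp_norm 2 (\<lambda>x. psi n s x - psi n t x) + Lp_norm 2 (\<lambda>x. wave \<alpha> A s x - wave \<alpha> A t x)"
      by (simp add: Lp_norm_cmult)
  qed
qed (simp_all add: wave_def Lp_norm_def)

lemma wave_weak_solution:
  assumes \<phi>: "test_function \<phi>"
  shows "((\<lambda>t. LINT x|lborel. wave \<alpha> A t x * \<phi> x) has_vector_derivative
     \<i> * (LINT x|lborel. wave \<alpha> A t x * laplacian \<phi> x)) (at t)"
proof -
  note L = test_function_Lp[OF \<phi> pos2]
  have e: "(LINT x|lborel. wave \<alpha> A t x * g x) = (\<Sum>n\<in>A. \<alpha> n * (LINT x|lborel. psi n t x * g x))"
    if "g \<in> Lp 2" for g t
    unfolding wave_def sum_distrib_right mult.assoc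
    using L2_mult(1)[OF psi_Lp2 that] by (subst Bochner_Integration.integral_sum) auto
  have "((\<lambda>t. \<Sum>n\<in>A. \<alpha> n * (LINT x|lborel. psi n t x * \<phi> x)) has_vector_derivative
     (\<Sum>n\<in>A. \<alpha> n * (\<i> * (LINT x|lborel. psi n t x * laplacian \<phi> x)))) (at t)"
    by (intro has_vector_derivative_sum has_vector_derivative_mult_right psi_weak_solution \<phi>)
  moreover have "(\<Sum>n\<in>A. \<alpha> n * (\<i> * (LINT x|lborel. psi n t x * laplacian \<phi> x)))
      = \<i> * (\<Sum>n\<in>A. \<alpha> n * (LINT x|lborel. psi n t x * laplacian \<phi> x))"
    unfolding sum_distrib_left by (intro sum.cong refl mult.left_commute)
  ultimately show ?thesis by (simp only: e[OF L(1)] e[OF L(2)])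
qed

text \<open>
  Along such a subsequence the increments of the series are small enough to force convergence almost
  everywhere, not only in the mean. The subsequence depends on the coefficients only, hence it serves
  all times at once.
\<close>

lemma geometric_subsequence:
  fixes a :: "nat \<Rightarrow> real"
  assumes "summable a" and nonneg: "\<And>n. 0 \<le> a n"
  obtains r :: "nat \<Rightarrow> nat" where "mono r" "\<And>k. k \<le> r k" "\<And>k M. (\<Sum>n\<in>{r k..<M}. a n) \<le> (1 / 4) ^ k"
proof -
  have "\<exists>N. \<forall>m\<ge>N. \<forall>n. norm (sum a {m..<n}) < (1 / 4) ^ k" for k :: nat
    using assms(1) unfolding summable_Cauchy by auto
  then obtain N where N: "\<And>k m n. N k \<le> m \<Longrightarrow> norm (sum a {m..<n}) < (1 / 4) ^ k" by metis
  \<comment> \<open>summing the thresholds makes the sequence monotone, adding \<open>k\<close> makes it tend to infinity\<close>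
  define r where "r k = k + (\<Sum>j\<le>k. N j)" for k
  show thesis
  proof
    show "mono r" unfolding r_def
      by (intro monoI add_mono sum_mono2) auto
    show "k \<le> r k" for k by (simp add: r_def)
    show "(\<Sum>n\<in>{r k..<M}. a n) \<le> (1 / 4) ^ k" for k M
    proof -
      have "N k \<le> (\<Sum>j\<le>k. N j)" by (rule member_le_sum) auto
      then have "N k \<le> r k" by (simp add: r_def)
      from N[OF this, of M] show ?thesis by simp
    qed
  qed
qed

text \<open>
  For every single time the subsequence converges almost everywhere, by a Borel-Cantelli argument: the
  increments satisfy \<open>\<parallel>d\<^sub>k\<parallel>\<^sup>2 \<le> 4\<^sup>-\<^sup>k\<close>, so \<open>\<Sum> 2\<^sup>k |d\<^sub>k|\<^sup>2\<close> has finite integral. The pointwise limit is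
  jointly measurable in space and time because the subsequence is the same for all times.
\<close>

lemma wave_limit_exists:
  assumes s: "summable (\<lambda>n. (norm (\<alpha> n))\<^sup>2)"
  obtains u :: "(real^2) \<times> real \<Rightarrow> complex" and r :: "nat \<Rightarrow> nat"
  where "u \<in> borel_measurable borel" "\<And>k. k \<le> r k"
    "\<And>t. AE x in lborel. (\<lambda>k. wave \<alpha> {..<r k} t x) \<longlonglongrightarrow> u (x, t)"
proof -
  obtain r where r: "mono r" "\<And>k. k \<le> r k" "\<And>k M. (\<Sum>n\<in>{r k..<M}. (norm (\<alpha> n))\<^sup>2) \<le> (1 / 4) ^ k"
    by (rule geometric_subsequence[OF s]) auto
  define u where "u p = lim (\<lambda>k. wave \<alpha> {..<r k} (snd p) (fst p))" for p
  have um: "u \<in> borel_measurable borel"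
    unfolding u_def by (rule borel_measurable_lim_metric) measurable
  have ae: "AE x in lborel. (\<lambda>k. wave \<alpha> {..<r k} t x) \<longlonglongrightarrow> u (x, t)" for t
  proof -
    define d where "d k = wave \<alpha> {r k..<r (Suc k)} t" for k
    have dL: "d k \<in> Lp 2" for k unfolding d_def by (rule wave_Lp2)
    note [measurable] = LpD(1)[OF dL]
    have dn: "(LINT x|lborel. (norm (d k x))\<^sup>2) \<le> (1 / 4) ^ k" for k
    proof -
      have "(Lp_norm 2 (d k))\<^sup>2 \<le> (1 / 4) ^ k / 2"
        unfolding d_def using r(3)[of k "r (Suc k)"] by (subst wave_norm) auto
      also have "\<dots> \<le> (1 / 4) ^ k" by simp
      finally show ?thesis by (simp add: Lp_norm_power)
    qed
    have "(\<integral>\<^sup>+x. (\<Sum>k. ennreal (2 ^ k * (norm (d k x))\<^sup>2)) \<partial>lborel) = (\<Sum>k. \<integral>\<^sup>+x. ennreal (2 ^ k * (norm (d k x))\<^sup>2) \<partial>lborel)"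
      by (rule nn_integral_suminf) measurable
    also have "\<dots> \<le> (\<Sum>k. ennreal ((1 / 2) ^ k))"
    proof (intro suminf_le summableI)
      fix k
      have "(\<integral>\<^sup>+x. ennreal (2 ^ k * (norm (d k x))\<^sup>2) \<partial>lborel) = ennreal (LINT x|lborel. 2 ^ k * (norm (d k x))\<^sup>2)"
        using LpD(2)[OF dL] by (intro nn_integral_eq_integral integrable_mult_right) auto
      also have "\<dots> \<le> ennreal ((1 / 2) ^ k)"
      proof (rule ennreal_leI)
        have "(LINT x|lborel. 2 ^ k * (norm (d k x))\<^sup>2) \<le> 2 ^ k * (1 / 4) ^ k"
          using dn[of k] by simp
        then show "(LINT x|lborel. 2 ^ k * (norm (d k x))\<^sup>2) \<le> (1 / 2) ^ k"
          by (simp add: power_mult_distrib[symmetric])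
      qed
      finally show "(\<integral>\<^sup>+x. ennreal (2 ^ k * (norm (d k x))\<^sup>2) \<partial>lborel) \<le> ennreal ((1 / 2) ^ k)" .
    qed
    also have "\<dots> = ennreal (\<Sum>k. (1 / 2) ^ k)" by (rule suminf_ennreal2) (auto intro: summable_geometric)
    finally have "(\<integral>\<^sup>+x. (\<Sum>k. ennreal (2 ^ k * (norm (d k x))\<^sup>2)) \<partial>lborel) \<noteq> \<infinity>"
      by (auto simp: top_unique)
    then have "AE x in lborel. (\<Sum>k. ennreal (2 ^ k * (norm (d k x))\<^sup>2)) \<noteq> \<infinity>"
      by (intro nn_integral_PInf_AE) measurable
    then show ?thesis
    proof eventually_elim
      case (elim x)
      have "summable (\<lambda>k. 2 ^ k * (norm (d k x))\<^sup>2)"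
        using elim by (intro summable_suminf_not_top) auto
      then obtain C where C: "\<And>k. norm (2 ^ k * (norm (d k x))\<^sup>2) \<le> C"
        using summable_imp_Bseq unfolding Bseq_def by blast
      have dk: "norm (d k x) \<le> sqrt C * (1 / sqrt 2) ^ k" for k
      proof -
        have "2 ^ k * (norm (d k x))\<^sup>2 \<le> C" using C[of k] by simp
        then have "(norm (d k x))\<^sup>2 \<le> C * (1 / 2) ^ k" by (simp add: field_simps power_divide)
        then have "norm (d k x) \<le> sqrt (C * (1 / 2) ^ k)" by (rule real_le_rsqrt)
        then show ?thesis by (simp add: real_sqrt_mult real_sqrt_power real_sqrt_divide)
      qed
      have "summable (\<lambda>k. sqrt C * (1 / sqrt 2) ^ k)"
        by (intro summable_mult summable_geometric) (simp add: real_less_rsqrt)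
      then have "summable (\<lambda>k. d k x)"
        by (rule summable_comparison_test'[where N = 0]) (use dk in auto)
      then have "convergent (\<lambda>n. \<Sum>k<n. d k x)" by (simp add: summable_iff_convergent)
      moreover have "(\<Sum>k<n. d k x) = wave \<alpha> {..<r n} t x - wave \<alpha> {..<r 0} t x" for n
      proof -
        have "d k x = wave \<alpha> {..<r (Suc k)} t x - wave \<alpha> {..<r k} t x" for k
          unfolding d_def using r(1) by (simp add: wave_diff monoD)
        then show ?thesis using sum_lessThan_telescope[of "\<lambda>k. wave \<alpha> {..<r k} t x" n] by simp
      qed
      ultimately have "convergent (\<lambda>n. wave \<alpha> {..<r n} t x - wave \<alpha> {..<r 0} t x)" by simp
      then have "convergent (\<lambda>n. (wave \<alpha> {..<r n} t x - wave \<alpha> {..<r 0} t x) + wave \<alpha> {..<r 0} t x)"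
        by (intro convergent_add convergent_const)
      then have "convergent (\<lambda>n. wave \<alpha> {..<r n} t x)" by simp
      then show ?case unfolding u_def by (simp add: convergent_LIMSEQ_iff)
    qed
  qed
  show thesis by (rule that[OF um r(2) ae])
qed

text \<open>
  Fatou's lemma turns a uniform Cauchy estimate and convergence almost everywhere of a subsequence
  into an estimate for the limit. It is used with exponent \<open>2\<close> at a fixed time and with exponent \<open>4\<close> in
  space-time.
\<close>

lemma Lp_limit_of_subsequence:
  fixes F :: "nat \<Rightarrow> 'a::euclidean_space \<Rightarrow> complex"
  assumes F: "\<And>N. F N \<in> Lp p" and u: "u \<in> borel_measurable lborel" and r: "\<And>k. k \<le> r k"
    and ae: "AE x in lborel. (\<lambda>k. F (r k) x) \<longlonglongrightarrow> u x" and p: "0 < p"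
    and le: "\<And>N M. N \<le> M \<Longrightarrow> Lp_norm p (\<lambda>x. F M x - F N x) \<le> \<tau> N"
  shows "u \<in> Lp p" "(\<lambda>x. u x - F N x) \<in> Lp p" "Lp_norm p (\<lambda>x. u x - F N x) \<le> \<tau> N"
proof -
  have rk: "N \<le> r (k + N)" for k N using r[of "k + N"] by simp
  note L = Lp_diff(1)[OF F F p]
  have m: "(\<lambda>x. u x - F N x) \<in> borel_measurable lborel" for N
    using u LpD(1)[OF F[of N]] by simp
  have ae': "AE x in lborel. (\<lambda>k. F (r (k + N)) x - F N x) \<longlonglongrightarrow> u x - F N x" for N
    using ae by eventually_elim (intro tendsto_intros LIMSEQ_ignore_initial_segment)
  note Fatou = Lp_Fatou[OF L m ae' le[OF rk] p]
  show "(\<lambda>x. u x - F N x) \<in> Lp p" "Lp_norm p (\<lambda>x. u x - F N x) \<le> \<tau> N" by (fact Fatou)+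
  show "u \<in> Lp p" using Lp_add(1)[OF Fatou(1) F p, of 0 0] by simp
qed

text \<open>
  The series converges in the mean uniformly in time, so continuity and the weak equation pass to the
  limit.
\<close>

lemma wave_limit_solution:
  fixes u :: "(real^2) \<times> real \<Rightarrow> complex"
  assumes s: "summable (\<lambda>n. (norm (\<alpha> n))\<^sup>2)"
    and u[measurable]: "u \<in> borel_measurable borel" and r: "\<And>k. k \<le> r k"
    and ae: "\<And>t. AE x in lborel. (\<lambda>k. wave \<alpha> {..<r k} t x) \<longlonglongrightarrow> u (x, t)"
    and f: "f \<in> Lp 2"
    and lim: "(\<lambda>N. Lp_norm 2 (\<lambda>x. f x - (\<Sum>n<N. \<alpha> n * Psi n x))) \<longlonglongrightarrow> 0"
  shows "schrodinger_solution f u"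
proof -
  define tl where "tl N = sqrt ((\<Sum>n. (norm (\<alpha> (n + N)))\<^sup>2) / 2)" for N
  have tl0: "tl \<longlonglongrightarrow> 0"
  proof -
    have "(\<lambda>N. \<Sum>n. (norm (\<alpha> (n + N)))\<^sup>2) \<longlonglongrightarrow> 0"
      using suminf_exist_split2[OF s] by simp
    then have "(\<lambda>N. sqrt ((\<Sum>n. (norm (\<alpha> (n + N)))\<^sup>2) / 2)) \<longlonglongrightarrow> sqrt (0 / 2)" by (intro tendsto_intros) auto
    then show ?thesis by (simp add: tl_def[abs_def])
  qed
  have wtl: "Lp_norm 2 (wave \<alpha> {N..<M} t) \<le> tl N" for N M t
  proof -
    have "(\<Sum>n\<in>{N..<M}. (norm (\<alpha> n))\<^sup>2) = (\<Sum>n<M - N. (norm (\<alpha> (n + N)))\<^sup>2)"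
      by (rule sum.reindex_bij_witness[of _ "\<lambda>n. n + N" "\<lambda>n. n - N"]) auto
    also have "\<dots> \<le> (\<Sum>n. (norm (\<alpha> (n + N)))\<^sup>2)"
      using summable_ignore_initial_segment[OF s] by (intro sum_le_suminf) auto
    finally have "(Lp_norm 2 (wave \<alpha> {N..<M} t))\<^sup>2 \<le> (\<Sum>n. (norm (\<alpha> (n + N)))\<^sup>2) / 2"
      by (subst wave_norm) auto
    then show ?thesis unfolding tl_def by (rule real_le_rsqrt)
  qed
  have u_t: "(\<lambda>x. u (x, t)) \<in> borel_measurable lborel" for t by simp
  have wd: "Lp_norm 2 (\<lambda>x. wave \<alpha> {..<M} t x - wave \<alpha> {..<N} t x) \<le> tl N" if "N \<le> M" for M N t
    unfolding wave_diff[OF that] by (rule wtl)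
  note limits = Lp_limit_of_subsequence[OF wave_Lp2 u_t r ae pos2 wd]
  have uL: "(\<lambda>x. u (x, t)) \<in> Lp 2" for t by (rule limits(1))
  have uN: "(\<lambda>x. u (x, t) - wave \<alpha> {..<N} t x) \<in> Lp 2 \<and> Lp_norm 2 (\<lambda>x. u (x, t) - wave \<alpha> {..<N} t x) \<le> tl N" for t N
    by (intro conjI limits(2,3))
  have cont: "((\<lambda>s. Lp_norm 2 (\<lambda>x. u (x, s) - u (x, t))) \<longlongrightarrow> 0) (at t)" for t
  proof (rule tendstoI)
    fix e :: real assume e: "0 < e"
    obtain N where N: "tl N < e / 3"
      using order_tendstoD(2)[OF tl0, of "e / 3"] e by (auto simp: eventually_sequentially)
    have "eventually (\<lambda>s. dist (Lp_norm 2 (\<lambda>x. wave \<alpha> {..<N} s x - wave \<alpha> {..<N} t x)) 0 < e / 3) (at t)"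
      using wave_L2_continuous e by (intro tendstoD) auto
    then show "eventually (\<lambda>s. dist (Lp_norm 2 (\<lambda>x. u (x, s) - u (x, t))) 0 < e) (at t)"
    proof eventually_elim
      case (elim s)
      let ?w = "\<lambda>s x. wave \<alpha> {..<N} s x"
      have eq: "(\<lambda>x. u (x, s) - u (x, t)) = (\<lambda>x. (u (x, s) - ?w s x) + ((?w s x - ?w t x) + (?w t x - u (x, t))))"
        by auto
      have L: "(\<lambda>x. u (x, s) - ?w s x) \<in> Lp 2" "(\<lambda>x. ?w s x - ?w t x) \<in> Lp 2" "(\<lambda>x. ?w t x - u (x, t)) \<in> Lp 2"
        using uL wave_Lp2 by (auto intro!: Lp_diff)
      have "Lp_norm 2 (\<lambda>x. u (x, s) - u (x, t)) \<le> Lp_norm 2 (\<lambda>x. u (x, s) - ?w s x)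
          + Lp_norm 2 (\<lambda>x. (?w s x - ?w t x) + (?w t x - u (x, t)))"
        unfolding eq by (rule Lp_add(2)[OF L(1) Lp_add(1)[OF L(2,3)]]) auto
      also have "\<dots> \<le> Lp_norm 2 (\<lambda>x. u (x, s) - ?w s x)
          + (Lp_norm 2 (\<lambda>x. ?w s x - ?w t x) + Lp_norm 2 (\<lambda>x. ?w t x - u (x, t)))"
        by (intro add_left_mono Lp_add(2) L) auto
      also have "\<dots> < e"
        using elim uN[of s N] uN[of t N] N unfolding Lp_norm_minus_commute[of 2 "?w t"] by simp
      finally show ?case by simp
    qed
  qed
  have init: "AE x in lborel. u (x, 0) = f x"
  proof -
    have "Lp_norm 2 (\<lambda>x. u (x, 0) - f x) = 0"
    proof (rule antisym)
      have "(\<lambda>N. tl N + Lp_norm 2 (\<lambda>x. f x - (\<Sum>n<N. \<alpha> n * Psi n x))) \<longlonglongrightarrow> 0"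
        using tendsto_add[OF tl0 lim] by simp
      moreover have "Lp_norm 2 (\<lambda>x. u (x, 0) - f x) \<le> tl N + Lp_norm 2 (\<lambda>x. f x - (\<Sum>n<N. \<alpha> n * Psi n x))" for N
      proof -
        have w: "wave \<alpha> {..<N} 0 = (\<lambda>x. \<Sum>n<N. \<alpha> n * Psi n x)" by (rule ext) (simp add: wave_def psi_0)
        have eq: "(\<lambda>x. u (x, 0) - f x) = (\<lambda>x. (u (x, 0) - wave \<alpha> {..<N} 0 x) + (wave \<alpha> {..<N} 0 x - f x))" by auto
        have "Lp_norm 2 (\<lambda>x. u (x, 0) - f x) \<le> Lp_norm 2 (\<lambda>x. u (x, 0) - wave \<alpha> {..<N} 0 x) + Lp_norm 2 (\<lambda>x. wave \<alpha> {..<N} 0 x - f x)"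
          unfolding eq using uN[of 0 N] uL[of 0] by (intro Lp_add(2) Lp_diff wave_Lp2 f) auto
        then show ?thesis
          using uN[of 0 N] unfolding Lp_norm_minus_commute[of 2 "wave \<alpha> {..<N} 0"] by (simp add: w)
      qed
      ultimately show "Lp_norm 2 (\<lambda>x. u (x, 0) - f x) \<le> 0" by (intro LIMSEQ_le_const) auto
    qed simp
    from Lp_norm_eq_0_AE[OF Lp_diff(1)[OF uL f] this] show ?thesis by simp
  qed
  have weak: "((\<lambda>s. LINT x|lborel. u (x, s) * \<phi> x) has_vector_derivative
           \<i> * (LINT x|lborel. u (x, t) * laplacian \<phi> x)) (at t)" if \<phi>: "test_function \<phi>" for \<phi> t
  proof -
    note L = test_function_Lp[OF \<phi> pos2]
    have close: "norm ((LINT x|lborel. wave \<alpha> {..<N} s x * g x) - (LINT x|lborel. u (x, s) * g x)) \<le> tl N * Lp_norm 2 g"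
      if g: "g \<in> Lp 2" for g s N
    proof -
      have "(LINT x|lborel. wave \<alpha> {..<N} s x * g x) - (LINT x|lborel. u (x, s) * g x)
          = - (LINT x|lborel. (u (x, s) - wave \<alpha> {..<N} s x) * g x)"
        using L2_mult(1)[OF wave_Lp2 g] L2_mult(1)[OF uL g] by (simp add: left_diff_distrib)
      then have "norm ((LINT x|lborel. wave \<alpha> {..<N} s x * g x) - (LINT x|lborel. u (x, s) * g x))
          \<le> Lp_norm 2 (\<lambda>x. u (x, s) - wave \<alpha> {..<N} s x) * Lp_norm 2 g"
        using L2_mult(2)[OF conjunct1[OF uN[of s N]] g] by simp
      also have "\<dots> \<le> tl N * Lp_norm 2 g"
        using uN[of s N] by (intro mult_right_mono) auto
      finally show ?thesis .
    qed
    have tlg: "(\<lambda>N. tl N * Lp_norm 2 g) \<longlonglongrightarrow> 0" for g :: "real^2 \<Rightarrow> complex"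
      by (rule tendsto_mult_left_zero[OF tl0])
    show ?thesis
    proof (rule has_vector_derivative_uniform_limit[where S = UNIV and F = "\<lambda>N s. LINT x|lborel. wave \<alpha> {..<N} s x * \<phi> x"
          and DF = "\<lambda>N s. \<i> * (LINT x|lborel. wave \<alpha> {..<N} s x * laplacian \<phi> x)"])
      show "((\<lambda>s. LINT x|lborel. wave \<alpha> {..<N} s x * \<phi> x) has_vector_derivative
          \<i> * (LINT x|lborel. wave \<alpha> {..<N} s x * laplacian \<phi> x)) (at s)" for N s
        by (rule wave_weak_solution[OF \<phi>])
      show "(\<lambda>N. LINT x|lborel. wave \<alpha> {..<N} s x * \<phi> x) \<longlonglongrightarrow> (LINT x|lborel. u (x, s) * \<phi> x)" for s
        by (rule LIM_zero_cancel, rule Lim_null_comparison[OF always_eventually tlg[of \<phi>]], rule allI, rule close[OF L(1)])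
      fix e :: real assume "0 < e"
      then have "\<forall>\<^sub>F N in sequentially. tl N * Lp_norm 2 (laplacian \<phi>) < e"
        using order_tendstoD(2)[OF tlg] by blast
      then show "\<forall>\<^sub>F N in sequentially. \<forall>s\<in>UNIV.
          norm (\<i> * (LINT x|lborel. wave \<alpha> {..<N} s x * laplacian \<phi> x) - \<i> * (LINT x|lborel. u (x, s) * laplacian \<phi> x)) \<le> e"
      proof eventually_elim
        case (elim N)
        show ?case
        proof
          fix s
          have "norm (\<i> * (LINT x|lborel. wave \<alpha> {..<N} s x * laplacian \<phi> x) - \<i> * (LINT x|lborel. u (x, s) * laplacian \<phi> x))
              = norm ((LINT x|lborel. wave \<alpha> {..<N} s x * laplacian \<phi> x) - (LINT x|lborel. u (x, s) * laplacian \<phi> x))"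
            unfolding right_diff_distrib[symmetric] norm_mult by simp
          then show "norm (\<i> * (LINT x|lborel. wave \<alpha> {..<N} s x * laplacian \<phi> x) - \<i> * (LINT x|lborel. u (x, s) * laplacian \<phi> x)) \<le> e"
            using close[OF L(2), of N s] elim by simp
        qed
      qed
    qed auto
  qed
  show ?thesis
    unfolding schrodinger_solution_def using u uL cont init weak by auto
qed

section \<open>Gaussians determine a square-integrable function\<close>

definition gaussian_kernel :: "real \<Rightarrow> real^2 \<Rightarrow> real" where
  "gaussian_kernel c v = c / pi * exp (- (c * (norm v)\<^sup>2))"

lemma gaussian_kernel_measurable [measurable]: "gaussian_kernel c \<in> borel_measurable borel"
  unfolding gaussian_kernel_def by (intro borel_measurable_continuous_onI continuous_intros)

lemma gaussian_kernel_nonneg: "0 < c \<Longrightarrow> 0 \<le> gaussian_kernel c v"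
  by (simp add: gaussian_kernel_def)

lemma gaussian_kernel_integral:
  assumes "0 < c"
  shows "integrable lborel (\<lambda>y. gaussian_kernel c (y - x))" "(LINT y|lborel. gaussian_kernel c (y - x)) = 1"
proof -
  have e: "expint 1 = 1" by (simp add: expint_eq_moment moment_def)
  have "integrable lborel (gaussian_kernel c)" "(LINT y|lborel. gaussian_kernel c y) = 1"
    using radial_exp_poly[OF assms, of 1] assms unfolding gaussian_kernel_def e by simp_all
  then show "integrable lborel (\<lambda>y. gaussian_kernel c (y - x))" "(LINT y|lborel. gaussian_kernel c (y - x)) = 1"
    by (simp_all add: lborel_translation)
qed

text \<open>
  Convolution of the indicator with a Gaussian of total mass one that concentrates as \<open>c\<close> grows.
\<close>

definition mollified_indicator :: "(real^2) set \<Rightarrow> real \<Rightarrow> real^2 \<Rightarrow> real" where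
  "mollified_indicator B c x = (LINT y|lborel. indicator B y * gaussian_kernel c (y - x))"

lemma integrable_indicator_gaussian_kernel:
  assumes "0 < c" "B \<in> sets borel"
  shows "integrable lborel (\<lambda>y. indicator B y * gaussian_kernel c (y - x))"
  using integrable_mult_indicator[OF _ gaussian_kernel_integral(1)[OF assms(1), of x], of B] assms by simp

lemma mollified_indicator_bounds:
  assumes "0 < c" "B \<in> sets borel"
  shows "0 \<le> mollified_indicator B c x" "mollified_indicator B c x \<le> 1"
proof -
  show "0 \<le> mollified_indicator B c x"
    unfolding mollified_indicator_def using gaussian_kernel_nonneg[OF assms(1)] by (intro integral_nonneg_AE) auto
  have "mollified_indicator B c x \<le> (LINT y|lborel. gaussian_kernel c (y - x))"
    unfolding mollified_indicator_def using gaussian_kernel_nonneg[OF assms(1)]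
    by (intro integral_mono integrable_indicator_gaussian_kernel gaussian_kernel_integral assms) (auto simp: indicator_def)
  then show "mollified_indicator B c x \<le> 1" using gaussian_kernel_integral(2)[OF assms(1)] by simp
qed

text \<open>
  Half of the exponent is spent on the factor \<open>exp (- c d\<^sup>2 / 2)\<close>, the other half is still a Gaussian,
  of mass \<open>2\<close> after this change of the exponent.
\<close>

lemma mollified_indicator_far:
  assumes c: "0 < c" and B: "B \<in> sets borel" and d: "0 \<le> d" "\<And>y. y \<in> B \<Longrightarrow> d \<le> norm (y - x)"
  shows "mollified_indicator B c x \<le> 2 * exp (- (c * d\<^sup>2 / 2))"
proof -
  have c2: "0 < c / 2" using c by simp
  have "mollified_indicator B c x \<le> (LINT y|lborel. 2 * exp (- (c * d\<^sup>2 / 2)) * gaussian_kernel (c / 2) (y - x))"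
    unfolding mollified_indicator_def
  proof (intro integral_mono integrable_indicator_gaussian_kernel integrable_mult_right gaussian_kernel_integral c c2 B)
    fix y
    show "indicator B y * gaussian_kernel c (y - x) \<le> 2 * exp (- (c * d\<^sup>2 / 2)) * gaussian_kernel (c / 2) (y - x)"
    proof (cases "y \<in> B")
      case True
      then have "d\<^sup>2 \<le> (norm (y - x))\<^sup>2" using d by (intro power_mono) auto
      then have "c * d\<^sup>2 / 2 + c / 2 * (norm (y - x))\<^sup>2 \<le> c * (norm (y - x))\<^sup>2"
        using mult_left_mono[OF _ less_imp_le[OF c], of "d\<^sup>2" "(norm (y - x))\<^sup>2"] by simp
      then have "exp (- (c * (norm (y - x))\<^sup>2)) \<le> exp (- (c * d\<^sup>2 / 2)) * exp (- (c / 2 * (norm (y - x))\<^sup>2))"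
        by (simp add: exp_add[symmetric])
      then have "c / pi * exp (- (c * (norm (y - x))\<^sup>2)) \<le> c / pi * (exp (- (c * d\<^sup>2 / 2)) * exp (- (c / 2 * (norm (y - x))\<^sup>2)))"
        using c by (intro mult_left_mono) auto
      then show ?thesis using True by (simp add: gaussian_kernel_def mult_ac)
    next
      case False
      then show ?thesis using gaussian_kernel_nonneg[OF c2] by simp
    qed
  qed
  also have "\<dots> = 2 * exp (- (c * d\<^sup>2 / 2))" using gaussian_kernel_integral(2)[OF c2] by simp
  finally show ?thesis .
qed

lemma mollified_indicator_near:
  assumes c: "0 < c" and B: "B \<in> sets borel" and d: "0 \<le> d" "\<And>y. y \<notin> B \<Longrightarrow> d \<le> norm (y - x)"
  shows "1 - mollified_indicator B c x \<le> 2 * exp (- (c * d\<^sup>2 / 2))"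
proof -
  have "mollified_indicator B c x + mollified_indicator (- B) c x = (LINT y|lborel. indicator B y * gaussian_kernel c (y - x) + indicator (- B) y * gaussian_kernel c (y - x))"
    unfolding mollified_indicator_def using B c
    by (intro Bochner_Integration.integral_add[symmetric] integrable_indicator_gaussian_kernel) auto
  also have "\<dots> = (LINT y|lborel. gaussian_kernel c (y - x))"
    by (intro Bochner_Integration.integral_cong) (auto simp: indicator_def)
  also have "\<dots> = 1" by (rule gaussian_kernel_integral(2)[OF c])
  finally show ?thesis using mollified_indicator_far[OF c _ d(1), of "- B" x] d(2) B by auto
qed

lemma mollified_indicator_measurable:
  assumes "B \<in> sets borel"
  shows "mollified_indicator B c \<in> borel_measurable borel"
proof -
  note [measurable] = assms
  show ?thesis unfolding mollified_indicator_def by measurable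
qed

lemma mollified_indicator_tail:
  assumes c: "1 \<le> c" and B: "B \<in> sets borel" and M: "0 \<le> M" "\<And>y. y \<in> B \<Longrightarrow> norm y \<le> M"
  shows "mollified_indicator B c x \<le> 2 * exp (M\<^sup>2 / 2) * exp (- (1 / 8 * (norm x)\<^sup>2))"
proof (cases "norm x \<le> 2 * M")
  case True
  then have "(norm x)\<^sup>2 \<le> (2 * M)\<^sup>2" by (intro power_mono) auto
  then have "1 \<le> exp (M\<^sup>2 / 2) * exp (- (1 / 8 * (norm x)\<^sup>2))"
    by (simp add: exp_add[symmetric] power_mult_distrib)
  then show ?thesis using mollified_indicator_bounds(2)[of c B x] c B by simp
next
  case False
  have "norm x / 2 \<le> norm (y - x)" if "y \<in> B" for y
    using M(2)[OF that] False norm_triangle_ineq3[of x y] by (simp add: norm_minus_commute)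
  then have "mollified_indicator B c x \<le> 2 * exp (- (c * (norm x / 2)\<^sup>2 / 2))"
    using c B by (intro mollified_indicator_far) auto
  also have "\<dots> \<le> 2 * exp (- (1 / 8 * (norm x)\<^sup>2))"
    using c mult_right_mono[of 1 c "(norm x)\<^sup>2"] by (simp add: power_divide)
  also have "\<dots> \<le> 2 * exp (M\<^sup>2 / 2) * exp (- (1 / 8 * (norm x)\<^sup>2))"
    by simp
  finally show ?thesis .
qed

lemma linear_gaussian_Lp2:
  fixes y :: "real^2"
  assumes "0 < c"
  shows "(\<lambda>x. complex_of_real ((A * (norm (x - y))\<^sup>2 + B) * exp (- (c * (norm (x - y))\<^sup>2)))) \<in> Lp 2"
proof -
  \<comment> \<open>the square of the modulus, as a polynomial in \<open>2 * c * (norm (x - y))\<^sup>2\<close>\<close>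
  define p where "p = [:B, A / (2 * c):]\<^sup>2"
  have "integrable lborel (\<lambda>x::real^2. poly p (2 * c * (norm x)\<^sup>2) * exp (- (2 * c * (norm x)\<^sup>2)))"
    using assms by (intro radial_exp_poly) simp
  then have "integrable lborel (\<lambda>x. poly p (2 * c * (norm (x - y))\<^sup>2) * exp (- (2 * c * (norm (x - y))\<^sup>2)))"
    by (subst lborel_translation(1)[of "\<lambda>x. poly p (2 * c * (norm x)\<^sup>2) * exp (- (2 * c * (norm x)\<^sup>2))"])
       (auto intro!: borel_measurable_continuous_onI continuous_intros)
  moreover have "(norm (complex_of_real ((A * (norm (x - y))\<^sup>2 + B) * exp (- (c * (norm (x - y))\<^sup>2)))))\<^sup>2
     = poly p (2 * c * (norm (x - y))\<^sup>2) * exp (- (2 * c * (norm (x - y))\<^sup>2))" for x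
  proof -
    have "exp (- (c * (norm (x - y))\<^sup>2)) ^ 2 = exp (- (2 * c * (norm (x - y))\<^sup>2))"
      by (simp add: exp_double[symmetric] mult.assoc)
    moreover have "poly p (2 * c * (norm (x - y))\<^sup>2) = (A * (norm (x - y))\<^sup>2 + B)\<^sup>2"
      using assms by (simp add: p_def poly_power add.commute mult.commute)
    ultimately show ?thesis unfolding norm_of_real power2_abs power_mult_distrib by simp
  qed
  moreover have "(\<lambda>x. complex_of_real ((A * (norm (x - y))\<^sup>2 + B) * exp (- (c * (norm (x - y))\<^sup>2)))) \<in> borel_measurable borel"
    by (intro borel_measurable_continuous_onI continuous_intros)
  ultimately show ?thesis by (simp add: Lp_def)
qed

lemma exp_neg_multiple_tendsto_0:
  assumes "0 < (d::real)"
  shows "(\<lambda>n. exp (- (real (Suc n) * d))) \<longlonglongrightarrow> 0"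
proof -
  have "(\<lambda>n. exp (- d) ^ Suc n) \<longlonglongrightarrow> 0"
    using assms by (intro LIMSEQ_Suc LIMSEQ_power_zero) simp
  moreover have "(\<lambda>n. exp (- d) ^ Suc n) = (\<lambda>n. exp (- (real (Suc n) * d)))"
    using exp_of_nat_mult[of _ "- d"] by (intro ext) (metis mult_minus_right)
  ultimately show ?thesis by (simp only:)
qed

text \<open>
  Integrating the hypothesis over the centers \<open>y\<close> in the box shows that \<open>w\<close> is orthogonal to all
  mollified indicators of the box. They converge to the indicator outside the boundary, dominated by a
  fixed Gaussian.
\<close>

lemma box_integral_eq_0_of_gaussians:
  fixes w :: "real^2 \<Rightarrow> complex"
  assumes w: "w \<in> Lp 2"
    and zero: "\<And>y c. 0 < c \<Longrightarrow> (LINT x|lborel. w x * of_real (exp (- (c * (norm (x - y))\<^sup>2)))) = 0"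
  shows "(LINT x|lborel. w x * of_real (indicator (box a b) x)) = 0"
proof -
  define B where "B = box a b"
  have B[measurable]: "B \<in> sets borel" by (simp add: B_def)
  have oB: "open B" by (simp add: B_def open_box)
  note [measurable] = LpD(1)[OF w, simplified] mollified_indicator_measurable[OF B]
  obtain M where M: "0 \<le> M" "\<And>y. y \<in> B \<Longrightarrow> norm y \<le> M"
    using bounded_box[of a b] unfolding bounded_iff B_def by (metis norm_ge_zero order_trans linear)
  define h where "h x = 2 * exp (M\<^sup>2 / 2) * exp (- (1 / 8 * (norm x)\<^sup>2))" for x :: "real^2"
  have h0: "0 \<le> h x" for x by (simp add: h_def)
  have hL: "(\<lambda>x. complex_of_real (h x)) \<in> Lp 2" unfolding h_def using linear_gaussian_Lp2[of "1 / 8" 0 0 "2 * exp (M\<^sup>2 / 2)"] by simp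
  have wh: "integrable lborel (\<lambda>x. norm (w x) * h x)"
    using integrable_norm[OF L2_mult(1)[OF w hL]] h0 by (simp add: norm_mult)
  define H where "H n = mollified_indicator B (real (Suc n))" for n
  have Hm[measurable]: "H n \<in> borel_measurable borel" for n unfolding H_def by measurable
  have H0: "0 \<le> H n x" and Hh: "H n x \<le> h x" for n x
    unfolding H_def h_def using mollified_indicator_bounds[of "real (Suc n)" B x] B
      mollified_indicator_tail[of "real (Suc n)" B M x] M by auto
  have wH: "(LINT x|lborel. w x * of_real (H n x)) = 0" for n
  proof -
    define c where "c = real (Suc n)"
    have c: "0 < c" by (simp add: c_def)
    define f where "f x y = w x * of_real (indicator B y * gaussian_kernel c (y - x))" for x y
    have int: "integrable (lborel \<Otimes>\<^sub>M lborel) (case_prod f)"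
    proof (rule lborel_pair.Fubini_integrable)
      show "case_prod f \<in> borel_measurable (lborel \<Otimes>\<^sub>M lborel)" unfolding f_def by measurable
      have "(LINT y|lborel. norm (case_prod f (x, y))) = norm (w x) * H n x" for x
        using gaussian_kernel_nonneg[OF c] unfolding H_def mollified_indicator_def c_def[symmetric]
        by (simp add: f_def norm_mult abs_mult)
      moreover have "integrable lborel (\<lambda>x. norm (w x) * H n x)"
        by (rule Bochner_Integration.integrable_bound[OF wh])
           (auto intro!: AE_I2 mult_left_mono simp: abs_mult H0 Hh h0)
      ultimately show "integrable lborel (\<lambda>x. LINT y|lborel. norm (case_prod f (x, y)))" by simp
      show "AE x in lborel. integrable lborel (\<lambda>y. case_prod f (x, y))"
        unfolding f_def using integrable_indicator_gaussian_kernel[OF c B]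
        by (auto intro!: AE_I2 integrable_mult_right integrable_of_real simp del: of_real_mult)
    qed
    have "(LINT x|lborel. w x * of_real (H n x)) = (LINT x|lborel. LINT y|lborel. f x y)"
      unfolding f_def H_def mollified_indicator_def c_def[symmetric]
      by (simp only: integral_mult_right_zero integral_complex_of_real)
    also have "\<dots> = (LINT y|lborel. LINT x|lborel. f x y)"
      by (rule lborel_pair.Fubini_integral[OF int, symmetric])
    also have "\<dots> = (LINT y::real^2|lborel. (0::complex))"
    proof (intro Bochner_Integration.integral_cong refl)
      fix y
      have "f x y = of_real (indicator B y * (c / pi)) * (w x * of_real (exp (- (c * (norm (x - y))\<^sup>2))))" for x
        by (simp add: f_def gaussian_kernel_def norm_minus_commute)
      then show "(LINT x|lborel. f x y) = 0"
        by (simp only: integral_mult_right_zero zero[OF c] mult_zero_right)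
    qed
    finally show ?thesis by simp
  qed
  have "(\<lambda>n. LINT x|lborel. w x * of_real (H n x)) \<longlonglongrightarrow> (LINT x|lborel. w x * of_real (indicator B x))"
  proof (rule integral_dominated_convergence[where w = "\<lambda>x. norm (w x) * h x"])
    have "negligible (frontier B)"
      unfolding B_def by (intro negligible_convex_frontier convex_box)
    then have "frontier B \<in> null_sets lebesgue" by (simp only: negligible_iff_null_sets)
    then have "frontier B \<in> null_sets lborel"
      by (subst (asm) null_sets_completion_iff) auto
    then have "AE x in lborel. x \<notin> frontier B" by (rule AE_not_in)
    then show "AE x in lborel. (\<lambda>n. w x * of_real (H n x)) \<longlonglongrightarrow> w x * of_real (indicator B x)"
    proof eventually_elim
      case (elim x)
      have ex: "(\<lambda>n. 2 * exp (- (real (Suc n) * d\<^sup>2 / 2))) \<longlonglongrightarrow> 0" if "0 < d" for d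
        using tendsto_mult_right_zero[OF exp_neg_multiple_tendsto_0[of "d\<^sup>2 / 2"], of 2] that by simp
      have "(\<lambda>n. H n x) \<longlonglongrightarrow> indicator B x"
      proof (cases "x \<in> B")
        case True
        then obtain d where d: "0 < d" "ball x d \<subseteq> B" using oB by (auto simp: open_contains_ball)
        have far: "d \<le> norm (y - x)" if "y \<notin> B" for y
          using d that by (force simp: dist_norm norm_minus_commute)
        have "(\<lambda>n. 1 - H n x) \<longlonglongrightarrow> 0"
        proof (rule Lim_null_comparison[OF always_eventually ex[OF d(1)]], rule allI)
          fix n
          show "norm (1 - H n x) \<le> 2 * exp (- (real (Suc n) * d\<^sup>2 / 2))"
            using mollified_indicator_near[of "real (Suc n)" B d x] far d(1) B
              mollified_indicator_bounds(2)[of "real (Suc n)" B x] unfolding H_def by simp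
        qed
        from tendsto_diff[OF tendsto_const[of 1] this] True show ?thesis by simp
      next
        case False
        then have "x \<notin> closure B" using elim oB by (simp add: frontier_def interior_open)
        then obtain d where d: "0 < d" "ball x d \<subseteq> - closure B"
          by (metis ComplI closed_closure open_Compl open_contains_ball)
        have far: "d \<le> norm (y - x)" if "y \<in> B" for y
          using d that closure_subset[of B] by (force simp: dist_norm norm_minus_commute)
        have "(\<lambda>n. H n x) \<longlonglongrightarrow> 0"
        proof (rule Lim_null_comparison[OF always_eventually ex[OF d(1)]], rule allI)
          fix n
          show "norm (H n x) \<le> 2 * exp (- (real (Suc n) * d\<^sup>2 / 2))"
            using mollified_indicator_far[of "real (Suc n)" B d x] far d(1) B H0[of n x] unfolding H_def by simp
        qed
        then show ?thesis using False by simp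
      qed
      then show ?case by (intro tendsto_intros)
    qed
    show "AE x in lborel. norm (w x * of_real (H n x)) \<le> norm (w x) * h x" for n
      using H0 Hh by (auto intro!: AE_I2 mult_left_mono simp: norm_mult)
  qed (use wh in measurable)
  then show ?thesis unfolding wH B_def by (simp add: LIMSEQ_const_iff)
qed

text \<open>
  The positive and the negative part of \<open>g\<close> are densities of two measures that agree on all boxes.
\<close>

lemma AE_eq_0_of_box_integrals:
  fixes g :: "'a::euclidean_space \<Rightarrow> real"
  assumes g[measurable]: "g \<in> borel_measurable borel"
    and int: "\<And>a b. integrable lborel (\<lambda>x. g x * indicator (box a b) x)"
    and zero: "\<And>a b. (LINT x|lborel. g x * indicator (box a b) x) = 0"
  shows "AE x in lborel. g x = 0"
proof -
  let ?P = "density lborel (\<lambda>x. ennreal (g x))" and ?N = "density lborel (\<lambda>x. ennreal (- g x))"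
  have P: "emeasure ?P (box a b) = (\<integral>\<^sup>+x. ennreal (g x * indicator (box a b) x) \<partial>lborel)" for a b
    by (subst emeasure_density) (auto intro!: nn_integral_cong simp: indicator_def)
  have N: "emeasure ?N (box a b) = (\<integral>\<^sup>+x. ennreal (- (g x * indicator (box a b) x)) \<partial>lborel)" for a b
    by (subst emeasure_density) (auto intro!: nn_integral_cong simp: indicator_def)
  have fin: "emeasure ?P (box a b) \<noteq> \<infinity>" "emeasure ?N (box a b) \<noteq> \<infinity>" for a b
    using int[of a b] unfolding P N real_integrable_def by auto
  have PN: "emeasure ?P (box a b) = emeasure ?N (box a b)" for a b
  proof -
    have "enn2real (emeasure ?P (box a b)) = enn2real (emeasure ?N (box a b))"
      using real_lebesgue_integral_def[OF int[of a b]] zero[of a b] unfolding P N by simp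
    then show ?thesis using fin[of a b] by (metis ennreal_enn2real_if infinity_ennreal_def)
  qed
  have "?P = ?N"
  proof (rule measure_eqI_generator_eq)
    let ?E = "range (\<lambda>(a, b). box a b::'a set)"
    show "Int_stable ?E" by (auto simp: Int_stable_def box_Int_box)
    show "?E \<subseteq> Pow UNIV" "sets ?P = sigma_sets UNIV ?E" "sets ?N = sigma_sets UNIV ?E"
      by (simp_all add: borel_eq_box)
    let ?A = "\<lambda>n::nat. box (- (real n *\<^sub>R One)) (real n *\<^sub>R One) :: 'a set"
    show "range ?A \<subseteq> ?E" "(\<Union>i. ?A i) = UNIV" unfolding UN_box_eq_UNIV by auto
    show "emeasure ?P (?A i) \<noteq> \<infinity>" for i by (rule fin(1))
    show "emeasure ?P X = emeasure ?N X" if "X \<in> ?E" for X using that PN by auto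
  qed
  then have "AE x in lborel. ennreal (g x) = ennreal (- g x)"
    by (subst (asm) sigma_finite_measure.density_unique_iff[OF lborel.sigma_finite_measure_axioms]) auto
  then show ?thesis
  proof eventually_elim
    case (elim x)
    then show ?case by (metis ennreal_eq_0_iff ennreal_neg linear neg_0_le_iff_le neg_le_0_iff_le order_antisym)
  qed
qed

lemma AE_eq_0_of_gaussians:
  fixes w :: "real^2 \<Rightarrow> complex"
  assumes w: "w \<in> Lp 2"
    and zero: "\<And>y c. 0 < c \<Longrightarrow> (LINT x|lborel. w x * of_real (exp (- (c * (norm (x - y))\<^sup>2)))) = 0"
  shows "AE x in lborel. w x = 0"
proof -
  note [measurable] = LpD(1)[OF w, simplified]
  have z: "(LINT x|lborel. w x * of_real (indicator (box a b) x)) = 0" for a b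
    by (rule box_integral_eq_0_of_gaussians[OF w zero])
  have "(\<lambda>x. complex_of_real (indicator (box a b) x)) \<in> Lp 2" for a b :: "real^2"
  proof -
    have "integrable lborel (indicat_real (box a b))"
      by (intro integrable_real_indicator emeasure_lborel_box_finite) simp
    moreover have "(norm (complex_of_real (indicator (box a b) x)))\<^sup>2 = indicator (box a b) x" for x
      by (simp add: indicator_def)
    ultimately show ?thesis by (simp add: Lp_def)
  qed
  then have i: "integrable lborel (\<lambda>x. w x * of_real (indicator (box a b) x))" for a b
    by (rule L2_mult(1)[OF w])
  have "AE x in lborel. Re (w x) = 0"
  proof (rule AE_eq_0_of_box_integrals)
    show "integrable lborel (\<lambda>x. Re (w x) * indicator (box a b) x)" for a b
      using integrable_Re[OF i[of a b]] by simp
    show "(LINT x|lborel. Re (w x) * indicator (box a b) x) = 0" for a b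
      using integral_Re[OF i[of a b]] z[of a b] by simp
  qed measurable
  moreover have "AE x in lborel. Im (w x) = 0"
  proof (rule AE_eq_0_of_box_integrals)
    show "integrable lborel (\<lambda>x. Im (w x) * indicator (box a b) x)" for a b
      using integrable_Im[OF i[of a b]] by simp
    show "(LINT x|lborel. Im (w x) * indicator (box a b) x) = 0" for a b
      using integral_Im[OF i[of a b]] z[of a b] by simp
  qed measurable
  ultimately show ?thesis by eventually_elim (simp add: complex_eq_iff)
qed

section \<open>Uniqueness of the solution\<close>

lemma positive_part_power_derivative:
  "((\<lambda>s::real. (max 0 s) ^ Suc (Suc n)) has_real_derivative (real (Suc (Suc n)) * (max 0 s) ^ Suc n)) (at s)"
proof -
  consider "0 < s" | "s < 0" | "s = 0" by linarith
  then show ?thesis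
  proof cases
    case 1
    have "((\<lambda>s::real. s ^ Suc (Suc n)) has_real_derivative (real (Suc (Suc n)) * s ^ Suc n)) (at s)"
      by (rule DERIV_cong[OF DERIV_pow]) simp
    then have "((\<lambda>s::real. (max 0 s) ^ Suc (Suc n)) has_real_derivative (real (Suc (Suc n)) * s ^ Suc n)) (at s)"
      by (rule has_field_derivative_transform_within_open[where S = "{0<..}"]) (use 1 in auto)
    then show ?thesis using 1 by simp
  next
    case 2
    have "((\<lambda>s::real. 0) has_real_derivative 0) (at s)" by simp
    then have "((\<lambda>s::real. (max 0 s) ^ Suc (Suc n)) has_real_derivative 0) (at s)"
      by (rule has_field_derivative_transform_within_open[where S = "{..<0}"]) (use 2 in auto)
    then show ?thesis using 2 by simp
  next
    case 3
    have "((\<lambda>h::real. \<bar>h\<bar>) \<longlongrightarrow> \<bar>0\<bar>) (at 0)" by (intro tendsto_intros)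
    then have lim: "((\<lambda>h::real. \<bar>h\<bar> ^ Suc n) \<longlongrightarrow> 0) (at 0)"
      using tendsto_power[of "\<lambda>h::real. \<bar>h\<bar>" 0 "at 0" "Suc n"] by simp
    have "((\<lambda>h::real. (max 0 (0 + h)) ^ Suc (Suc n) / h) \<longlongrightarrow> 0) (at 0)"
    proof (rule Lim_null_comparison[OF always_eventually lim], rule allI)
      fix h :: real
      show "norm ((max 0 (0 + h)) ^ Suc (Suc n) / h) \<le> \<bar>h\<bar> ^ Suc n"
      proof (cases "0 < h")
        case False
        then have "max 0 (0 + h) = 0" by simp
        then show ?thesis by (simp del: power_Suc add: power_0_left)
      qed simp
    qed
    then show ?thesis using 3 by (simp add: DERIV_def)
  qed
qed

text \<open>
  A cutoff that is twice continuously differentiable at the edge \<open>s = 1\<close> of its support; \<open>cutoff1\<close> and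
  \<open>cutoff2\<close> are its derivatives. The third power is the smallest integer power with this property.
\<close>

definition cutoff :: "real \<Rightarrow> real" where "cutoff s = (max 0 (1 - s)) ^ 3"
definition cutoff1 :: "real \<Rightarrow> real" where "cutoff1 s = - 3 * (max 0 (1 - s))\<^sup>2"
definition cutoff2 :: "real \<Rightarrow> real" where "cutoff2 s = 6 * max 0 (1 - s)"

lemma cut_derivatives:
  "((\<lambda>s. cutoff (r * s)) has_real_derivative r * cutoff1 (r * s)) (at s)"
  "((\<lambda>s. cutoff1 (r * s)) has_real_derivative r * cutoff2 (r * s)) (at s)"
proof -
  have d: "((\<lambda>s. 1 - r * s) has_real_derivative - r) (at s)"
    by (auto intro!: derivative_eq_intros)
  show "((\<lambda>s. cutoff (r * s)) has_real_derivative r * cutoff1 (r * s)) (at s)"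
    unfolding cutoff_def cutoff1_def
    using DERIV_chain2[OF positive_part_power_derivative[of 1] d] by (simp add: numeral_eq_Suc mult_ac)
  show "((\<lambda>s. cutoff1 (r * s)) has_real_derivative r * cutoff2 (r * s)) (at s)"
    unfolding cutoff1_def cutoff2_def
    using DERIV_cmult[OF DERIV_chain2[OF positive_part_power_derivative[of 0] d], of "-3"]
    by (simp add: numeral_eq_Suc mult_ac)
qed

lemma cut_bounds:
  assumes "0 \<le> s"
  shows "0 \<le> cutoff s" "cutoff s \<le> 1" "\<bar>cutoff1 s\<bar> \<le> 3" "\<bar>cutoff2 s\<bar> \<le> 6"
proof -
  have m: "0 \<le> max 0 (1 - s)" "max 0 (1 - s) \<le> 1" using assms by auto
  show "0 \<le> cutoff s" "cutoff s \<le> 1" unfolding cutoff_def using m by (auto intro: power_le_one)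
  show "\<bar>cutoff1 s\<bar> \<le> 3" unfolding cutoff1_def using power_le_one[OF m, of 2] by (simp add: abs_mult)
  show "\<bar>cutoff2 s\<bar> \<le> 6" unfolding cutoff2_def using m by simp
qed

lemma cut_eq_0: "1 \<le> s \<Longrightarrow> cutoff s = 0" "1 \<le> s \<Longrightarrow> cutoff1 s = 0" "1 \<le> s \<Longrightarrow> cutoff2 s = 0"
  by (simp_all add: cutoff_def cutoff1_def cutoff2_def)

lemma cut_continuous [continuous_intros]:
  assumes "continuous_on S f"
  shows "continuous_on S (\<lambda>x. cutoff (f x))" "continuous_on S (\<lambda>x. cutoff1 (f x))" "continuous_on S (\<lambda>x. cutoff2 (f x))"
  unfolding cutoff_def cutoff1_def cutoff2_def by (intro continuous_intros assms)+

text \<open>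
  Up to the factor \<open>4 \<pi>\<close>, the heat kernel of the plane at the complex time \<open>z\<close> as a function of the squared
  distance. Its derivative in \<open>z\<close> is its Laplacian.
\<close>

definition heat_kernel :: "complex \<Rightarrow> real \<Rightarrow> complex" where
  "heat_kernel z s = exp (- (of_real s / (4 * z))) / z"

text \<open>
  The heat kernel centered at \<open>y\<close>, truncated to the disc of radius \<open>1 / sqrt r\<close>.
\<close>

definition cut_heat :: "real \<Rightarrow> real^2 \<Rightarrow> complex \<Rightarrow> real^2 \<Rightarrow> complex" where
  "cut_heat r y z x = of_real (cutoff (r * (norm (x - y))\<^sup>2)) * heat_kernel z ((norm (x - y))\<^sup>2)"

definition cut_heat_dz :: "real \<Rightarrow> real^2 \<Rightarrow> complex \<Rightarrow> real^2 \<Rightarrow> complex" where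
  "cut_heat_dz r y z x = of_real (cutoff (r * (norm (x - y))\<^sup>2)) *
     ((of_real ((norm (x - y))\<^sup>2) / (4 * z\<^sup>2) - 1 / z) * heat_kernel z ((norm (x - y))\<^sup>2))"

text \<open>
  The commutator of the Laplacian with the cutoff, applied to the heat kernel. Every term carries a
  factor \<open>r\<close>, so it disappears as the cutoff is removed.
\<close>

definition cut_error :: "real \<Rightarrow> complex \<Rightarrow> real \<Rightarrow> complex" where
  "cut_error r z s = 4 * (of_real s * (of_real (r\<^sup>2 * cutoff2 (r * s)) - 2 * (1 / (4 * z)) * of_real (r * cutoff1 (r * s)))
     + of_real (r * cutoff1 (r * s))) * heat_kernel z s"

lemma heat_kernel_derivative:
  assumes "z \<noteq> 0"
  shows "(heat_kernel z has_vector_derivative - (1 / (4 * z)) * heat_kernel z s) (at s)"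
proof -
  have "((\<lambda>s. exp (- (s / (4 * z))) / z) has_field_derivative - (1 / (4 * z)) * heat_kernel z s) (at (of_real s))"
    unfolding heat_kernel_def using assms by (auto intro!: derivative_eq_intros)
  from has_vector_derivative_real_field[OF this] show ?thesis by (simp add: heat_kernel_def[abs_def])
qed

lemma heat_kernel_dz:
  assumes "z \<noteq> 0"
  shows "((\<lambda>z. heat_kernel z s) has_field_derivative (of_real s / (4 * z\<^sup>2) - 1 / z) * heat_kernel z s) (at z)"
proof -
  have "((\<lambda>z. - (of_real s / (4 * z))) has_field_derivative of_real s / (4 * z\<^sup>2)) (at z)"
    using assms by (auto intro!: derivative_eq_intros simp: power2_eq_square)
  from DERIV_divide[OF DERIV_fun_exp[OF this] DERIV_ident assms]
  show ?thesis unfolding heat_kernel_def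
    by (rule DERIV_cong) (use assms in \<open>simp add: field_simps power2_eq_square\<close>)
qed

lemma cut_heat_calculus:
  assumes z: "z \<noteq> 0" and r: "0 < r"
  shows "test_function (cut_heat r y z)"
    "laplacian (cut_heat r y z) x = cut_heat_dz r y z x + cut_error r z ((norm (x - y))\<^sup>2)"
proof -
  define g where "g = 1 / (4 * z)"
  define v where "v s = of_real (cutoff (r * s)) * heat_kernel z s" for s
  define v1 where "v1 s = of_real (r * cutoff1 (r * s)) * heat_kernel z s - g * (of_real (cutoff (r * s)) * heat_kernel z s)" for s
  define v2 where "v2 s = of_real (r * (r * cutoff2 (r * s))) * heat_kernel z s - 2 * g * (of_real (r * cutoff1 (r * s)) * heat_kernel z s)
      + g\<^sup>2 * (of_real (cutoff (r * s)) * heat_kernel z s)" for s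
  note h = heat_kernel_derivative[OF z, folded g_def]
  have c: "((\<lambda>s. complex_of_real (cutoff (r * s))) has_vector_derivative of_real (r * cutoff1 (r * s))) (at s)" for s
    using cut_derivatives(1) by (intro has_vector_derivative_of_real) (simp add: has_real_derivative_iff_has_vector_derivative)
  have c1: "((\<lambda>s. complex_of_real (r * cutoff1 (r * s))) has_vector_derivative of_real (r * (r * cutoff2 (r * s)))) (at s)" for s
    using DERIV_cmult[OF cut_derivatives(2)]
    by (intro has_vector_derivative_of_real) (simp add: has_real_derivative_iff_has_vector_derivative)
  have d1: "(v has_vector_derivative v1 s) (at s)" for s
    unfolding v_def v1_def
    by (rule has_vector_derivative_eq_rhs[OF has_vector_derivative_mult[OF c h]]) (simp add: algebra_simps)
  have d2: "(v1 has_vector_derivative v2 s) (at s)" for s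
    unfolding v1_def v2_def
    by (rule has_vector_derivative_eq_rhs[OF has_vector_derivative_diff[OF has_vector_derivative_mult[OF c1 h]
          has_vector_derivative_mult_right[OF has_vector_derivative_mult[OF c h]]]])
       (simp add: algebra_simps power2_eq_square)
  have ch: "continuous_on UNIV (heat_kernel z)"
    using h by (intro continuous_at_imp_continuous_on ballI has_vector_derivative_continuous) auto
  have c2: "continuous_on UNIV v2"
    unfolding v2_def by (intro continuous_intros ch)
  have eq: "cut_heat r y z = (\<lambda>x. v ((norm (x - y))\<^sup>2))"
    by (rule ext) (simp add: cut_heat_def v_def)
  note R = radial_calculus[OF d1 d2 c2, of y, folded eq]
  have "{x. cut_heat r y z x \<noteq> 0} \<subseteq> cball y (sqrt (1 / r))"
  proof
    fix x assume "x \<in> {x. cut_heat r y z x \<noteq> 0}"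
    then have "r * (norm (x - y))\<^sup>2 < 1" using cut_eq_0(1)[of "r * (norm (x - y))\<^sup>2"] by (force simp: cut_heat_def)
    then have "(norm (x - y))\<^sup>2 \<le> 1 / r" using r by (simp add: field_simps)
    then have "norm (x - y) \<le> sqrt (1 / r)" by (rule real_le_rsqrt)
    then show "x \<in> cball y (sqrt (1 / r))" by (simp add: dist_norm norm_minus_commute)
  qed
  then have "bounded {x. cut_heat r y z x \<noteq> 0}" using bounded_cball bounded_subset by blast
  then have "compact (closure {x. cut_heat r y z x \<noteq> 0})" by (simp add: compact_closure)
  with R(1) show "test_function (cut_heat r y z)" by (simp add: test_function_iff)
  show "laplacian (cut_heat r y z) x = cut_heat_dz r y z x + cut_error r z ((norm (x - y))\<^sup>2)"
  proof -
    define s where "s = (norm (x - y))\<^sup>2"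
    have g2: "of_real s / (4 * z\<^sup>2) - 1 / z = 4 * (of_real s * g\<^sup>2 - g)"
      using z unfolding g_def by (simp add: field_simps power2_eq_square)
    show ?thesis
      unfolding R(2) cut_heat_dz_def cut_error_def s_def[symmetric] g2 g_def[symmetric] v1_def v2_def
      by (simp add: algebra_simps power2_eq_square)
  qed
qed

text \<open>
  A product rule for the pairing of a curve that is differentiable only in the weak sense with a curve of
  test functions that is differentiable in the mean.
\<close>

lemma moving_pairing_derivative:
  fixes w :: "(real^2) \<times> real \<Rightarrow> complex"
  assumes w: "\<And>t. (\<lambda>x. w (x, t)) \<in> Lp 2"
    and wc: "((\<lambda>s. Lp_norm 2 (\<lambda>x. w (x, s) - w (x, t))) \<longlongrightarrow> 0) (at t)"
    and \<psi>: "\<And>t. \<psi> t \<in> Lp 2" and d\<psi>: "d\<psi> \<in> Lp 2"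
    and D: "((\<lambda>s. LINT x|lborel. w (x, s) * \<psi> t x) has_vector_derivative D) (at t)"
    and Q: "((\<lambda>s. Lp_norm 2 (\<lambda>x. \<psi> s x - \<psi> t x - of_real (s - t) * d\<psi> x) / \<bar>s - t\<bar>) \<longlongrightarrow> 0) (at t)"
  shows "((\<lambda>s. LINT x|lborel. w (x, s) * \<psi> s x) has_vector_derivative D + (LINT x|lborel. w (x, t) * d\<psi> x)) (at t)"
proof -
  define R where "R s = (LINT x|lborel. w (x, s) * (\<psi> s x - \<psi> t x))" for s
  define E where "E = (LINT x|lborel. w (x, t) * d\<psi> x)"
  define q where "q s x = \<psi> s x - \<psi> t x - of_real (s - t) * d\<psi> x" for s x
  have qL: "q s \<in> Lp 2" for s unfolding q_def by (intro Lp_diff Lp_cmult \<psi> d\<psi>) auto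
  have wdL: "(\<lambda>x. w (x, s) - w (x, t)) \<in> Lp 2" for s by (intro Lp_diff w) simp
  have "(R has_vector_derivative E) (at t)"
    unfolding has_vector_derivative_def has_derivative_iff_norm
  proof (intro conjI)
    show "bounded_linear (\<lambda>x. x *\<^sub>R E)" by (rule bounded_linear_scaleR_left)
    have lim: "((\<lambda>s. (Lp_norm 2 (\<lambda>x. w (x, t)) + Lp_norm 2 (\<lambda>x. w (x, s) - w (x, t))) * (Lp_norm 2 (q s) / \<bar>s - t\<bar>)
        + Lp_norm 2 (\<lambda>x. w (x, s) - w (x, t)) * Lp_norm 2 d\<psi>) \<longlongrightarrow> 0) (at t)"
    proof -
      have "((\<lambda>s. (Lp_norm 2 (\<lambda>x. w (x, t)) + Lp_norm 2 (\<lambda>x. w (x, s) - w (x, t))) * (Lp_norm 2 (q s) / \<bar>s - t\<bar>)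
        + Lp_norm 2 (\<lambda>x. w (x, s) - w (x, t)) * Lp_norm 2 d\<psi>) \<longlongrightarrow> (Lp_norm 2 (\<lambda>x. w (x, t)) + 0) * 0 + 0 * Lp_norm 2 d\<psi>) (at t)"
        unfolding q_def by (intro tendsto_intros wc Q)
      then show ?thesis by simp
    qed
    show "((\<lambda>s. norm (R s - R t - (s - t) *\<^sub>R E) / norm (s - t)) \<longlongrightarrow> 0) (at t)"
    proof (rule Lim_null_comparison[OF always_eventually lim], rule allI)
      fix s
      have Rt: "R t = 0" by (simp add: R_def)
      have i: "integrable lborel (\<lambda>x. w (x, s) * q s x)" "integrable lborel (\<lambda>x. w (x, s) * d\<psi> x)"
         "integrable lborel (\<lambda>x. w (x, t) * d\<psi> x)"
        by (intro L2_mult(1) w qL d\<psi>)+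
      have "R s = (LINT x|lborel. w (x, s) * q s x + of_real (s - t) * (w (x, s) * d\<psi> x))"
        unfolding R_def q_def by (intro Bochner_Integration.integral_cong refl) (simp add: algebra_simps)
      also have "\<dots> = (LINT x|lborel. w (x, s) * q s x) + of_real (s - t) * (LINT x|lborel. w (x, s) * d\<psi> x)"
        using i by (subst Bochner_Integration.integral_add) (auto simp del: of_real_diff)
      finally have "R s - R t - (s - t) *\<^sub>R E = (LINT x|lborel. w (x, s) * q s x)
          + of_real (s - t) * ((LINT x|lborel. w (x, s) * d\<psi> x) - E)"
        unfolding Rt by (simp add: scaleR_conv_of_real algebra_simps)
      also have "(LINT x|lborel. w (x, s) * d\<psi> x) - E = (LINT x|lborel. (w (x, s) - w (x, t)) * d\<psi> x)"
        unfolding E_def left_diff_distrib using i by simp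
      finally have "norm (R s - R t - (s - t) *\<^sub>R E) \<le> norm (LINT x|lborel. w (x, s) * q s x)
          + \<bar>s - t\<bar> * norm (LINT x|lborel. (w (x, s) - w (x, t)) * d\<psi> x)"
        by (simp only:) (rule order_trans[OF norm_triangle_ineq], simp only: norm_mult norm_of_real order_refl)
      also have "\<dots> \<le> Lp_norm 2 (\<lambda>x. w (x, s)) * Lp_norm 2 (q s)
          + \<bar>s - t\<bar> * (Lp_norm 2 (\<lambda>x. w (x, s) - w (x, t)) * Lp_norm 2 d\<psi>)"
        by (intro add_mono mult_left_mono L2_mult(2) w qL d\<psi> wdL) auto
      also have "\<dots> \<le> (Lp_norm 2 (\<lambda>x. w (x, t)) + Lp_norm 2 (\<lambda>x. w (x, s) - w (x, t))) * Lp_norm 2 (q s)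
          + \<bar>s - t\<bar> * (Lp_norm 2 (\<lambda>x. w (x, s) - w (x, t)) * Lp_norm 2 d\<psi>)"
      proof (intro add_right_mono mult_right_mono)
        show "Lp_norm 2 (\<lambda>x. w (x, s)) \<le> Lp_norm 2 (\<lambda>x. w (x, t)) + Lp_norm 2 (\<lambda>x. w (x, s) - w (x, t))"
          using Lp_norm_diff_le[OF w[of s] w[of t]] by simp
      qed simp
      finally have *: "norm (R s - R t - (s - t) *\<^sub>R E) \<le> \<dots>" .
      show "norm (norm (R s - R t - (s - t) *\<^sub>R E) / norm (s - t))
         \<le> (Lp_norm 2 (\<lambda>x. w (x, t)) + Lp_norm 2 (\<lambda>x. w (x, s) - w (x, t))) * (Lp_norm 2 (q s) / \<bar>s - t\<bar>)
        + Lp_norm 2 (\<lambda>x. w (x, s) - w (x, t)) * Lp_norm 2 d\<psi>"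
      proof (cases "s = t")
        case False
        then have p: "0 < \<bar>s - t\<bar>" by simp
        have "norm (R s - R t - (s - t) *\<^sub>R E) / \<bar>s - t\<bar> \<le> ((Lp_norm 2 (\<lambda>x. w (x, t)) + Lp_norm 2 (\<lambda>x. w (x, s) - w (x, t))) * Lp_norm 2 (q s)
          + \<bar>s - t\<bar> * (Lp_norm 2 (\<lambda>x. w (x, s) - w (x, t)) * Lp_norm 2 d\<psi>)) / \<bar>s - t\<bar>"
          by (intro divide_right_mono *) simp
        then show ?thesis using p by (simp add: add_divide_distrib)
      qed simp
    qed
  qed
  from has_vector_derivative_add[OF D this]
  have "((\<lambda>s. (LINT x|lborel. w (x, s) * \<psi> t x) + R s) has_vector_derivative D + E) (at t)" .
  moreover have "(LINT x|lborel. w (x, s) * \<psi> t x) + R s = (LINT x|lborel. w (x, s) * \<psi> s x)" for s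
    unfolding R_def right_diff_distrib using L2_mult(1)[OF w \<psi>] by simp
  ultimately show ?thesis unfolding E_def by simp
qed

text \<open>
  On a compact set the derivative is uniformly continuous, so the difference quotients converge
  uniformly there.
\<close>

lemma L2_differentiable_compact_support:
  fixes \<psi> d\<psi> :: "real \<Rightarrow> real^2 \<Rightarrow> complex"
  assumes K: "compact K" and out: "\<And>s x. x \<notin> K \<Longrightarrow> \<psi> s x = 0" "\<And>s x. x \<notin> K \<Longrightarrow> d\<psi> s x = 0"
    and der: "\<And>s x. ((\<lambda>s. \<psi> s x) has_vector_derivative d\<psi> s x) (at s)"
    and cont: "continuous_on UNIV (\<lambda>(s, x). d\<psi> s x)"
  shows "((\<lambda>s. Lp_norm 2 (\<lambda>x. \<psi> s x - \<psi> t x - of_real (s - t) * d\<psi> t x) / \<bar>s - t\<bar>) \<longlongrightarrow> 0) (at t)"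
proof (rule tendstoI)
  fix e :: real assume e: "0 < e"
  define V where "V = measure lborel K"
  have V: "0 \<le> V" by (simp add: V_def)
  \<comment> \<open>the additional \<open>1\<close> covers the case of a null set\<close>
  define \<epsilon> where "\<epsilon> = e / (sqrt V + 1)"
  have \<epsilon>: "0 < \<epsilon>" using e V by (simp add: \<epsilon>_def add_nonneg_pos)
  have "uniformly_continuous_on (cbox (t - 1) (t + 1) \<times> K) (\<lambda>(s, x). d\<psi> s x)"
    by (intro compact_uniformly_continuous continuous_on_subset[OF cont] compact_Times K compact_cbox) auto
  from this[unfolded uniformly_continuous_on_def, rule_format, OF \<epsilon>]
  obtain \<delta> where \<delta>: "0 < \<delta>"
    "\<And>p q. p \<in> cbox (t - 1) (t + 1) \<times> K \<Longrightarrow> q \<in> cbox (t - 1) (t + 1) \<times> K \<Longrightarrow> dist q p < \<delta>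
      \<Longrightarrow> dist (case q of (s, x) \<Rightarrow> d\<psi> s x) (case p of (s, x) \<Rightarrow> d\<psi> s x) < \<epsilon>"
    by blast
  have pt: "norm (\<psi> s x - \<psi> t x - of_real (s - t) * d\<psi> t x) \<le> \<epsilon> * \<bar>s - t\<bar> * indicator K x"
    if s: "\<bar>s - t\<bar> < min \<delta> 1" for s x
  proof (cases "x \<in> K")
    case True
    have "norm (\<psi> s x - \<psi> t x - (s - t) *\<^sub>R d\<psi> t x) \<le> norm (s - t) * \<epsilon>"
    proof (rule vector_differentiable_bound_linearization[where S = "closed_segment t s"])
      fix \<theta> assume "\<theta> \<in> closed_segment t s"
      then have \<theta>: "\<bar>\<theta> - t\<bar> < min \<delta> 1" using s by (auto simp: closed_segment_eq_real_ivl split: if_splits)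
      show "((\<lambda>s. \<psi> s x) has_vector_derivative d\<psi> \<theta> x) (at \<theta> within closed_segment t s)"
        by (rule has_vector_derivative_at_within[OF der])
      have "dist (d\<psi> \<theta> x) (d\<psi> t x) < \<epsilon>"
        using \<delta>(2)[of "(t, x)" "(\<theta>, x)"] \<theta> True by (auto simp: dist_Pair_Pair dist_real_def abs_less_iff)
      then show "norm (d\<psi> \<theta> x - d\<psi> t x) \<le> \<epsilon>" by (simp add: dist_norm)
    qed auto
    then show ?thesis using True by (simp add: scaleR_conv_of_real mult.commute)
  next
    case False
    then show ?thesis by (simp add: out)
  qed
  have Ki: "integrable lborel (\<lambda>x. (\<epsilon> * \<bar>s - t\<bar>)\<^sup>2 * indicat_real K x)" for s
    using K by (intro integrable_mult_right integrable_real_indicator emeasure_bounded_finite compact_imp_bounded)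
       (auto intro: borel_compact)
  have nb: "Lp_norm 2 (\<lambda>x. \<psi> s x - \<psi> t x - of_real (s - t) * d\<psi> t x) \<le> \<epsilon> * \<bar>s - t\<bar> * sqrt V"
    if s: "\<bar>s - t\<bar> < min \<delta> 1" for s
  proof (rule Lp_norm_leI)
    have "(LINT x|lborel. (norm (\<psi> s x - \<psi> t x - of_real (s - t) * d\<psi> t x))\<^sup>2)
        \<le> (LINT x|lborel. (\<epsilon> * \<bar>s - t\<bar>)\<^sup>2 * indicat_real K x)"
    proof (rule integral_mono_AE'[OF Ki])
      show "AE x in lborel. (norm (\<psi> s x - \<psi> t x - of_real (s - t) * d\<psi> t x))\<^sup>2 \<le> (\<epsilon> * \<bar>s - t\<bar>)\<^sup>2 * indicat_real K x"
      proof (rule AE_I2)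
        fix x
        have "(norm (\<psi> s x - \<psi> t x - of_real (s - t) * d\<psi> t x))\<^sup>2 \<le> (\<epsilon> * \<bar>s - t\<bar> * indicator K x)\<^sup>2"
          by (intro power_mono pt s) auto
        then show "(norm (\<psi> s x - \<psi> t x - of_real (s - t) * d\<psi> t x))\<^sup>2 \<le> (\<epsilon> * \<bar>s - t\<bar>)\<^sup>2 * indicat_real K x"
          by (cases "x \<in> K") auto
      qed
    qed auto
    also have "\<dots> = (\<epsilon> * \<bar>s - t\<bar>)\<^sup>2 * V" by (simp add: V_def)
    also have "\<dots> = (\<epsilon> * \<bar>s - t\<bar> * sqrt V)\<^sup>2" using V by (simp add: power_mult_distrib)
    finally show "(LINT x|lborel. (norm (\<psi> s x - \<psi> t x - of_real (s - t) * d\<psi> t x))\<^sup>2) \<le> (\<epsilon> * \<bar>s - t\<bar> * sqrt V)\<^sup>2" .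
  qed (use \<epsilon> V in auto)
  have "eventually (\<lambda>s. dist s t < min \<delta> 1 \<and> s \<noteq> t) (at t)"
    unfolding eventually_at using \<delta>(1) by (intro exI[of _ "min \<delta> 1"]) auto
  then show "eventually (\<lambda>s. dist (Lp_norm 2 (\<lambda>x. \<psi> s x - \<psi> t x - of_real (s - t) * d\<psi> t x) / \<bar>s - t\<bar>) 0 < e) (at t)"
  proof eventually_elim
    case (elim s)
    then have p: "0 < \<bar>s - t\<bar>" and s: "\<bar>s - t\<bar> < min \<delta> 1" by (auto simp: dist_real_def)
    have "Lp_norm 2 (\<lambda>x. \<psi> s x - \<psi> t x - of_real (s - t) * d\<psi> t x) / \<bar>s - t\<bar> \<le> \<epsilon> * sqrt V"
      using nb[OF s] p by (simp add: field_simps)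
    also have "\<dots> < \<epsilon> * (sqrt V + 1)" using \<epsilon> by simp
    also have "\<dots> = e"
    proof -
      have "sqrt V + 1 \<noteq> 0" using real_sqrt_ge_zero[OF V] by linarith
      then show ?thesis by (simp add: \<epsilon>_def)
    qed
    finally show ?case by (simp add: dist_real_def)
  qed
qed


lemma cut_error_bound:
  assumes r: "0 < r" "r \<le> 1" and z0: "0 < z0" and z: "Re z = z0" "(norm z)\<^sup>2 \<le> Z" and s: "0 \<le> s"
  shows "norm (cut_error r z s) \<le> r * ((4 / z0 * ((6 + 2 * (1 / (4 * z0)) * 3) * s + 3)) * exp (- (z0 / (4 * Z) * s)))"
proof -
  have nz: "z0 \<le> norm z" using complex_Re_le_cmod[of z] z by simp
  have nz0: "0 < norm z" using nz z0 by linarith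
  have Z: "0 < Z" using z(2) nz0 by (meson less_le_trans zero_less_power)
  note cb = cut_bounds[of "r * s"]
  have rs: "0 \<le> r * s" using r s by simp
  have h: "norm (heat_kernel z s) \<le> exp (- (z0 / (4 * Z) * s)) / z0"
  proof -
    have "Re (of_real s / (4 * z)) = s * z0 / (4 * (norm z)\<^sup>2)"
    proof -
      have "of_real s / (4 * z) = of_real (s / 4) / z" by simp
      also have "Re \<dots> = s / 4 * z0 / (norm z)\<^sup>2"
        unfolding Re_divide by (simp add: z cmod_power2)
      also have "\<dots> = s * z0 / (4 * (norm z)\<^sup>2)" by simp
      finally show ?thesis .
    qed
    moreover have "z0 / (4 * Z) * s \<le> s * z0 / (4 * (norm z)\<^sup>2)"
      using z(2) Z nz0 z0 s by (simp add: frac_le mult.commute)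
    ultimately have "norm (exp (- (of_real s / (4 * z)))) \<le> exp (- (z0 / (4 * Z) * s))"
      by (simp add: norm_exp_eq_Re)
    then show ?thesis
      unfolding heat_kernel_def norm_divide using nz z0 by (intro frac_le) auto
  qed
  have g: "norm (1 / (4 * z)) \<le> 1 / (4 * z0)"
    using nz z0 by (simp add: norm_divide norm_mult frac_le)
  have a: "norm (of_real (r\<^sup>2 * cutoff2 (r * s)) :: complex) \<le> r * 6"
  proof -
    have "r * (r * \<bar>cutoff2 (r * s)\<bar>) \<le> r * (1 * 6)"
      using r cb(4)[OF rs] by (intro mult_left_mono mult_mono) auto
    then show ?thesis using r unfolding norm_of_real power2_eq_square by (simp add: abs_mult mult.assoc)
  qed
  have b: "norm (of_real (r * cutoff1 (r * s)) :: complex) \<le> r * 3"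
    using r cb(3)[OF rs] unfolding norm_of_real by (simp add: abs_mult)
  have "norm (of_real s * (of_real (r\<^sup>2 * cutoff2 (r * s)) - 2 * (1 / (4 * z)) * of_real (r * cutoff1 (r * s)))
     + of_real (r * cutoff1 (r * s))) \<le> s * (r * 6 + 2 * (1 / (4 * z0)) * (r * 3)) + r * 3"
  proof (rule order_trans[OF norm_triangle_ineq], rule add_mono[OF _ b])
    have "norm (of_real (r\<^sup>2 * cutoff2 (r * s)) - 2 * (1 / (4 * z)) * of_real (r * cutoff1 (r * s)))
        \<le> norm (of_real (r\<^sup>2 * cutoff2 (r * s)) :: complex) + norm (2 * (1 / (4 * z)) * of_real (r * cutoff1 (r * s)))"
      by (rule norm_triangle_ineq4)
    also have "norm (2 * (1 / (4 * z)) * of_real (r * cutoff1 (r * s))) = 2 * norm (1 / (4 * z)) * norm (of_real (r * cutoff1 (r * s)) :: complex)"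
      unfolding norm_mult by simp
    also have "norm (of_real (r\<^sup>2 * cutoff2 (r * s)) :: complex) + 2 * norm (1 / (4 * z)) * norm (of_real (r * cutoff1 (r * s)) :: complex)
        \<le> r * 6 + 2 * (1 / (4 * z0)) * (r * 3)"
      using z0 by (intro add_mono a mult_mono b g mult_left_mono) auto
    finally have "s * norm (of_real (r\<^sup>2 * cutoff2 (r * s)) - 2 * (1 / (4 * z)) * of_real (r * cutoff1 (r * s)))
        \<le> s * (r * 6 + 2 * (1 / (4 * z0)) * (r * 3))" by (rule mult_left_mono[OF _ s])
    then show "norm (of_real s * (of_real (r\<^sup>2 * cutoff2 (r * s)) - 2 * (1 / (4 * z)) * of_real (r * cutoff1 (r * s))))
        \<le> s * (r * 6 + 2 * (1 / (4 * z0)) * (r * 3))"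
      using s by (simp only: norm_mult norm_of_real abs_of_nonneg)
  qed
  then have "norm (cut_error r z s) \<le> 4 * (s * (r * 6 + 2 * (1 / (4 * z0)) * (r * 3)) + r * 3) * (exp (- (z0 / (4 * Z) * s)) / z0)"
    unfolding cut_error_def norm_mult[of _ "heat_kernel z s"] norm_mult[of 4]
    using r s z0 by (intro mult_mono h) auto
  also have "\<dots> = r * ((4 / z0 * ((6 + 2 * (1 / (4 * z0)) * 3) * s + 3)) * exp (- (z0 / (4 * Z) * s)))"
    by (simp add: algebra_simps add_divide_distrib)
  finally show ?thesis .
qed

lemma vector_derivative_bound:
  fixes f :: "real \<Rightarrow> complex"
  assumes "\<And>t. t \<in> closed_segment a b \<Longrightarrow> (f has_vector_derivative f' t) (at t)"
    "\<And>t. t \<in> closed_segment a b \<Longrightarrow> norm (f' t) \<le> B"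
  shows "norm (f b - f a) \<le> B * norm (b - a)"
proof (rule differentiable_bound[where S = "closed_segment a b" and f' = "\<lambda>t h. h *\<^sub>R f' t"])
  fix t assume t: "t \<in> closed_segment a b"
  show "(f has_derivative (\<lambda>h. h *\<^sub>R f' t)) (at t within closed_segment a b)"
    using has_vector_derivative_at_within[OF assms(1)[OF t]] by (simp add: has_vector_derivative_def)
  show "onorm (\<lambda>h. h *\<^sub>R f' t) \<le> B"
  proof (rule onorm_le)
    fix h :: real
    show "norm (h *\<^sub>R f' t) \<le> B * norm h"
      using mult_right_mono[OF assms(2)[OF t], of "\<bar>h\<bar>"] by (simp add: mult.commute)
  qed
qed auto

text \<open>
  Let the complex time \<open>z(t) = z0 + i (T - t)\<close> of the heat kernel run against the Schroedinger flow. Then the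
  derivative of the pairing with \<open>w\<close> vanishes except for the commutator with the cutoff, which is of
  order \<open>r\<close> uniformly for \<open>t\<close> between \<open>0\<close> and \<open>T\<close>. Since \<open>w\<close> vanishes at time \<open>0\<close>, the pairing at
  time \<open>T\<close> is of order \<open>r\<close>, and \<open>r\<close> tends to \<open>0\<close>.
\<close>

lemma gaussian_pairing_eq_0:
  fixes w :: "(real^2) \<times> real \<Rightarrow> complex"
  assumes w: "\<And>t. (\<lambda>x. w (x, t)) \<in> Lp 2"
    and wc: "\<And>t. ((\<lambda>s. Lp_norm 2 (\<lambda>x. w (x, s) - w (x, t))) \<longlongrightarrow> 0) (at t)"
    and w0: "AE x in lborel. w (x, 0) = 0"
    and weak: "\<And>\<phi> t. test_function \<phi> \<Longrightarrow>
        ((\<lambda>s. LINT x|lborel. w (x, s) * \<phi> x) has_vector_derivative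
           \<i> * (LINT x|lborel. w (x, t) * laplacian \<phi> x)) (at t)"
    and z0: "0 < z0"
  shows "(LINT x|lborel. w (x, T) * heat_kernel (of_real z0) ((norm (x - y))\<^sup>2)) = 0"
proof -
  define zt where "zt t = Complex z0 (T - t)" for t
  have zt: "zt t = (of_real z0 + \<i> * of_real T) - \<i> * of_real t" for t
    by (simp add: zt_def complex_eq_iff)
  have ztn: "zt t \<noteq> 0" for t using z0 by (simp add: zt_def complex_eq_iff)
  \<comment> \<open>\<open>Z\<close> bounds the squared modulus of \<open>zt t\<close>, and \<open>c\<close> the decay rate of the kernels from below\<close>
  define Z where "Z = z0\<^sup>2 + (2 * T)\<^sup>2"
  have Z: "0 < Z" using z0 by (simp add: Z_def add_pos_nonneg)
  define c where "c = z0 / (4 * Z)"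
  have c: "0 < c" using z0 Z by (simp add: c_def)
  define A where "A = 4 / z0 * (6 + 2 * (1 / (4 * z0)) * 3)"
  define h where "h x = complex_of_real ((A * (norm (x - y))\<^sup>2 + 12 / z0) * exp (- (c * (norm (x - y))\<^sup>2)))" for x
  have hL: "h \<in> Lp 2" unfolding h_def by (rule linear_gaussian_Lp2[OF c])
  have A0: "0 \<le> A" using z0 by (simp add: A_def)
  define J where "J = closed_segment 0 T"
  have J: "\<bar>t\<bar> \<le> \<bar>T\<bar> \<and> \<bar>T - t\<bar> \<le> \<bar>T\<bar>" if "t \<in> J" for t
    using that by (auto simp: J_def closed_segment_eq_real_ivl split: if_splits)
  have "continuous_on J (\<lambda>t. Lp_norm 2 (\<lambda>x. w (x, t)))"
  proof (intro continuous_at_imp_continuous_on ballI)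
    fix t
    have "((\<lambda>s. Lp_norm 2 (\<lambda>x. w (x, s)) - Lp_norm 2 (\<lambda>x. w (x, t))) \<longlongrightarrow> 0) (at t)"
      by (rule Lim_null_comparison[OF always_eventually wc[of t]]) (use Lp_norm_diff_le[OF w w] in auto)
    then show "isCont (\<lambda>t. Lp_norm 2 (\<lambda>x. w (x, t))) t" unfolding isCont_def by (rule LIM_zero_cancel)
  qed
  then have "bounded ((\<lambda>t. Lp_norm 2 (\<lambda>x. w (x, t))) ` J)"
    unfolding J_def by (intro compact_imp_bounded compact_continuous_image) auto
  then obtain M where M: "\<And>t. t \<in> J \<Longrightarrow> Lp_norm 2 (\<lambda>x. w (x, t)) \<le> M"
    unfolding bounded_iff by auto
  have bound: "norm (LINT x|lborel. w (x, T) * cut_heat r y (of_real z0) x) \<le> M * (r * Lp_norm 2 h) * \<bar>T\<bar>"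
    if r: "0 < r" "r \<le> 1" for r
  proof -
    define \<psi> where "\<psi> t = cut_heat r y (zt t)" for t
    define d\<psi> where "d\<psi> t x = - \<i> * cut_heat_dz r y (zt t) x" for t x
    define er where "er t x = cut_error r (zt t) ((norm (x - y))\<^sup>2)" for t x
    note C = cut_heat_calculus[OF ztn r(1), of y]
    note tf = test_function_Lp[OF C(1) pos2]
    define K where "K = cball y (sqrt (1 / r))"
    have K: "compact K" by (simp add: K_def)
    have out: "cutoff (r * (norm (x - y))\<^sup>2) = 0" if "x \<notin> K" for x
    proof (rule cut_eq_0(1))
      have "\<not> (norm (x - y))\<^sup>2 \<le> 1 / r"
        using that real_le_rsqrt[of "norm (x - y)" "1 / r"] by (auto simp: K_def dist_norm norm_minus_commute)
      then show "1 \<le> r * (norm (x - y))\<^sup>2" using r by (simp add: field_simps)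
    qed
    have der: "((\<lambda>s. \<psi> s x) has_vector_derivative d\<psi> s x) (at s)" for s x
    proof -
      have dz: "((\<lambda>t. (of_real z0 + \<i> * of_real T) - \<i> * t) has_field_derivative - \<i>) (at t)" for t
        by (auto intro!: derivative_eq_intros)
      have "((\<lambda>s. heat_kernel (zt s) S) has_vector_derivative (of_real S / (4 * (zt s)\<^sup>2) - 1 / zt s) * heat_kernel (zt s) S * - \<i>) (at s)" for S
        unfolding zt
        by (rule has_vector_derivative_real_field[OF DERIV_chain2[OF heat_kernel_dz dz]])
           (use ztn in \<open>simp only: zt[symmetric] not_False_eq_True\<close>)
      from has_vector_derivative_mult_right[OF this, of "of_real (cutoff (r * (norm (x - y))\<^sup>2))" "(norm (x - y))\<^sup>2"]
      show ?thesis unfolding \<psi>_def cut_heat_def d\<psi>_def cut_heat_dz_def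
        by (rule has_vector_derivative_eq_rhs) (simp add: mult_ac)
    qed
    have czt: "continuous_on UNIV (\<lambda>p::real \<times> (real^2). zt (fst p))"
      unfolding zt by (intro continuous_intros)
    have cont: "continuous_on UNIV (\<lambda>(s, x). d\<psi> s x)"
      unfolding d\<psi>_def cut_heat_dz_def heat_kernel_def case_prod_beta
      by (intro continuous_intros czt) (use ztn in auto)
    have d\<psi>L: "d\<psi> t \<in> Lp 2" for t
    proof (rule Lp_compact_support[OF _ K])
      show "continuous_on UNIV (d\<psi> t)"
      proof -
        have "continuous_on UNIV (\<lambda>x::real^2. (t, x))" by (intro continuous_intros)
        from continuous_on_compose2[OF cont this] show ?thesis by simp
      qed
    qed (auto simp: d\<psi>_def cut_heat_dz_def out)
    have lap: "laplacian (\<psi> t) x = \<i> * d\<psi> t x + er t x" for t x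
      unfolding \<psi>_def C(2) d\<psi>_def er_def by simp
    have erL: "er t \<in> Lp 2" for t
    proof -
      have "er t = (\<lambda>x. laplacian (\<psi> t) x - \<i> * d\<psi> t x)" by (rule ext) (simp add: lap)
      then show ?thesis using Lp_diff(1)[OF tf(2) Lp_cmult[OF d\<psi>L] pos2] unfolding \<psi>_def by simp
    qed
    have main: "((\<lambda>s. LINT x|lborel. w (x, s) * \<psi> s x) has_vector_derivative \<i> * (LINT x|lborel. w (x, t) * er t x)) (at t)" for t
    proof -
      have "((\<lambda>s. LINT x|lborel. w (x, s) * \<psi> s x) has_vector_derivative
          \<i> * (LINT x|lborel. w (x, t) * laplacian (\<psi> t) x) + (LINT x|lborel. w (x, t) * d\<psi> t x)) (at t)"
      proof (rule moving_pairing_derivative[OF w wc _ d\<psi>L])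
        show "\<psi> t \<in> Lp 2" for t unfolding \<psi>_def by (rule tf(1))
        show "((\<lambda>s. LINT x|lborel. w (x, s) * \<psi> t x) has_vector_derivative \<i> * (LINT x|lborel. w (x, t) * laplacian (\<psi> t) x)) (at t)"
          unfolding \<psi>_def by (rule weak[OF C(1)])
        show "((\<lambda>s. Lp_norm 2 (\<lambda>x. \<psi> s x - \<psi> t x - of_real (s - t) * d\<psi> t x) / \<bar>s - t\<bar>) \<longlongrightarrow> 0) (at t)"
          by (rule L2_differentiable_compact_support[OF K _ _ der cont])
             (simp_all add: \<psi>_def d\<psi>_def cut_heat_def cut_heat_dz_def out)
      qed
      moreover have "(LINT x|lborel. w (x, t) * laplacian (\<psi> t) x)
          = \<i> * (LINT x|lborel. w (x, t) * d\<psi> t x) + (LINT x|lborel. w (x, t) * er t x)"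
      proof -
        have "(LINT x|lborel. w (x, t) * laplacian (\<psi> t) x)
          = (LINT x|lborel. \<i> * (w (x, t) * d\<psi> t x) + w (x, t) * er t x)"
          by (simp add: lap algebra_simps)
        also have "\<dots> = \<i> * (LINT x|lborel. w (x, t) * d\<psi> t x) + (LINT x|lborel. w (x, t) * er t x)"
          using L2_mult(1)[OF w d\<psi>L] L2_mult(1)[OF w erL] by (subst Bochner_Integration.integral_add) auto
        finally show ?thesis .
      qed
      ultimately show ?thesis by (simp add: distrib_left mult.assoc[symmetric])
    qed
    have eb: "norm (\<i> * (LINT x|lborel. w (x, t) * er t x)) \<le> M * (r * Lp_norm 2 h)" if t: "t \<in> J" for t
    proof -
      have pt: "norm (er t x) \<le> norm (of_real r * h x)" for x
      proof -
        have "(norm (zt t))\<^sup>2 \<le> Z"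
        proof -
          have "\<bar>T - t\<bar> \<le> \<bar>2 * T\<bar>" using J[OF t] by auto
          then have "(T - t)\<^sup>2 \<le> (2 * T)\<^sup>2" by (simp only: abs_le_square_iff)
          then show ?thesis by (simp add: zt_def cmod_power2 Z_def)
        qed
        then have "norm (er t x) \<le> r * ((4 / z0 * ((6 + 2 * (1 / (4 * z0)) * 3) * (norm (x - y))\<^sup>2 + 3)) * exp (- (z0 / (4 * Z) * (norm (x - y))\<^sup>2)))"
          unfolding er_def by (intro cut_error_bound r z0) (auto simp: zt_def)
        also have "4 / z0 * ((6 + 2 * (1 / (4 * z0)) * 3) * (norm (x - y))\<^sup>2 + 3) = A * (norm (x - y))\<^sup>2 + 12 / z0"
          unfolding A_def using z0 by (simp add: field_simps)
        also have "r * ((A * (norm (x - y))\<^sup>2 + 12 / z0) * exp (- (z0 / (4 * Z) * (norm (x - y))\<^sup>2))) = norm (of_real r * h x)"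
          using r z0 A0 unfolding h_def c_def norm_mult norm_of_real by (simp add: abs_mult)
        finally show ?thesis .
      qed
      have rhL: "(\<lambda>x. of_real r * h x) \<in> Lp 2" by (rule Lp_cmult[OF hL])
      have "Lp_norm 2 (er t) \<le> Lp_norm 2 (\<lambda>x. of_real r * h x)"
      proof (rule Lp_norm_leI)
        show "(LINT x|lborel. (norm (er t x))\<^sup>2) \<le> (Lp_norm 2 (\<lambda>x. of_real r * h x))\<^sup>2"
          unfolding Lp_norm_power[OF pos2]
          by (intro integral_mono LpD(2) erL rhL power_mono pt) auto
      qed auto
      also have "\<dots> = r * Lp_norm 2 h" using r by (simp add: Lp_norm_cmult)
      finally have e: "Lp_norm 2 (er t) \<le> r * Lp_norm 2 h" .
      have "norm (\<i> * (LINT x|lborel. w (x, t) * er t x)) \<le> Lp_norm 2 (\<lambda>x. w (x, t)) * Lp_norm 2 (er t)"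
        using L2_mult(2)[OF w erL] by (simp add: norm_mult)
      also have "\<dots> \<le> M * (r * Lp_norm 2 h)"
        using M[OF t] e order_trans[OF Lp_norm_nonneg[OF pos2] M[OF t]] by (intro mult_mono) auto
      finally show ?thesis .
    qed
    have "norm ((LINT x|lborel. w (x, T) * \<psi> T x) - (LINT x|lborel. w (x, 0) * \<psi> 0 x)) \<le> M * (r * Lp_norm 2 h) * norm (T - 0)"
      by (rule vector_derivative_bound[OF main eb]) (auto simp: J_def)
    moreover have "(LINT x|lborel. w (x, 0) * \<psi> 0 x) = 0"
    proof -
      have "(LINT x|lborel. w (x, 0) * \<psi> 0 x) = (LINT x::real^2|lborel. (0::complex))"
      proof (rule integral_cong_AE)
        show "(\<lambda>x. w (x, 0) * \<psi> 0 x) \<in> borel_measurable lborel"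
          using LpD(1)[OF w[of 0]] LpD(1)[OF tf(1)] unfolding \<psi>_def by measurable
        show "AE x in lborel. w (x, 0) * \<psi> 0 x = 0" using w0 by eventually_elim simp
      qed simp
      then show ?thesis by simp
    qed
    moreover have "\<psi> T = cut_heat r y (of_real z0)" by (simp add: \<psi>_def zt_def complex_of_real_def)
    ultimately show ?thesis by simp
  qed
  have heatL: "(\<lambda>x. heat_kernel (of_real z0) ((norm (x - y))\<^sup>2)) \<in> Lp 2"
  proof -
    have "heat_kernel (of_real z0) ((norm (x - y))\<^sup>2)
        = of_real (1 / z0) * complex_of_real ((0 * (norm (x - y))\<^sup>2 + 1) * exp (- (1 / (4 * z0) * (norm (x - y))\<^sup>2)))" for x
      by (simp add: heat_kernel_def exp_of_real[symmetric])
    then show ?thesis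
      using Lp_cmult[OF linear_gaussian_Lp2[of "1 / (4 * z0)" 0 y 1], of "of_real (1 / z0)"] z0 by simp
  qed
  define rr where "rr n = inverse (real (Suc n))" for n
  have rr: "0 < rr n" "rr n \<le> 1" for n by (auto simp: rr_def field_simps)
  have rr0: "rr \<longlonglongrightarrow> 0" unfolding rr_def by (rule LIMSEQ_inverse_real_of_nat)
  have "(\<lambda>n. LINT x|lborel. w (x, T) * cut_heat (rr n) y (of_real z0) x) \<longlonglongrightarrow> (LINT x|lborel. w (x, T) * heat_kernel (of_real z0) ((norm (x - y))\<^sup>2))"
  proof (rule integral_dominated_convergence[where w = "\<lambda>x. norm (w (x, T) * heat_kernel (of_real z0) ((norm (x - y))\<^sup>2))"])
    show "AE x in lborel. (\<lambda>n. w (x, T) * cut_heat (rr n) y (of_real z0) x) \<longlonglongrightarrow> w (x, T) * heat_kernel (of_real z0) ((norm (x - y))\<^sup>2)"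
    proof (rule AE_I2)
      fix x
      have "continuous_on UNIV (\<lambda>r. cutoff (r * (norm (x - y))\<^sup>2))" by (intro continuous_intros)
      then have "(\<lambda>n. cutoff (rr n * (norm (x - y))\<^sup>2)) \<longlonglongrightarrow> cutoff (0 * (norm (x - y))\<^sup>2)"
        by (rule continuous_on_tendsto_compose[OF _ rr0]) auto
      then have "(\<lambda>n. complex_of_real (cutoff (rr n * (norm (x - y))\<^sup>2))) \<longlonglongrightarrow> of_real 1"
        by (intro tendsto_of_real) (simp add: cutoff_def)
      then have "(\<lambda>n. w (x, T) * (of_real (cutoff (rr n * (norm (x - y))\<^sup>2)) * heat_kernel (of_real z0) ((norm (x - y))\<^sup>2)))
          \<longlonglongrightarrow> w (x, T) * (of_real 1 * heat_kernel (of_real z0) ((norm (x - y))\<^sup>2))"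
        by (rule tendsto_mult[OF tendsto_const tendsto_mult[OF _ tendsto_const]])
      then show "(\<lambda>n. w (x, T) * cut_heat (rr n) y (of_real z0) x) \<longlonglongrightarrow> w (x, T) * heat_kernel (of_real z0) ((norm (x - y))\<^sup>2)"
        by (simp add: cut_heat_def)
    qed
    show "AE x in lborel. norm (w (x, T) * cut_heat (rr n) y (of_real z0) x) \<le> norm (w (x, T) * heat_kernel (of_real z0) ((norm (x - y))\<^sup>2))" for n
    proof (rule AE_I2)
      fix x
      have "0 \<le> rr n * (norm (x - y))\<^sup>2" using rr(1)[of n] by simp
      from cut_bounds(1,2)[OF this]
      have "\<bar>cutoff (rr n * (norm (x - y))\<^sup>2)\<bar> * norm (heat_kernel (of_real z0) ((norm (x - y))\<^sup>2)) \<le> 1 * norm (heat_kernel (of_real z0) ((norm (x - y))\<^sup>2))"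
        by (intro mult_right_mono) auto
      then show "norm (w (x, T) * cut_heat (rr n) y (of_real z0) x) \<le> norm (w (x, T) * heat_kernel (of_real z0) ((norm (x - y))\<^sup>2))"
        unfolding cut_heat_def norm_mult norm_of_real by (intro mult_left_mono) auto
    qed
    show "(\<lambda>x. w (x, T) * cut_heat (rr n) y (of_real z0) x) \<in> borel_measurable lborel" for n
      using z0 rr(1) by (intro borel_measurable_integrable L2_mult(1)[OF w] test_function_Lp(1)[OF cut_heat_calculus(1)]) auto
    show "integrable lborel (\<lambda>x. norm (w (x, T) * heat_kernel (of_real z0) ((norm (x - y))\<^sup>2)))"
      by (intro integrable_norm L2_mult(1)[OF w heatL])
    show "(\<lambda>x. w (x, T) * heat_kernel (of_real z0) ((norm (x - y))\<^sup>2)) \<in> borel_measurable lborel"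
      by (intro borel_measurable_integrable L2_mult(1)[OF w heatL])
  qed
  moreover have "(\<lambda>n. LINT x|lborel. w (x, T) * cut_heat (rr n) y (of_real z0) x) \<longlonglongrightarrow> 0"
  proof (rule Lim_null_comparison[OF always_eventually])
    show "\<forall>n. norm (LINT x|lborel. w (x, T) * cut_heat (rr n) y (of_real z0) x) \<le> M * (rr n * Lp_norm 2 h) * \<bar>T\<bar>"
      using bound rr by blast
    have "(\<lambda>n. M * (rr n * Lp_norm 2 h) * \<bar>T\<bar>) \<longlonglongrightarrow> M * (0 * Lp_norm 2 h) * \<bar>T\<bar>" by (intro tendsto_intros rr0)
    then show "(\<lambda>n. M * (rr n * Lp_norm 2 h) * \<bar>T\<bar>) \<longlonglongrightarrow> 0" by simp
  qed
  ultimately show ?thesis by (rule LIMSEQ_unique)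
qed

lemma schrodinger_solutionD:
  assumes "schrodinger_solution f u"
  shows "u \<in> borel_measurable lborel" "(\<lambda>x. u (x, t)) \<in> Lp 2"
    "((\<lambda>s. Lp_norm 2 (\<lambda>x. u (x, s) - u (x, t))) \<longlongrightarrow> 0) (at t)"
    "AE x in lborel. u (x, 0) = f x"
    "test_function \<phi> \<Longrightarrow> ((\<lambda>s. LINT x|lborel. u (x, s) * \<phi> x) has_vector_derivative
           \<i> * (LINT x|lborel. u (x, t) * laplacian \<phi> x)) (at t)"
proof -
  note a = assms[unfolded schrodinger_solution_def]
  show "u \<in> borel_measurable lborel" by (rule a[THEN conjunct1])
  show "(\<lambda>x. u (x, t)) \<in> Lp 2" by (rule a[THEN conjunct2, THEN conjunct1, THEN spec])
  show "((\<lambda>s. Lp_norm 2 (\<lambda>x. u (x, s) - u (x, t))) \<longlongrightarrow> 0) (at t)"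
    by (rule a[THEN conjunct2, THEN conjunct2, THEN conjunct1, THEN spec])
  show "AE x in lborel. u (x, 0) = f x"
    by (rule a[THEN conjunct2, THEN conjunct2, THEN conjunct2, THEN conjunct1])
  show "((\<lambda>s. LINT x|lborel. u (x, s) * \<phi> x) has_vector_derivative
           \<i> * (LINT x|lborel. u (x, t) * laplacian \<phi> x)) (at t)" if "test_function \<phi>"
    by (rule a[THEN conjunct2, THEN conjunct2, THEN conjunct2, THEN conjunct2, THEN spec, THEN spec, THEN mp, OF that])
qed

lemma schrodinger_solution_unique:
  assumes u: "schrodinger_solution f u" and v: "schrodinger_solution f v"
  shows "AE x in lborel. u (x, T) = v (x, T)"
proof -
  define w where "w p = u p - v p" for p
  note U = schrodinger_solutionD[OF u] and V = schrodinger_solutionD[OF v]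
  note uL = U(2) and vL = V(2)
  have wL: "(\<lambda>x. w (x, t)) \<in> Lp 2" for t unfolding w_def by (intro Lp_diff uL vL) simp
  have wc: "((\<lambda>s. Lp_norm 2 (\<lambda>x. w (x, s) - w (x, t))) \<longlongrightarrow> 0) (at t)" for t
  proof (rule Lim_null_comparison[OF always_eventually])
    show "((\<lambda>s. Lp_norm 2 (\<lambda>x. u (x, s) - u (x, t)) + Lp_norm 2 (\<lambda>x. v (x, s) - v (x, t))) \<longlongrightarrow> 0) (at t)"
      using tendsto_add[OF U(3) V(3)] by simp
    show "\<forall>s. norm (Lp_norm 2 (\<lambda>x. w (x, s) - w (x, t))) \<le> Lp_norm 2 (\<lambda>x. u (x, s) - u (x, t)) + Lp_norm 2 (\<lambda>x. v (x, s) - v (x, t))"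
    proof
      fix s
      have "(\<lambda>x. w (x, s) - w (x, t)) = (\<lambda>x. (u (x, s) - u (x, t)) - (v (x, s) - v (x, t)))"
        by (auto simp: w_def)
      then show "norm (Lp_norm 2 (\<lambda>x. w (x, s) - w (x, t))) \<le> Lp_norm 2 (\<lambda>x. u (x, s) - u (x, t)) + Lp_norm 2 (\<lambda>x. v (x, s) - v (x, t))"
        using Lp_diff(2)[OF Lp_diff(1)[OF uL[of s] uL[of t] pos2] Lp_diff(1)[OF vL[of s] vL[of t] pos2] pos2] by simp
    qed
  qed
  have w0: "AE x in lborel. w (x, 0) = 0"
  proof -
    show ?thesis using U(4) V(4) by eventually_elim (simp add: w_def)
  qed
  have weak: "((\<lambda>s. LINT x|lborel. w (x, s) * \<phi> x) has_vector_derivative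
           \<i> * (LINT x|lborel. w (x, t) * laplacian \<phi> x)) (at t)" if \<phi>: "test_function \<phi>" for \<phi> t
  proof -
    note L = test_function_Lp[OF \<phi> pos2]
    have e: "(LINT x|lborel. w (x, s) * g x) = (LINT x|lborel. u (x, s) * g x) - (LINT x|lborel. v (x, s) * g x)"
      if "g \<in> Lp 2" for g s
      unfolding w_def left_diff_distrib using L2_mult(1)[OF uL that] L2_mult(1)[OF vL that] by simp
    show ?thesis
      unfolding e[OF L(1)] e[OF L(2)] right_diff_distrib
      by (intro has_vector_derivative_diff U(5) V(5) \<phi>)
  qed
  have "AE x in lborel. w (x, T) = 0"
  proof (rule AE_eq_0_of_gaussians[OF wL])
    fix y :: "real^2" and c :: real assume c: "0 < c"
    define z0 where "z0 = 1 / (4 * c)"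
    have z0: "0 < z0" using c by (simp add: z0_def)
    have "heat_kernel (of_real z0) s = of_real (4 * c) * of_real (exp (- (c * s)))" for s
      using c by (simp add: heat_kernel_def z0_def exp_of_real[symmetric] mult.commute)
    then have "w (x, T) * heat_kernel (of_real z0) ((norm (x - y))\<^sup>2)
        = of_real (4 * c) * (w (x, T) * of_real (exp (- (c * (norm (x - y))\<^sup>2))))" for x by simp
    with gaussian_pairing_eq_0[OF wL wc w0 weak z0, of T y]
    have "complex_of_real (4 * c) * (LINT x|lborel. w (x, T) * of_real (exp (- (c * (norm (x - y))\<^sup>2)))) = 0"
      by (simp only: integral_mult_right_zero)
    then show "(LINT x|lborel. w (x, T) * of_real (exp (- (c * (norm (x - y))\<^sup>2)))) = 0" using c by simp
  qed
  then show ?thesis by eventually_elim (simp add: w_def)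
qed

section \<open>Time integrals of powers of the phase\<close>

text \<open>
  The substitution \<open>\<tau> = 4 \<pi> t\<close> in the integral of \<open>1 / (1 + \<tau>\<^sup>2)\<close>.
\<close>

lemma inverse_zeta_sq_integral:
  "integrable lborel (\<lambda>t. 1 / zeta_sq t)" "(LINT t|lborel. 1 / zeta_sq t) = 1 / 4"
proof -
  have eint: "einterval (-\<infinity>) \<infinity> = (UNIV :: real set)" by (auto simp: einterval_def)
  have i: "integrable lborel (\<lambda>x::real. inverse (1 + x\<^sup>2))"
    using integrable_inverse_1_plus_square by (simp add: set_integrable_def eint)
  have I: "(LINT x|lborel. inverse (1 + x\<^sup>2)) = pi"
    using LBINT_inverse_1_plus_square by (simp add: interval_lebesgue_integral_def set_lebesgue_integral_def eint)
  have e: "1 / zeta_sq t = inverse (1 + (0 + 4 * pi * t)\<^sup>2)" for t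
    by (simp add: zeta_sq_def inverse_eq_divide)
  show "integrable lborel (\<lambda>t. 1 / zeta_sq t)"
    unfolding e using i by (intro lborel_integrable_real_affine) auto
  have "pi = 4 * pi * (LINT t|lborel. inverse (1 + (0 + 4 * pi * t)\<^sup>2))"
    using lborel_integral_real_affine[of "4 * pi" "\<lambda>x. inverse (1 + x\<^sup>2)" 0] I by simp
  then show "(LINT t|lborel. 1 / zeta_sq t) = 1 / 4"
    unfolding e by (simp add: field_simps)
qed

lemma phase_eq: "phase t = 2 / zeta t - 1"
  unfolding phase_def two_minus_zeta[symmetric] by (simp add: diff_divide_distrib)

lemma phase_derivative:
  "(phase has_vector_derivative (- (8 * pi) * \<i>) * (phase t / of_real (zeta_sq t))) (at t)"
proof -
  have z: "zeta t = 1 + 4 * of_real pi * \<i> * of_real t" for t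
    by (simp add: zeta_def complex_eq_iff)
  have "((\<lambda>\<tau>. 2 / (1 + 4 * of_real pi * \<i> * \<tau>) - 1) has_field_derivative
      - (8 * of_real pi * \<i>) / (zeta t * zeta t)) (at (of_real t))"
    using zeta_nonzero(1)[of t] unfolding z by (auto intro!: derivative_eq_intros)
  from has_vector_derivative_real_field[OF this]
  have "(phase has_vector_derivative - (8 * of_real pi * \<i>) / (zeta t * zeta t)) (at t)"
    unfolding phase_eq[abs_def] z .
  moreover have "1 / (zeta t * zeta t) = phase t / of_real (zeta_sq t)"
    unfolding phase_def zeta_mult_cnj[symmetric] by simp
  ultimately show ?thesis
    by (metis (no_types, lifting) mult_minus_left of_real_minus of_real_mult of_real_numeral times_divide_eq_right mult.right_neutral minus_mult_left)
qed

lemma phase_limits: "(phase \<longlongrightarrow> - 1) at_top" "(phase \<longlongrightarrow> - 1) at_bot"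
proof -
  have b: "norm (2 / zeta t) \<le> norm (inverse t)" if False: "t \<noteq> 0" for t
  proof -
    have "4 * pi * \<bar>t\<bar> \<le> norm (zeta t)"
      using abs_Im_le_cmod[of "zeta t"] by (simp add: zeta_def abs_mult)
    moreover have "2 * \<bar>t\<bar> \<le> 4 * pi * \<bar>t\<bar>"
      using pi_gt3 by (intro mult_right_mono) auto
    ultimately have "2 * \<bar>t\<bar> \<le> norm (zeta t)" by linarith
    then show ?thesis using False by (simp add: norm_divide field_simps)
  qed
  have "((\<lambda>t::real. norm (inverse t)) \<longlongrightarrow> 0) at_infinity"
    by (rule tendsto_norm_zero[OF tendsto_inverse_0])
  then have "((\<lambda>t. 2 / zeta t) \<longlongrightarrow> 0) at_infinity"
    by (rule Lim_null_comparison[OF eventually_mono[OF eventually_not_equal_at_infinity[of 0]], rotated]) (rule b)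
  then have "((\<lambda>t. 2 / zeta t - 1) \<longlongrightarrow> 0 - 1) at_infinity" by (intro tendsto_intros)
  then have "(phase \<longlongrightarrow> - 1) at_infinity" by (simp add: phase_eq[abs_def])
  then show "(phase \<longlongrightarrow> - 1) at_top" "(phase \<longlongrightarrow> - 1) at_bot"
    using at_top_le_at_infinity at_bot_le_at_infinity tendsto_mono by blast+
qed

lemma continuous_on_phase [continuous_intros]: "continuous_on S phase"
  unfolding phase_eq[abs_def] by (intro continuous_intros) auto

lemma phase_power_integrable:
  "integrable lborel (\<lambda>t. phase t ^ m * cnj (phase t) ^ n * of_real (1 / zeta_sq t))"
proof (rule Bochner_Integration.integrable_bound[OF inverse_zeta_sq_integral(1)])
  have "continuous_on UNIV (\<lambda>t. phase t ^ m * cnj (phase t) ^ n * of_real (1 / zeta_sq t))"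
    unfolding zeta_sq_def
    by (intro continuous_intros) (auto simp: add_nonneg_eq_0_iff)
  then show "(\<lambda>t. phase t ^ m * cnj (phase t) ^ n * of_real (1 / zeta_sq t)) \<in> borel_measurable lborel"
    by (simp add: borel_measurable_continuous_onI)
  show "AE t in lborel. norm (phase t ^ m * cnj (phase t) ^ n * of_real (1 / zeta_sq t)) \<le> norm (1 / zeta_sq t)"
    unfolding norm_mult norm_power complex_mod_cnj norm_phase norm_of_real by simp
qed

text \<open>
  The integrand is a constant multiple of the derivative of \<open>phase t ^ k\<close>, and the phase describes one
  full turn of the unit circle, from \<open>- 1\<close> back to \<open>- 1\<close>.
\<close>

lemma phase_power_integral_pos:
  assumes k: "0 < k"
  shows "(LINT t|lborel. phase t ^ k * of_real (1 / zeta_sq t)) = 0"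
proof -
  define C where "C = of_nat k * ((- (8 * complex_of_real pi)) * \<i>)"
  have C: "C \<noteq> 0" using k by (simp add: C_def)
  define f where "f t = phase t ^ k * complex_of_real (1 / zeta_sq t)" for t
  have eint: "einterval (-\<infinity>) \<infinity> = (UNIV :: real set)" by (auto simp: einterval_def)
  have der: "((\<lambda>t. phase t ^ k) has_vector_derivative C * f t) (at t)" for t
  proof -
    have "((\<lambda>z. z ^ k) has_field_derivative of_nat k * phase t ^ (k - 1)) (at (phase t))"
      by (auto intro!: derivative_eq_intros)
    from field_vector_diff_chain_at[OF phase_derivative this]
    have "((\<lambda>t. phase t ^ k) has_vector_derivative
        ((- (8 * pi) * \<i>) * (phase t / of_real (zeta_sq t))) * (of_nat k * phase t ^ (k - 1))) (at t)"
      by (simp add: o_def)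
    moreover have "phase t * phase t ^ (k - 1) = phase t ^ k" using k by (cases k) auto
    ultimately show ?thesis
      by (elim has_vector_derivative_eq_rhs) (simp add: C_def f_def mult_ac)
  qed
  have fi: "integrable lborel f"
    using phase_power_integrable[of k 0] unfolding f_def by simp
  have cf: "continuous_on UNIV f"
    unfolding f_def zeta_sq_def
    by (intro continuous_intros) (auto simp: add_nonneg_eq_0_iff)
  have "(LBINT t=-\<infinity>..\<infinity>. C * f t) = (- 1) ^ k - (- 1) ^ k"
  proof (rule interval_integral_FTC_integrable[where F = "\<lambda>t. phase t ^ k"])
    show "((\<lambda>t. phase t ^ k) has_vector_derivative C * f t) (at t)" for t by (rule der)
    show "isCont (\<lambda>t. C * f t) t" for t
      using cf by (intro continuous_intros) (simp add: continuous_on_eq_continuous_at)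
    show "set_integrable lborel (einterval (-\<infinity>) \<infinity>) (\<lambda>t. C * f t)"
      using fi by (simp add: eint set_integrable_def)
    show "(((\<lambda>t. phase t ^ k) \<circ> real_of_ereal) \<longlongrightarrow> (- 1) ^ k) (at_right (-\<infinity>))"
      "(((\<lambda>t. phase t ^ k) \<circ> real_of_ereal) \<longlongrightarrow> (- 1) ^ k) (at_left \<infinity>)"
      unfolding ereal_tendsto_simps1 by (intro tendsto_power phase_limits)+
  qed simp
  then have "C * (LINT t|lborel. f t) = 0"
    by (simp add: interval_lebesgue_integral_def set_lebesgue_integral_def eint)
  then show ?thesis using C unfolding f_def by simp
qed

lemma phase_power_integral:
  "(LINT t|lborel. phase t ^ m * cnj (phase t) ^ n * of_real (1 / zeta_sq t)) = (if m = n then 1 / 4 else 0)"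
proof -
  have cancel: "phase t ^ (j + k) * cnj (phase t) ^ j = phase t ^ k" for t j k
    by (simp add: power_add mult.commute mult.left_commute power_mult_distrib[symmetric] phase_mult_cnj)
  consider "m = n" | k where "0 < k" "m = n + k" | k where "0 < k" "n = m + k"
    by (metis add_diff_inverse_nat less_imp_add_positive linorder_neqE_nat)
  then show ?thesis
  proof cases
    case 1
    have "phase t ^ m * cnj (phase t) ^ n * of_real (1 / zeta_sq t) = of_real (1 / zeta_sq t)" for t
      using 1 by (simp only: power_mult_distrib[symmetric] phase_mult_cnj power_one mult_1_left)
    then show ?thesis
      using 1 by (simp only: integral_complex_of_real inverse_zeta_sq_integral(2)) simp
  next
    case 2
    then show ?thesis unfolding 2 cancel using phase_power_integral_pos[of k] by simp
  next
    case 3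
    have "phase t ^ m * cnj (phase t) ^ n * of_real (1 / zeta_sq t) = cnj (phase t ^ k * of_real (1 / zeta_sq t))" for t
    proof -
      have "phase t ^ m * cnj (phase t) ^ n = cnj (phase t ^ (m + k) * cnj (phase t) ^ m)"
        using 3 by (simp add: mult.commute)
      then show ?thesis unfolding cancel by simp
    qed
    then have "(LINT t|lborel. phase t ^ m * cnj (phase t) ^ n * of_real (1 / zeta_sq t))
       = cnj (LINT t|lborel. phase t ^ k * of_real (1 / zeta_sq t))"
      by (simp only: Bochner_Integration.integral_cnj)
    then show ?thesis using 3 phase_power_integral_pos[of k] by simp
  qed
qed

section \<open>The space-time norm\<close>

text \<open>
  The rescaling by \<open>1 / 2\<close> matches the Gaussian factors: four modes contribute \<open>exp (- 2 s)\<close> where each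
  polynomial has the argument \<open>s\<close>, and \<open>x = 2 s\<close> is the variable of \<open>Q\<close>.
\<close>

definition quartic_poly :: "nat \<Rightarrow> nat \<Rightarrow> nat \<Rightarrow> nat \<Rightarrow> real poly" where
  "quartic_poly a b c d = pcompose (Lag a * Lag b * Lag c * Lag d) [:0, 1 / 2:]"

lemma expint_quartic_poly: "expint (quartic_poly a b c d) = Q a b c d"
  unfolding expint_def Q_def laguerre_eq quartic_poly_def
  by (simp add: poly_pcompose)

definition psi4 :: "nat \<Rightarrow> nat \<Rightarrow> nat \<Rightarrow> nat \<Rightarrow> real \<Rightarrow> real^2 \<Rightarrow> complex" where
  "psi4 a b c d t x = psi a t x * psi b t x * cnj (psi c t x * psi d t x)"

lemma psi4_eq:
  "psi4 a b c d t x = phase t ^ (a + b) * cnj (phase t) ^ (c + d) *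
     of_real ((1 / zeta_sq t)\<^sup>2 * (poly (quartic_poly a b c d) (4 * pi / zeta_sq t * (norm x)\<^sup>2)
        * exp (- (4 * pi / zeta_sq t * (norm x)\<^sup>2))))"
proof -
  define s where "s = 2 * pi / zeta_sq t * (norm x)\<^sup>2"
  have s4: "4 * pi / zeta_sq t * (norm x)\<^sup>2 = 2 * s" by (simp add: s_def)
  have q: "poly (quartic_poly a b c d) (2 * s) = poly (Lag a) s * poly (Lag b) s * poly (Lag c) s * poly (Lag d) s"
    by (simp add: quartic_poly_def poly_pcompose)
  have e: "exp (- (2 * s)) = exp (- s) * exp (- s)" by (simp add: exp_add[symmetric])
  have "psi4 a b c d t x = (psi a t x * cnj (psi c t x)) * (psi b t x * cnj (psi d t x))"
    by (simp add: psi4_def mult_ac)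
  also have "\<dots> = phase t ^ (a + b) * cnj (phase t) ^ (c + d) *
     of_real ((1 / zeta_sq t)\<^sup>2 * (poly (Lag a) s * poly (Lag b) s * poly (Lag c) s * poly (Lag d) s * (exp (- s) * exp (- s))))"
    unfolding psi_mult_cnj s_def[symmetric] by (simp add: power_add power2_eq_square mult_ac)
  finally show ?thesis unfolding s4 q e .
qed

lemma psi4_space_integral:
  "integrable lborel (psi4 a b c d t)"
  "(LINT x|lborel. psi4 a b c d t x) = phase t ^ (a + b) * cnj (phase t) ^ (c + d) * of_real (1 / zeta_sq t) * of_real (Q a b c d / 4)"
proof -
  let ?c = "4 * pi / zeta_sq t"
  have c: "0 < ?c" by simp
  note I = radial_exp_poly[OF c, of "quartic_poly a b c d"]
  show "integrable lborel (psi4 a b c d t)"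
    unfolding psi4_eq[abs_def] by (intro integrable_mult_right integrable_of_real I(1))
  have "(LINT x|lborel. psi4 a b c d t x)
      = phase t ^ (a + b) * cnj (phase t) ^ (c + d) * of_real ((1 / zeta_sq t)\<^sup>2 * (pi / ?c * expint (quartic_poly a b c d)))"
    unfolding psi4_eq I(2)[symmetric] by (simp only: integral_mult_right_zero integral_complex_of_real)
  also have "(1 / zeta_sq t)\<^sup>2 * (pi / ?c * expint (quartic_poly a b c d)) = 1 / zeta_sq t * (Q a b c d / 4)"
    unfolding expint_quartic_poly by (simp add: power2_eq_square)
  finally show "(LINT x|lborel. psi4 a b c d t x) = phase t ^ (a + b) * cnj (phase t) ^ (c + d) * of_real (1 / zeta_sq t) * of_real (Q a b c d / 4)"
    by (simp only: of_real_mult mult.assoc)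
qed

lemma psi_pair_measurable [measurable]:
  "(\<lambda>p. psi n (snd p) (fst p)) \<in> borel_measurable borel"
  by (intro borel_measurable_continuous_onI continuous_on_psi continuous_intros)

lemma psi_Lp4: "(\<lambda>p. psi n (snd p) (fst p)) \<in> Lp 4"
proof -
  have n4: "complex_of_real (norm (psi n t x) ^ 4) = psi4 n n n n t x" for t x
  proof -
    have "complex_of_real (norm (psi n t x) ^ 4) = complex_of_real ((norm (psi n t x))\<^sup>2) * complex_of_real ((norm (psi n t x))\<^sup>2)"
      by (simp add: power2_eq_square power4_eq_xxxx)
    also have "\<dots> = psi4 n n n n t x" unfolding complex_norm_square psi4_def by (simp add: mult_ac)
    finally show ?thesis .
  qed
  have int: "integrable lborel (\<lambda>x. norm (psi n t x) ^ 4)" for t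
    using integrable_norm[OF psi4_space_integral(1)[of n n n n t]] unfolding n4[symmetric] norm_of_real by simp
  have I: "(LINT x|lborel. norm (psi n t x) ^ 4) = 1 / zeta_sq t * (Q n n n n / 4)" for t
  proof -
    have "complex_of_real (LINT x|lborel. norm (psi n t x) ^ 4) = (LINT x|lborel. psi4 n n n n t x)"
      unfolding n4[symmetric] integral_complex_of_real ..
    also have "\<dots> = (phase t * cnj (phase t)) ^ (n + n) * of_real (1 / zeta_sq t) * of_real (Q n n n n / 4)"
      unfolding psi4_space_integral power_mult_distrib ..
    also have "\<dots> = complex_of_real (1 / zeta_sq t * (Q n n n n / 4))"
      unfolding phase_mult_cnj by simp
    finally show ?thesis by (simp only: of_real_eq_iff)
  qed
  have "integrable (lborel \<Otimes>\<^sub>M lborel) (\<lambda>(t, x). norm (psi n t x) ^ 4)"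
  proof (rule lborel_pair.Fubini_integrable)
    show "(\<lambda>(t, x). norm (psi n t x) ^ 4) \<in> borel_measurable (lborel \<Otimes>\<^sub>M lborel)"
      unfolding lborel_prod case_prod_unfold
      by (simp, intro borel_measurable_continuous_onI continuous_intros continuous_on_psi)
    show "integrable lborel (\<lambda>t. LINT x|lborel. norm (case (t, x) of (t, x) \<Rightarrow> norm (psi n t x) ^ 4))"
    proof -
      have "(LINT x|lborel. norm (case (t, x) of (t, x) \<Rightarrow> norm (psi n t x) ^ 4)) = 1 / zeta_sq t * (Q n n n n / 4)" for t
        using I by simp
      then show ?thesis by (simp only:) (intro integrable_mult_left inverse_zeta_sq_integral(1))
    qed
    show "AE t in lborel. integrable lborel (\<lambda>x. case (t, x) of (t, x) \<Rightarrow> norm (psi n t x) ^ 4)"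
      using int by simp
  qed
  from lborel_pair.integrable_product_swap[OF this]
  have "integrable (lborel \<Otimes>\<^sub>M lborel) (\<lambda>p. norm (psi n (snd p) (fst p)) ^ 4)"
    by (simp add: case_prod_unfold)
  then show ?thesis by (simp add: Lp_def lborel_prod)
qed

text \<open>
  The integral over space produces \<open>Q\<close> and a power of the phase; the integral over time keeps only the
  resonant quadruples.
\<close>

lemma psi4_integral:
  "integrable lborel (\<lambda>p. psi4 a b c d (snd p) (fst p))"
  "(LINT p|lborel. psi4 a b c d (snd p) (fst p)) = (if a + b = c + d then of_real (Q a b c d) / 16 else 0)"
proof -
  have amgm: "x * y * (z * w) \<le> x ^ 4 + y ^ 4 + (z ^ 4 + w ^ 4)" for x y z w :: real
  proof -
    have "2 * (x * y * (z * w)) \<le> (x * y)\<^sup>2 + (z * w)\<^sup>2"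
      using sum_squares_bound[of "x * y" "z * w"] by (simp add: mult.assoc)
    moreover have "2 * (x * y)\<^sup>2 \<le> x ^ 4 + y ^ 4"
      using sum_squares_bound[of "x\<^sup>2" "y\<^sup>2"] by (simp add: power_mult_distrib power_mult[symmetric] mult.assoc)
    moreover have "2 * (z * w)\<^sup>2 \<le> z ^ 4 + w ^ 4"
      using sum_squares_bound[of "z\<^sup>2" "w\<^sup>2"] by (simp add: power_mult_distrib power_mult[symmetric] mult.assoc)
    moreover have "0 \<le> x ^ 4" "0 \<le> y ^ 4" "0 \<le> z ^ 4" "0 \<le> w ^ 4" by simp_all
    ultimately show ?thesis by linarith
  qed
  let ?n = "\<lambda>n p. norm (psi n (snd p) (fst p)) ^ 4"
  show int: "integrable lborel (\<lambda>p. psi4 a b c d (snd p) (fst p))"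
  proof (rule Bochner_Integration.integrable_bound)
    show "integrable lborel (\<lambda>p::(real^2) \<times> real. ?n a p + ?n b p + (?n c p + ?n d p))"
      by (intro Bochner_Integration.integrable_add LpD(2)[OF psi_Lp4])
    show "(\<lambda>p. psi4 a b c d (snd p) (fst p)) \<in> borel_measurable lborel"
      unfolding psi4_def
      by (simp, intro borel_measurable_continuous_onI continuous_intros continuous_on_psi)
    show "AE p in lborel. norm (psi4 a b c d (snd p) (fst p)) \<le> norm (?n a p + ?n b p + (?n c p + ?n d p))"
      unfolding psi4_def norm_mult complex_mod_cnj
      by (intro AE_I2 order_trans[OF amgm]) simp
  qed
  have int': "integrable (lborel \<Otimes>\<^sub>M lborel) (case_prod (\<lambda>x t. psi4 a b c d t x))"
    using int by (simp add: lborel_prod case_prod_unfold)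
  have "(LINT p|lborel. psi4 a b c d (snd p) (fst p)) = (LINT t|lborel. LINT x|lborel. psi4 a b c d t x)"
    using lborel_pair.integral_snd[OF int'] by (simp add: lborel_prod case_prod_unfold)
  also have "\<dots> = (LINT t|lborel. phase t ^ (a + b) * cnj (phase t) ^ (c + d) * of_real (1 / zeta_sq t)) * of_real (Q a b c d / 4)"
    unfolding psi4_space_integral by (rule integral_mult_left_zero)
  also have "\<dots> = (if a + b = c + d then of_real (Q a b c d) / 16 else 0)"
    unfolding phase_power_integral by simp
  finally show "(LINT p|lborel. psi4 a b c d (snd p) (fst p)) = (if a + b = c + d then of_real (Q a b c d) / 16 else 0)" .
qed

definition spacetime_wave :: "(nat \<Rightarrow> complex) \<Rightarrow> nat set \<Rightarrow> (real^2) \<times> real \<Rightarrow> complex" where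
  "spacetime_wave \<alpha> A p = wave \<alpha> A (snd p) (fst p)"

definition product_seq :: "(nat \<Rightarrow> complex) \<Rightarrow> nat \<times> nat \<Rightarrow> complex" where
  "product_seq \<alpha> = (\<lambda>(a, b). \<alpha> a * \<alpha> b)"

lemma spacetime_wave_Lp4: "spacetime_wave \<alpha> A \<in> Lp 4"
proof -
  have "(\<lambda>p. \<Sum>n\<in>A. \<alpha> n * psi n (snd p) (fst p)) \<in> Lp 4"
    by (intro Lp_sum Lp_cmult psi_Lp4) simp
  then show ?thesis by (simp add: spacetime_wave_def[abs_def] wave_def)
qed

lemma spacetime_wave_norm:
  assumes A: "finite A"
  shows "complex_of_real (Lp_norm 4 (spacetime_wave \<alpha> A) ^ 4)
     = 1 / 16 * (\<Sum>x\<in>resonant \<inter> ((A \<times> A) \<times> (A \<times> A)). resonant_term (product_seq \<alpha>) x)"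
proof -
  let ?c = "\<lambda>p q. product_seq \<alpha> p * cnj (product_seq \<alpha> q)"
  let ?P = "\<lambda>p q x. psi4 (fst p) (snd p) (fst q) (snd q) (snd x) (fst x)"
  have pt: "complex_of_real (norm (spacetime_wave \<alpha> A x) ^ 4)
      = (\<Sum>p\<in>A \<times> A. \<Sum>q\<in>A \<times> A. ?c p q * ?P p q x)" for x
  proof -
    define z where "z = spacetime_wave \<alpha> A x"
    have zz: "z * z = (\<Sum>p\<in>A \<times> A. product_seq \<alpha> p * (psi (fst p) (snd x) (fst x) * psi (snd p) (snd x) (fst x)))"
      unfolding z_def spacetime_wave_def wave_def sum_product sum.cartesian_product
      by (intro sum.cong refl) (auto simp: product_seq_def)
    have "complex_of_real (norm z ^ 4) = complex_of_real ((norm z)\<^sup>2) * complex_of_real ((norm z)\<^sup>2)"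
      by (simp add: power2_eq_square power4_eq_xxxx)
    also have "\<dots> = (z * z) * cnj (z * z)" unfolding complex_norm_square by simp
    also have "\<dots> = (\<Sum>p\<in>A \<times> A. \<Sum>q\<in>A \<times> A. ?c p q * ?P p q x)"
      unfolding zz cnj_sum sum_product by (intro sum.cong refl) (simp add: psi4_def mult_ac)
    finally show ?thesis unfolding z_def .
  qed
  have "complex_of_real (Lp_norm 4 (spacetime_wave \<alpha> A) ^ 4) = (LINT x|lborel. complex_of_real (norm (spacetime_wave \<alpha> A x) ^ 4))"
    by (simp only: Lp_norm_power zero_less_numeral integral_complex_of_real)
  also have "\<dots> = (\<Sum>p\<in>A \<times> A. \<Sum>q\<in>A \<times> A. ?c p q * (LINT x|lborel. ?P p q x))"
    unfolding pt by (simp add: Bochner_Integration.integral_sum psi4_integral(1))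
  also have "\<dots> = (\<Sum>p\<in>A \<times> A. \<Sum>q\<in>A \<times> A. if (p, q) \<in> resonant then 1 / 16 * resonant_term (product_seq \<alpha>) (p, q) else 0)"
    by (intro sum.cong refl) (auto simp: psi4_integral(2) resonant_def diagonal_def resonant_term_def)
  also have "\<dots> = (\<Sum>x\<in>(A \<times> A) \<times> (A \<times> A). if x \<in> resonant then 1 / 16 * resonant_term (product_seq \<alpha>) x else 0)"
    unfolding sum.cartesian_product by (intro sum.cong refl) auto
  also have "\<dots> = (\<Sum>x\<in>((A \<times> A) \<times> (A \<times> A)) \<inter> resonant. 1 / 16 * resonant_term (product_seq \<alpha>) x)"
    using A by (intro sum.inter_restrict[symmetric]) auto
  finally show ?thesis by (simp add: sum_distrib_left Int_commute)
qed

lemma product_seq_restrict_norm: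
  fixes \<alpha> :: "nat \<Rightarrow> complex"
  assumes A: "finite A"
  defines "\<beta> \<equiv> (\<lambda>n. if n \<in> A then \<alpha> n else 0)"
  shows "product_seq \<beta> \<in> G" "(G_norm (product_seq \<beta>))\<^sup>2 = (\<Sum>n\<in>A. (norm (\<alpha> n))\<^sup>2)\<^sup>2"
proof -
  have h: "((\<lambda>p. (norm (product_seq \<beta> p))\<^sup>2) has_sum (\<Sum>p\<in>A \<times> A. (norm (product_seq \<beta> p))\<^sup>2)) UNIV"
    using A by (intro has_sum_finite_neutralI[of "A \<times> A"]) (auto simp: product_seq_def \<beta>_def split: if_splits)
  then show "product_seq \<beta> \<in> G" by (auto simp: G_def summable_on_def)
  have "(\<Sum>p\<in>A \<times> A. (norm (product_seq \<beta> p))\<^sup>2) = (\<Sum>n\<in>A. (norm (\<alpha> n))\<^sup>2)\<^sup>2"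
    unfolding power2_eq_square[of "sum _ _"] sum_product sum.cartesian_product
    by (intro sum.cong refl) (auto simp: product_seq_def \<beta>_def norm_mult power_mult_distrib)
  then show "(G_norm (product_seq \<beta>))\<^sup>2 = (\<Sum>n\<in>A. (norm (\<alpha> n))\<^sup>2)\<^sup>2"
    unfolding G_norm_sq infsumI[OF h] .
qed

text \<open>
  The quadratic form with absolute values is bounded by the norm, as the operator is a contraction
  with nonnegative entries. This makes the partial sums a Cauchy sequence in the space-time norm.
\<close>

lemma spacetime_wave_norm_le:
  assumes A: "finite A"
  shows "Lp_norm 4 (spacetime_wave \<alpha> A) ^ 4 \<le> 1 / 16 * (\<Sum>n\<in>A. (norm (\<alpha> n))\<^sup>2)\<^sup>2"
proof -
  \<comment> \<open>truncating the coefficients changes none of the terms in the sum over \<open>A\<close>\<close>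
  define \<beta> where "\<beta> n = (if n \<in> A then \<alpha> n else 0)" for n
  let ?F = "resonant \<inter> ((A \<times> A) \<times> (A \<times> A))"
  have F: "finite ?F" using A by auto
  have "Lp_norm 4 (spacetime_wave \<alpha> A) ^ 4 = norm (complex_of_real (Lp_norm 4 (spacetime_wave \<alpha> A) ^ 4))"
    unfolding norm_of_real by simp
  also have "\<dots> = 1 / 16 * norm (\<Sum>x\<in>?F. resonant_term (product_seq \<alpha>) x)"
    unfolding spacetime_wave_norm[OF A] norm_mult by simp
  also have "(\<Sum>x\<in>?F. resonant_term (product_seq \<alpha>) x) = (\<Sum>x\<in>?F. resonant_term (product_seq \<beta>) x)"
    by (intro sum.cong refl) (auto simp: resonant_term_def product_seq_def \<beta>_def)
  also have "norm (\<Sum>x\<in>?F. resonant_term (product_seq \<beta>) x) \<le> (\<Sum>x\<in>?F. norm (resonant_term (product_seq \<beta>) x))"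
    by (rule norm_sum)
  also have "\<dots> \<le> (G_norm (product_seq \<beta>))\<^sup>2"
    using product_seq_restrict_norm(1)[OF A] F unfolding \<beta>_def by (intro resonant_term_finite_sum_le) auto
  also have "\<dots> = (\<Sum>n\<in>A. (norm (\<alpha> n))\<^sup>2)\<^sup>2"
    using product_seq_restrict_norm(2)[OF A] unfolding \<beta>_def .
  finally show ?thesis by simp
qed

lemma product_seq_norm:
  assumes s: "(\<lambda>n. (norm (\<alpha> n))\<^sup>2) sums S"
  shows "product_seq \<alpha> \<in> G" "(G_norm (product_seq \<alpha>))\<^sup>2 = S\<^sup>2"
proof -
  have h: "((\<lambda>n. (norm (\<alpha> n))\<^sup>2) has_sum S) UNIV"
    by (rule sums_nonneg_imp_has_sum[OF s]) simp
  have S: "0 \<le> S" using h by (rule has_sum_nonneg) simp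
  have F: "(\<Sum>n\<in>F. (norm (\<alpha> n))\<^sup>2) \<le> S" if "finite F" for F
    using finite_sum_le_has_sum[OF h that] by simp
  have le: "(\<Sum>p\<in>F. (norm (product_seq \<alpha> p))\<^sup>2) \<le> S\<^sup>2" if "finite F" for F
  proof -
    let ?A = "fst ` F \<union> snd ` F"
    have A: "finite ?A" using that by simp
    have "(\<Sum>p\<in>F. (norm (product_seq \<alpha> p))\<^sup>2) \<le> (\<Sum>p\<in>?A \<times> ?A. (norm (product_seq \<alpha> p))\<^sup>2)"
      using that by (intro sum_mono2) force+
    also have "\<dots> = (\<Sum>n\<in>?A. (norm (\<alpha> n))\<^sup>2)\<^sup>2"
      unfolding power2_eq_square[of "sum _ _"] sum_product sum.cartesian_product
      by (intro sum.cong refl) (auto simp: product_seq_def norm_mult power_mult_distrib)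
    also have "\<dots> \<le> S\<^sup>2" by (intro power_mono F A sum_nonneg) auto
    finally show ?thesis .
  qed
  have sm: "(\<lambda>p. (norm (product_seq \<alpha> p))\<^sup>2) summable_on UNIV"
    by (rule nonneg_bdd_above_summable_on) (auto intro!: bdd_aboveI[of _ "S\<^sup>2"] le)
  then show "product_seq \<alpha> \<in> G" by (simp add: G_def)
  have "(\<Sum>\<^sub>\<infinity>p. (norm (product_seq \<alpha> p))\<^sup>2) = S\<^sup>2"
  proof (rule antisym)
    show "(\<Sum>\<^sub>\<infinity>p. (norm (product_seq \<alpha> p))\<^sup>2) \<le> S\<^sup>2"
      by (rule infsum_le_finite_sums[OF sm]) (auto intro: le)
    have "(\<lambda>N. (\<Sum>n<N. (norm (\<alpha> n))\<^sup>2)\<^sup>2) \<longlonglongrightarrow> S\<^sup>2"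
      using s unfolding sums_def by (intro tendsto_intros)
    moreover have "(\<Sum>n<N. (norm (\<alpha> n))\<^sup>2)\<^sup>2 \<le> (\<Sum>\<^sub>\<infinity>p. (norm (product_seq \<alpha> p))\<^sup>2)" for N
    proof -
      have "(\<Sum>n<N. (norm (\<alpha> n))\<^sup>2)\<^sup>2 = (\<Sum>p\<in>{..<N} \<times> {..<N}. (norm (product_seq \<alpha> p))\<^sup>2)"
        unfolding power2_eq_square[of "sum _ _"] sum_product sum.cartesian_product
        by (intro sum.cong refl) (auto simp: product_seq_def norm_mult power_mult_distrib)
      also have "\<dots> \<le> (\<Sum>\<^sub>\<infinity>p. (norm (product_seq \<alpha> p))\<^sup>2)"
        by (rule finite_sum_le_infsum[OF sm]) auto
      finally show ?thesis .
    qed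
    ultimately show "S\<^sup>2 \<le> (\<Sum>\<^sub>\<infinity>p. (norm (product_seq \<alpha> p))\<^sup>2)" by (intro LIMSEQ_le_const2) auto
  qed
  then show "(G_norm (product_seq \<alpha>))\<^sup>2 = S\<^sup>2" unfolding G_norm_sq .
qed

text \<open>
  Fubini: a measurable property that holds almost everywhere in space for each time holds almost
  everywhere in space-time.
\<close>

lemma AE_slices:
  fixes P :: "'a::euclidean_space \<times> real \<Rightarrow> bool"
  assumes m: "Measurable.pred borel P" and ae: "\<And>t. AE x in lborel. P (x, t)"
  shows "AE p in lborel. P p"
proof -
  have s: "{p \<in> space (lborel \<Otimes>\<^sub>M lborel). P p} \<in> sets (lborel \<Otimes>\<^sub>M lborel)"
    unfolding lborel_prod using m by (simp add: pred_def)
  have "AE x in lborel. AE t in lborel. P (x, t)"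
    using ae s by (subst lborel_pair.AE_commute) auto
  from lborel_pair.AE_pair_measure[OF s this] show ?thesis by (simp only: lborel_prod)
qed

text \<open>
  The identity for partial sums passes to the limit: on the left by the Cauchy property in the
  space-time norm, on the right by absolute convergence of the quadruple sum.
\<close>

lemma wave_limit_Lp4:
  fixes u :: "(real^2) \<times> real \<Rightarrow> complex"
  assumes s: "summable (\<lambda>n. (norm (\<alpha> n))\<^sup>2)"
    and u[measurable]: "u \<in> borel_measurable borel" and r: "\<And>k. k \<le> r k"
    and ae: "\<And>t. AE x in lborel. (\<lambda>k. wave \<alpha> {..<r k} t x) \<longlonglongrightarrow> u (x, t)"
  shows "u \<in> Lp 4" "complex_of_real (Lp_norm 4 u ^ 4) = 1 / 16 * G_inner (product_seq \<alpha>) (Q_op (product_seq \<alpha>))"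
proof -
  let ?w = "\<lambda>N. spacetime_wave \<alpha> {..<N}"
  have wm[measurable]: "?w N \<in> borel_measurable borel" for N
    unfolding spacetime_wave_def[abs_def] by (rule wave_measurable)
  have ae': "AE p in lborel. (\<lambda>k. ?w (r k) p) \<longlonglongrightarrow> u p"
  proof -
    have "AE p in lborel. (\<lambda>k. norm (?w (r k) p - u p)) \<longlonglongrightarrow> 0"
    proof (rule AE_slices)
      show "AE x in lborel. (\<lambda>k. norm (?w (r k) (x, t) - u (x, t))) \<longlonglongrightarrow> 0" for t
        using ae[of t] by eventually_elim (simp add: spacetime_wave_def tendsto_norm_zero_iff LIM_zero_iff)
    qed measurable
    then show ?thesis by eventually_elim (simp add: tendsto_norm_zero_iff LIM_zero_iff)
  qed
  define tl where "tl N = (\<Sum>n. (norm (\<alpha> (n + N)))\<^sup>2)" for N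
  define \<tau> where "\<tau> N = root 4 (1 / 16 * (tl N)\<^sup>2)" for N
  have \<tau>0: "\<tau> \<longlonglongrightarrow> 0"
  proof -
    have "tl \<longlonglongrightarrow> 0" unfolding tl_def[abs_def] by (rule suminf_exist_split2[OF s])
    then have "(\<lambda>N. root 4 (1 / 16 * (tl N)\<^sup>2)) \<longlonglongrightarrow> root 4 (1 / 16 * 0\<^sup>2)"
      by (intro tendsto_real_root tendsto_intros)
    then show ?thesis by (simp add: \<tau>_def[abs_def])
  qed
  have \<tau>_nonneg: "0 \<le> \<tau> N" for N by (simp add: \<tau>_def)
  have wle: "Lp_norm 4 (spacetime_wave \<alpha> {N..<M}) \<le> \<tau> N" for N M
  proof -
    have "(\<Sum>n\<in>{N..<M}. (norm (\<alpha> n))\<^sup>2) = (\<Sum>n<M - N. (norm (\<alpha> (n + N)))\<^sup>2)"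
      by (rule sum.reindex_bij_witness[of _ "\<lambda>n. n + N" "\<lambda>n. n - N"]) auto
    also have "\<dots> \<le> tl N"
      unfolding tl_def using summable_ignore_initial_segment[OF s] by (intro sum_le_suminf) auto
    finally have "(\<Sum>n\<in>{N..<M}. (norm (\<alpha> n))\<^sup>2)\<^sup>2 \<le> (tl N)\<^sup>2" by (intro power_mono sum_nonneg) auto
    then have "Lp_norm 4 (spacetime_wave \<alpha> {N..<M}) ^ 4 \<le> 1 / 16 * (tl N)\<^sup>2"
      using spacetime_wave_norm_le[of "{N..<M}" \<alpha>] by simp
    also have "\<dots> = \<tau> N ^ 4" unfolding \<tau>_def by simp
    finally show ?thesis using \<tau>_nonneg by (simp add: power_mono_iff)
  qed
  have wd: "Lp_norm 4 (\<lambda>p. ?w M p - ?w N p) \<le> \<tau> N" if "N \<le> M" for M N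
    unfolding spacetime_wave_def[of \<alpha> "{..<_}"] wave_diff[OF that] by (rule wle[unfolded spacetime_wave_def[abs_def]])
  have um: "u \<in> borel_measurable lborel" by simp
  note limits = Lp_limit_of_subsequence[OF spacetime_wave_Lp4 um r ae' _ wd, OF zero_less_numeral]
  show uL: "u \<in> Lp 4" by (rule limits(1))
  have "(\<lambda>N. Lp_norm 4 (?w N)) \<longlonglongrightarrow> Lp_norm 4 u"
  proof (rule LIM_zero_cancel, rule Lim_null_comparison[OF always_eventually \<tau>0], rule allI)
    fix N
    have "\<bar>Lp_norm 4 u - Lp_norm 4 (?w N)\<bar> \<le> Lp_norm 4 (\<lambda>p. u p - ?w N p)"
      by (rule Lp_norm_diff_le[OF uL spacetime_wave_Lp4]) simp
    then show "norm (Lp_norm 4 (?w N) - Lp_norm 4 u) \<le> \<tau> N" using limits(3)[of N] by (simp add: abs_minus_commute)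
  qed
  then have "(\<lambda>N. complex_of_real (Lp_norm 4 (?w N) ^ 4)) \<longlonglongrightarrow> complex_of_real (Lp_norm 4 u ^ 4)"
    by (intro tendsto_intros)
  moreover have "(\<lambda>N. complex_of_real (Lp_norm 4 (?w N) ^ 4)) \<longlonglongrightarrow> 1 / 16 * G_inner (product_seq \<alpha>) (Q_op (product_seq \<alpha>))"
    unfolding spacetime_wave_norm[OF finite_lessThan]
    by (intro tendsto_mult tendsto_const resonant_term_square_limit product_seq_norm(1)[OF summable_sums[OF s]])
  ultimately show "complex_of_real (Lp_norm 4 u ^ 4) = 1 / 16 * G_inner (product_seq \<alpha>) (Q_op (product_seq \<alpha>))"
    by (rule LIMSEQ_unique)
qed

text \<open>
  By uniqueness, any solution agrees almost everywhere in space-time with the limit of the evolved series.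
\<close>

lemma Strichartz_identity:
  assumes f: "f \<in> Lp 2"
    and lim: "(\<lambda>N. Lp_norm 2 (\<lambda>x. f x - (\<Sum>n<N. \<alpha> n * Psi n x))) \<longlonglongrightarrow> 0"
  shows "product_seq \<alpha> \<in> G" "\<exists>u. schrodinger_solution f u"
    "\<And>u. schrodinger_solution f u \<Longrightarrow> u \<in> Lp 4 \<and>
       complex_of_real (Lp_norm 4 u ^ 4) = 1 / 16 * G_inner (product_seq \<alpha>) (Q_op (product_seq \<alpha>))"
    "(2 powr (- 1 / 2) * Lp_norm 2 f) ^ 4 = 1 / 16 * (G_norm (product_seq \<alpha>))\<^sup>2"
proof -
  note sums = Psi_expansion_sums[OF f lim]
  note s = sums_summable[OF sums]
  show "product_seq \<alpha> \<in> G" by (rule product_seq_norm(1)[OF sums])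
  obtain v r where v: "v \<in> borel_measurable borel" "\<And>k. k \<le> r k"
    "\<And>t. AE x in lborel. (\<lambda>k. wave \<alpha> {..<r k} t x) \<longlonglongrightarrow> v (x, t)"
    by (rule wave_limit_exists[OF s]) blast
  have sol: "schrodinger_solution f v" by (rule wave_limit_solution[OF s v f lim])
  then show "\<exists>u. schrodinger_solution f u" by blast
  note V = wave_limit_Lp4[OF s v]
  show "u \<in> Lp 4 \<and> complex_of_real (Lp_norm 4 u ^ 4) = 1 / 16 * G_inner (product_seq \<alpha>) (Q_op (product_seq \<alpha>))"
    if u: "schrodinger_solution f u" for u
  proof -
    have um: "u \<in> borel_measurable lborel" by (rule schrodinger_solutionD(1)[OF u])
    have [measurable]: "u \<in> borel_measurable borel" "v \<in> borel_measurable borel" using um v(1) by simp_all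
    have "AE p in lborel. v p = u p"
    proof (rule AE_slices)
      show "AE x in lborel. v (x, t) = u (x, t)" for t by (rule schrodinger_solution_unique[OF sol u])
    qed measurable
    from Lp_cong_AE[OF this _ um] v(1) V show ?thesis by simp
  qed
  have "(2 powr (- 1 / 2) * Lp_norm 2 f) ^ 4 = (2 powr (- 1 / 2)) ^ 4 * ((Lp_norm 2 f)\<^sup>2)\<^sup>2"
    by (simp add: power_mult_distrib power_mult[symmetric])
  also have "(2 powr (- 1 / 2)) ^ 4 = (1 / 4 :: real)"
  proof -
    have "(2 powr (- 1 / 2)) ^ 4 = (2 powr (- 1 / 2)) powr real 4" by (rule powr_realpow[symmetric]) simp
    also have "\<dots> = (2 :: real) powr (- 1 / 2 * real 4)" by (rule powr_powr)
    also have "\<dots> = inverse (2 powr 2)" by (subst powr_minus[symmetric]) simp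
    finally show ?thesis by simp
  qed
  also have "1 / 4 * ((Lp_norm 2 f)\<^sup>2)\<^sup>2 = 1 / 16 * (2 * (Lp_norm 2 f)\<^sup>2)\<^sup>2"
    by (simp add: power_mult_distrib)
  finally show "(2 powr (- 1 / 2) * Lp_norm 2 f) ^ 4 = 1 / 16 * (G_norm (product_seq \<alpha>))\<^sup>2"
    unfolding product_seq_norm(2)[OF sums] .
qed

theorem theorem6:
  shows "(\<forall>(f :: real^2 \<Rightarrow> complex) (\<alpha> :: nat \<Rightarrow> complex).
            radial f \<longrightarrow> f \<in> Lp 2 \<longrightarrow>
            (\<lambda>N. Lp_norm 2 (\<lambda>x. f x - (\<Sum>n<N. \<alpha> n * Psi n x))) \<longlonglongrightarrow> 0 \<longrightarrow>
            (let \<phi> = (\<lambda>(a, b). \<alpha> a * \<alpha> b) in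
               \<phi> \<in> G \<and>
               (\<exists>u. schrodinger_solution f u) \<and>
               (\<forall>u. schrodinger_solution f u \<longrightarrow>
                  u \<in> Lp 4 \<and>
                  complex_of_real (Lp_norm 4 u ^ 4) = 1 / 16 * G_inner \<phi> (Q_op \<phi>)) \<and>
               (2 powr (- 1 / 2) * Lp_norm 2 f) ^ 4 = 1 / 16 * (G_norm \<phi>)\<^sup>2))
       \<and> (\<forall>S. positive_semidefinite (S + 1) (Q_mat S) \<and>
              doubly_stochastic (S + 1) (Q_mat S) \<and>
              (\<forall>a\<le>S. \<forall>c\<le>S. 0 < Q_mat S a c))
       \<and> (\<forall>\<phi>\<in>G. Q_op \<phi> \<in> G)
       \<and> G_opnorm Q_op = 1
       \<and> (\<forall>\<phi>\<in>G. G_inner \<phi> (Q_op \<phi>) = complex_of_real ((G_norm \<phi>)\<^sup>2) \<longleftrightarrow>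
              (\<forall>a b c d. a + b = c + d \<longrightarrow> \<phi> (a, b) = \<phi> (c, d)))"
  unfolding Let_def product_seq_def[symmetric]
proof (intro conjI allI impI ballI)
  fix f :: "real^2 \<Rightarrow> complex" and \<alpha> :: "nat \<Rightarrow> complex"
  assume f: "f \<in> Lp 2" "(\<lambda>N. Lp_norm 2 (\<lambda>x. f x - (\<Sum>n<N. \<alpha> n * Psi n x))) \<longlonglongrightarrow> 0"
  note I = Strichartz_identity[OF f]
  show "product_seq \<alpha> \<in> G" "\<exists>u. schrodinger_solution f u" by (fact I(1), fact I(2))
  show "(2 powr (- 1 / 2) * Lp_norm 2 f) ^ 4 = 1 / 16 * (G_norm (product_seq \<alpha>))\<^sup>2" by (fact I(4))
  fix u assume u: "schrodinger_solution f u"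
  show "u \<in> Lp 4" "complex_of_real (Lp_norm 4 u ^ 4) = 1 / 16 * G_inner (product_seq \<alpha>) (Q_op (product_seq \<alpha>))"
    using I(3)[OF u] by blast+
qed (simp_all only: Q_mat_positive_semidefinite Q_mat_doubly_stochastic Q_mat_pos Q_op_contraction(1)
    G_opnorm_Q_op Q_op_equality_iff)

end
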